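(* Let $(G,d)$ be a simply connected, sub-Riemannian, $2$-step nilpotent Lie group, and denote by $d_\infty$ its canonical asymptotic metric. If $$\lvert d_\infty(p,q)^2-d(p,q)^2\rvert\to 0\quad\text{as }d(p,q)\to\infty,$$ then $d=d_\infty$.
   Context: Let $G$ be a connected Lie group with identity $e$ and Lie algebra $\mathfrak g=T_eG$; $L_p$ denotes left translation by $p$. The group is $2$-step nilpotent if its nilpotency step is $2$, i.e. $[\mathfrak g,[\mathfrak g,\mathfrak g]]=0$ and $[\mathfrak g,\mathfrak g]\neq 0$. A sub-Riemannian structure $(\Delta,\rho)$ on $G$ consists of a left-invariant subbundle $\Delta\subseteq TG$ that is bracket-generating (the Lie algebra generated by $\Delta_e$ is $\mathfrak g$) and a left-invariant metric tensor $\rho$ on $\Delta$. The case $\Delta=TG$ (Riemannian) is included. An absolutely continuous curve $\gamma:[0,1]\to G$ is $\Delta$-horizontal if $\dot\gamma(t)\in\Delta_{\gamma(t)}$ for a.e. $t$; its length is $\ell(\gamma)=\int_0^1\sqrt{\rho(\dot\gamma(t),\dot\gamma(t))}\,dt$. The associated (left-invariant) sub-Riemannian metric is $d(p,q)=\inf\{\ell(\gamma): \gamma \text{ is } \Delta\text{-horizontal},\ p,q\in\gamma([0,1])\}$. A sub-Riemannian Lie group is a pair $(G,d)$ of this kind. Canonical asymptotic metric: given $(\Delta,\rho)$ with metric $d$, let $V=\{v\in\Delta_e: \rho(v,w)=0 \text{ for every } w\in\Delta_e\cap[\mathfrak g,\mathfrak g]\}$ and $\Delta_\infty=\bigcup_{p\in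 G}dL_p(V)\subseteq\Delta$. Then $d_\infty(p,q)=\inf\{\ell(\gamma):\gamma:[0,1]\to G\text{ is }\Delta_\infty\text{-horizontal},\ p,q\in\gamma([0,1])\}$. *)

theory Defs
  imports "HOL-Analysis.Analysis"
begin

section \<open>Smooth manifolds\<close>

text \<open>Only meant for open \<open>S\<close>: \<open>Ck_on k f S\<close> says that all iterated directional derivatives of
  \<open>f\<close> up to order \<open>k\<close> exist and are continuous on \<open>S\<close>.\<close>

primrec Ck_on :: "nat \<Rightarrow> ('a::real_normed_vector \<Rightarrow> 'b::real_normed_vector) \<Rightarrow> 'a set \<Rightarrow> bool" where
  "Ck_on 0 f S \<longleftrightarrow> continuous_on S f"
| "Ck_on (Suc k) f S \<longleftrightarrow>
     (\<forall>x\<in>S. f differentiable (at x)) \<and> (\<forall>v. Ck_on k (\<lambda>x. frechet_derivative f (at x) v) S)"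

definition smooth_on :: "'a set \<Rightarrow> ('a::real_normed_vector \<Rightarrow> 'b::real_normed_vector) \<Rightarrow> bool" where
  "smooth_on S f \<longleftrightarrow> (\<forall>k. Ck_on k f S)"

text \<open>A chart is a pair of its domain and its coordinate map; the values of the coordinate map
  outside the domain are irrelevant.\<close>

type_synonym ('g, 'a) chart = "'g set \<times> ('g \<Rightarrow> 'a)"

abbreviation chart_inv :: "('g, 'a) chart \<Rightarrow> 'a \<Rightarrow> 'g" where
  "chart_inv c \<equiv> inv_into (fst c) (snd c)"

definition smooth_atlas ::
    "('g::topological_space, 'a::euclidean_space) chart set \<Rightarrow> bool" where
  "smooth_atlas A \<longleftrightarrow>
     (\<forall>c\<in>A. open (fst c) \<and> open (snd c ` fst c) \<and>
            homeomorphism (fst c) (snd c ` fst c) (snd c) (chart_inv c)) \<and>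
     (\<Union>c\<in>A. fst c) = UNIV \<and>
     (\<forall>c\<in>A. \<forall>c'\<in>A. smooth_on (snd c ` (fst c \<inter> fst c')) (snd c' \<circ> chart_inv c))"

definition smooth_map ::
    "('g::topological_space, 'a::euclidean_space) chart set \<Rightarrow>
     ('h::topological_space, 'b::euclidean_space) chart set \<Rightarrow> ('g \<Rightarrow> 'h) \<Rightarrow> bool" where
  "smooth_map A B f \<longleftrightarrow> continuous_on UNIV f \<and>
     (\<forall>c\<in>A. \<forall>c'\<in>B. smooth_on (snd c ` (fst c \<inter> f -` fst c')) (snd c' \<circ> f \<circ> chart_inv c))"

definition prod_atlas ::
    "('g, 'a) chart set \<Rightarrow> ('h, 'b) chart set \<Rightarrow> ('g \<times> 'h, 'a \<times> 'b) chart set" where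
  "prod_atlas A B = {(fst c \<times> fst c', map_prod (snd c) (snd c')) | c c'. c \<in> A \<and> c' \<in> B}"

text \<open>For every point \<open>p\<close> a preferred chart around \<open>p\<close> is selected. The tangent space at \<open>p\<close> is
  the model space \<open>'a\<close>, a tangent vector being represented by its components in the preferred chart
  at its base point. Tangent maps, velocities and vector fields are expressed accordingly.\<close>

definition chart_at :: "('g, 'a) chart set \<Rightarrow> 'g \<Rightarrow> ('g, 'a) chart" where
  "chart_at A p = (SOME c. c \<in> A \<and> p \<in> fst c)"

definition tangent_map ::
    "('g, 'a::euclidean_space) chart set \<Rightarrow> ('g \<Rightarrow> 'g) \<Rightarrow> 'g \<Rightarrow> 'a \<Rightarrow> 'a" where
  "tangent_map A f p =
     frechet_derivative (snd (chart_at A (f p)) \<circ> f \<circ> chart_inv (chart_at A p))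
       (at (snd (chart_at A p) p))"

text \<open>\<open>field_coord A c X\<close> is the coordinate expression in the chart \<open>c\<close> of the vector field \<open>X\<close>: the
  vector \<open>X q\<close>, given in the preferred chart at \<open>q\<close>, is transformed to the chart \<open>c\<close>.\<close>

definition field_coord ::
    "('g, 'a::euclidean_space) chart set \<Rightarrow> ('g, 'a) chart \<Rightarrow> ('g \<Rightarrow> 'a) \<Rightarrow> 'a \<Rightarrow> 'a" where
  "field_coord A c X x =
     (let q = chart_inv c x in
      frechet_derivative (snd c \<circ> chart_inv (chart_at A q)) (at (snd (chart_at A q) q)) (X q))"

text \<open>\<open>[X, Y] = DY X - DX Y\<close> in coordinates, that is, \<open>[X, Y] f = X (Y f) - Y (X f)\<close>.\<close>

definition field_bracket ::
    "('g, 'a::euclidean_space) chart set \<Rightarrow> ('g \<Rightarrow> 'a) \<Rightarrow> ('g \<Rightarrow> 'a) \<Rightarrow> 'g \<Rightarrow> 'a" where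
  "field_bracket A X Y p =
     (let c = chart_at A p; x = snd c p; X' = field_coord A c X; Y' = field_coord A c Y in
      frechet_derivative Y' (at x) (X' x) - frechet_derivative X' (at x) (Y' x))"

section \<open>Lie groups\<close>

definition lie_group ::
    "('g::{t2_space,second_countable_topology}, 'a::euclidean_space) chart set \<Rightarrow>
     ('g \<Rightarrow> 'g \<Rightarrow> 'g) \<Rightarrow> 'g \<Rightarrow> ('g \<Rightarrow> 'g) \<Rightarrow> bool" where
  "lie_group A mul e iv \<longleftrightarrow>
     Groups.group mul e iv \<and> smooth_atlas A \<and>
     smooth_map (prod_atlas A A) A (\<lambda>(p, q). mul p q) \<and> smooth_map A A iv"

definition left_inv_field ::
    "('g, 'a::euclidean_space) chart set \<Rightarrow> ('g \<Rightarrow> 'g \<Rightarrow> 'g) \<Rightarrow> 'g \<Rightarrow> 'a \<Rightarrow> 'g \<Rightarrow> 'a" where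
  "left_inv_field A mul e v p = tangent_map A (mul p) e v"

text \<open>The Lie algebra is the tangent space at \<open>e\<close>, i.e. the type \<open>'a\<close>, with the following bracket.\<close>

definition lie_bracket ::
    "('g, 'a::euclidean_space) chart set \<Rightarrow> ('g \<Rightarrow> 'g \<Rightarrow> 'g) \<Rightarrow> 'g \<Rightarrow> 'a \<Rightarrow> 'a \<Rightarrow> 'a" where
  "lie_bracket A mul e v w =
     field_bracket A (left_inv_field A mul e v) (left_inv_field A mul e w) e"

definition bracket_space ::
    "('g, 'a::euclidean_space) chart set \<Rightarrow> ('g \<Rightarrow> 'g \<Rightarrow> 'g) \<Rightarrow> 'g \<Rightarrow> 'a set \<Rightarrow> 'a set \<Rightarrow> 'a set" where
  "bracket_space A mul e S T = span {lie_bracket A mul e v w | v w. v \<in> S \<and> w \<in> T}"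

definition two_step_nilpotent ::
    "('g, 'a::euclidean_space) chart set \<Rightarrow> ('g \<Rightarrow> 'g \<Rightarrow> 'g) \<Rightarrow> 'g \<Rightarrow> bool" where
  "two_step_nilpotent A mul e \<longleftrightarrow>
     bracket_space A mul e UNIV (bracket_space A mul e UNIV UNIV) = {0} \<and>
     bracket_space A mul e UNIV UNIV \<noteq> {0}"

definition lie_subalgebra ::
    "('g, 'a::euclidean_space) chart set \<Rightarrow> ('g \<Rightarrow> 'g \<Rightarrow> 'g) \<Rightarrow> 'g \<Rightarrow> 'a set \<Rightarrow> bool" where
  "lie_subalgebra A mul e S \<longleftrightarrow>
     subspace S \<and> (\<forall>v\<in>S. \<forall>w\<in>S. lie_bracket A mul e v w \<in> S)"

section \<open>Sub-Riemannian structures\<close>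

definition inner_product_on :: "'a::real_vector set \<Rightarrow> ('a \<Rightarrow> 'a \<Rightarrow> real) \<Rightarrow> bool" where
  "inner_product_on S r \<longleftrightarrow>
     (\<forall>v\<in>S. \<forall>w\<in>S. r v w = r w v) \<and>
     (\<forall>u\<in>S. \<forall>v\<in>S. \<forall>w\<in>S. r (u + v) w = r u w + r v w) \<and>
     (\<forall>a. \<forall>v\<in>S. \<forall>w\<in>S. r (a *\<^sub>R v) w = a * r v w) \<and>
     (\<forall>v\<in>S. v \<noteq> 0 \<longrightarrow> r v v > 0)"

text \<open>\<open>\<Delta> p\<close> is the fibre at \<open>p\<close> of the distribution and \<open>\<rho> p\<close> the metric tensor at \<open>p\<close>, whose values
  matter on \<open>\<Delta> p\<close> only. Smoothness of both is a consequence of left invariance.\<close>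

definition sub_riemannian_structure ::
    "('g, 'a::euclidean_space) chart set \<Rightarrow> ('g \<Rightarrow> 'g \<Rightarrow> 'g) \<Rightarrow> 'g \<Rightarrow>
     ('g \<Rightarrow> 'a set) \<Rightarrow> ('g \<Rightarrow> 'a \<Rightarrow> 'a \<Rightarrow> real) \<Rightarrow> bool" where
  "sub_riemannian_structure A mul e \<Delta> \<rho> \<longleftrightarrow>
     (\<forall>p. subspace (\<Delta> p)) \<and>
     (\<forall>p q. tangent_map A (mul p) q ` \<Delta> q = \<Delta> (mul p q)) \<and>
     lie_subalgebra A mul e hull \<Delta> e = UNIV \<and>
     (\<forall>p. inner_product_on (\<Delta> p) (\<rho> p)) \<and>
     (\<forall>p q. \<forall>v\<in>\<Delta> q. \<forall>w\<in>\<Delta> q.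
        \<rho> (mul p q) (tangent_map A (mul p) q v) (tangent_map A (mul p) q w) = \<rho> q v w)"

definition abs_continuous_on :: "real \<Rightarrow> real \<Rightarrow> (real \<Rightarrow> 'a::real_normed_vector) \<Rightarrow> bool" where
  "abs_continuous_on a b f \<longleftrightarrow>
     (\<forall>\<epsilon>>0. \<exists>\<delta>>0. \<forall>D. D division_of (\<Union>D) \<and> \<Union>D \<subseteq> {a..b} \<and> (\<Sum>K\<in>D. Sup K - Inf K) < \<delta> \<longrightarrow>
        (\<Sum>K\<in>D. norm (f (Sup K) - f (Inf K))) < \<epsilon>)"

definition abs_continuous_curve ::
    "('g::topological_space, 'a::euclidean_space) chart set \<Rightarrow> (real \<Rightarrow> 'g) \<Rightarrow> bool" where
  "abs_continuous_curve A \<gamma> \<longleftrightarrow> continuous_on {0..1} \<gamma> \<and>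
     (\<forall>c\<in>A. \<forall>a b. 0 \<le> a \<and> a \<le> b \<and> b \<le> 1 \<and> \<gamma> ` {a..b} \<subseteq> fst c \<longrightarrow>
        abs_continuous_on a b (snd c \<circ> \<gamma>))"

definition curve_differentiable ::
    "('g, 'a::euclidean_space) chart set \<Rightarrow> (real \<Rightarrow> 'g) \<Rightarrow> real \<Rightarrow> bool" where
  "curve_differentiable A \<gamma> t \<longleftrightarrow>
     (snd (chart_at A (\<gamma> t)) \<circ> \<gamma>) differentiable (at t within {0..1})"

definition velocity ::
    "('g, 'a::euclidean_space) chart set \<Rightarrow> (real \<Rightarrow> 'g) \<Rightarrow> real \<Rightarrow> 'a" where
  "velocity A \<gamma> t = vector_derivative (snd (chart_at A (\<gamma> t)) \<circ> \<gamma>) (at t within {0..1})"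

definition horizontal ::
    "('g::topological_space, 'a::euclidean_space) chart set \<Rightarrow> ('g \<Rightarrow> 'a set) \<Rightarrow>
     (real \<Rightarrow> 'g) \<Rightarrow> bool" where
  "horizontal A \<Delta> \<gamma> \<longleftrightarrow> abs_continuous_curve A \<gamma> \<and>
     (AE t in lebesgue. t \<in> {0..1} \<longrightarrow> curve_differentiable A \<gamma> t \<and> velocity A \<gamma> t \<in> \<Delta> (\<gamma> t))"

definition curve_length ::
    "('g, 'a::euclidean_space) chart set \<Rightarrow> ('g \<Rightarrow> 'a \<Rightarrow> 'a \<Rightarrow> real) \<Rightarrow> (real \<Rightarrow> 'g) \<Rightarrow> real" where
  "curve_length A \<rho> \<gamma> =
     (LINT t:{0..1}|lebesgue. sqrt (\<rho> (\<gamma> t) (velocity A \<gamma> t) (velocity A \<gamma> t)))"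

text \<open>The infimum is taken in the reals: for a bracket-generating left-invariant \<open>\<Delta>\<close> on a connected
  Lie group the set of lengths is nonempty by Chow's theorem.\<close>

definition sr_dist ::
    "('g::topological_space, 'a::euclidean_space) chart set \<Rightarrow> ('g \<Rightarrow> 'a set) \<Rightarrow>
     ('g \<Rightarrow> 'a \<Rightarrow> 'a \<Rightarrow> real) \<Rightarrow> 'g \<Rightarrow> 'g \<Rightarrow> real" where
  "sr_dist A \<Delta> \<rho> p q =
     Inf {curve_length A \<rho> \<gamma> | \<gamma>. horizontal A \<Delta> \<gamma> \<and> p \<in> \<gamma> ` {0..1} \<and> q \<in> \<gamma> ` {0..1}}"

definition asymptotic_distribution ::
    "('g, 'a::euclidean_space) chart set \<Rightarrow> ('g \<Rightarrow> 'g \<Rightarrow> 'g) \<Rightarrow> 'g \<Rightarrow>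
     ('g \<Rightarrow> 'a set) \<Rightarrow> ('g \<Rightarrow> 'a \<Rightarrow> 'a \<Rightarrow> real) \<Rightarrow> 'g \<Rightarrow> 'a set" where
  "asymptotic_distribution A mul e \<Delta> \<rho> p =
     tangent_map A (mul p) e `
       {v \<in> \<Delta> e. \<forall>w \<in> \<Delta> e \<inter> bracket_space A mul e UNIV UNIV. \<rho> e v w = 0}"

definition asymptotic_dist ::
    "('g::topological_space, 'a::euclidean_space) chart set \<Rightarrow> ('g \<Rightarrow> 'g \<Rightarrow> 'g) \<Rightarrow> 'g \<Rightarrow>
     ('g \<Rightarrow> 'a set) \<Rightarrow> ('g \<Rightarrow> 'a \<Rightarrow> 'a \<Rightarrow> real) \<Rightarrow> 'g \<Rightarrow> 'g \<Rightarrow> real" where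
  "asymptotic_dist A mul e \<Delta> \<rho> = sr_dist A (asymptotic_distribution A mul e \<Delta> \<rho>) \<rho>"

end

theory Submission
  imports Defs
begin

text \<open>Let \<open>V\<close> be the orthogonal complement of \<open>\<Delta>\<^sub>e \<inter> [\<gg>, \<gg>]\<close> in \<open>\<Delta>\<^sub>e\<close>. If \<open>\<Delta>\<^sub>e\<close> meets \<open>[\<gg>, \<gg>]\<close> trivially,
  then \<open>V = \<Delta>\<^sub>e\<close> and the two metrics are defined by the same curves. So it has to be shown that the
  hypothesis excludes a vector \<open>\<zeta> \<noteq> 0\<close> in \<open>\<Delta>\<^sub>e \<inter> [\<gg>, \<gg>]\<close>. Such a vector is central. Let \<open>g\<close> be the value at a
  short time \<open>t\<close> of the one-parameter subgroup of \<open>\<zeta>\<close>, and compare the distances from \<open>e\<close> to \<open>g\<^sup>n\<close>.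

  Upper bound. A \<open>V\<close>-horizontal curve of length \<open>l\<close> from \<open>e\<close> to \<open>g\<^sup>n\<close>, multiplied by the one-parameter
  subgroup of \<open>\<zeta>\<close> run through proportionally to arc length, becomes a \<open>\<Delta>\<close>-horizontal curve from \<open>e\<close> to
  \<open>g\<^sup>n\<^sup>+\<^sup>1\<close>. Since \<open>\<zeta>\<close> is orthogonal to \<open>V\<close>, the square of its length is \<open>l\<^sup>2 + t\<^sup>2 \<rho>(\<zeta>, \<zeta>)\<close>
  (\<open>lengths_mul_central\<close>). Hence \<open>d(e, g\<^sup>n\<^sup>+\<^sup>1)\<^sup>2 \<le> d\<^sub>\<infinity>(e, g\<^sup>n)\<^sup>2 + t\<^sup>2 \<rho>(\<zeta>, \<zeta>)\<close>, and if \<open>d\<^sup>2\<close> and \<open>d\<^sub>\<infinity>\<^sup>2\<close> differ by less than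
  \<open>t\<^sup>2\<close> far away, then \<open>d\<^sub>\<infinity>(e, g\<^sup>n)\<^sup>2\<close> grows by at most \<open>t\<^sup>2 (\<rho>(\<zeta>, \<zeta>) + 1)\<close> from one \<open>n\<close> to the next.

  Lower bound. The sum of the left-invariant and the right-invariant one-form with the value
  \<open>\<lambda>u. u \<bullet> \<zeta>\<close> at \<open>e\<close> is closed, because the group is two-step nilpotent, and therefore has a primitive \<open>\<psi>\<close>,
  because the group is simply connected (\<open>primitive_of_\<Omega>\<close>). On the one hand
  \<open>\<psi>(g\<^sup>n) = \<psi>(e) + 2 n t (\<zeta> \<bullet> \<zeta>)\<close>; on the other hand \<open>\<psi>\<close> changes by at most \<open>C (l + l\<^sup>2)\<close> along a horizontal curve
  of length \<open>l\<close> that starts at \<open>e\<close> (\<open>primitive_growth\<close>), since the right-invariant form, expressed in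
  the left-invariant frame, grows linearly with the length. So \<open>d(e, g\<^sup>n)\<^sup>2\<close> is at least \<open>n t (\<zeta> \<bullet> \<zeta>) / C\<close>
  for large \<open>n\<close>, which contradicts the upper bound if \<open>t\<close> is small.

  The group structure reduces differential calculus to the identity: functions are differentiated
  along left-invariant fields (\<open>left_deriv\<close>), and velocities of curves are translated back to \<open>e\<close>
  (\<open>left_vel\<close>). That the forms above are closed rests on the Maurer--Cartan equation, which
  expresses the symmetry of the second derivative of the multiplication.\<close>

section \<open>Absolutely continuous curves\<close>

lemma abs_continuous_on_subinterval:
  assumes "abs_continuous_on a b f" "a \<le> c" "d \<le> b"
  shows "abs_continuous_on c d f"
  unfolding abs_continuous_on_def
proof (intro allI impI)
  fix \<epsilon> :: real assume "\<epsilon> > 0"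
  then obtain \<delta> where \<delta>: "\<delta> > 0" "\<And>D. D division_of (\<Union>D) \<and> \<Union>D \<subseteq> {a..b} \<and> (\<Sum>K\<in>D. Sup K - Inf K) < \<delta>
      \<Longrightarrow> (\<Sum>K\<in>D. norm (f (Sup K) - f (Inf K))) < \<epsilon>"
    using assms(1) unfolding abs_continuous_on_def by meson
  moreover have "{c..d} \<subseteq> {a..b}" using assms by auto
  ultimately show "\<exists>\<delta>>0. \<forall>D. D division_of (\<Union>D) \<and> \<Union>D \<subseteq> {c..d} \<and> (\<Sum>K\<in>D. Sup K - Inf K) < \<delta>
      \<longrightarrow> (\<Sum>K\<in>D. norm (f (Sup K) - f (Inf K))) < \<epsilon>"
    by (meson order_trans)
qed

lemma division_real_memE:
  fixes D :: "real set set"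
  assumes "D division_of S" "K \<in> D"
  obtains u v where "K = {u..v}" "u \<le> v" "Inf K = u" "Sup K = v" "u \<in> S" "v \<in> S"
proof -
  obtain u v where uv: "K = cbox u v" using division_ofD(4)[OF assms] by blast
  have "K \<noteq> {}" using division_ofD(3)[OF assms] .
  with uv have "u \<le> v" by auto
  moreover have "K \<subseteq> S" using division_ofD(2)[OF assms] .
  ultimately show thesis using uv by (intro that[of u v]) auto
qed

text \<open>The form in which absolute continuity is transported: every increment of \<open>g\<close> is controlled by the
  increment of \<open>f\<close> over the same interval.\<close>

lemma abs_continuous_on_dominated:
  assumes f: "abs_continuous_on a b f"
    and g: "\<And>x y. x \<in> {a..b} \<Longrightarrow> y \<in> {a..b} \<Longrightarrow> norm (g x - g y) \<le> C * norm (f x - f y)"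
  shows "abs_continuous_on a b g"
  unfolding abs_continuous_on_def
proof (intro allI impI)
  fix \<epsilon> :: real assume "\<epsilon> > 0"
  define C' where "C' = max C 1"
  have C': "C' > 0" "C \<le> C'" by (auto simp: C'_def)
  have "\<epsilon> / C' > 0" using \<open>\<epsilon> > 0\<close> C' by simp
  then obtain \<delta> where \<delta>: "\<delta> > 0" "\<And>D. D division_of (\<Union>D) \<and> \<Union>D \<subseteq> {a..b} \<and> (\<Sum>K\<in>D. Sup K - Inf K) < \<delta>
      \<Longrightarrow> (\<Sum>K\<in>D. norm (f (Sup K) - f (Inf K))) < \<epsilon> / C'"
    using f unfolding abs_continuous_on_def by meson
  show "\<exists>\<delta>>0. \<forall>D. D division_of (\<Union>D) \<and> \<Union>D \<subseteq> {a..b} \<and> (\<Sum>K\<in>D. Sup K - Inf K) < \<delta>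
      \<longrightarrow> (\<Sum>K\<in>D. norm (g (Sup K) - g (Inf K))) < \<epsilon>"
  proof (intro exI[of _ \<delta>] conjI allI impI \<delta>(1))
    fix D assume D: "D division_of (\<Union>D) \<and> \<Union>D \<subseteq> {a..b} \<and> (\<Sum>K\<in>D. Sup K - Inf K) < \<delta>"
    have "(\<Sum>K\<in>D. norm (g (Sup K) - g (Inf K))) \<le> (\<Sum>K\<in>D. C' * norm (f (Sup K) - f (Inf K)))"
    proof (rule sum_mono)
      fix K assume "K \<in> D"
      then obtain u v where "Inf K = u" "Sup K = v" "u \<in> \<Union>D" "v \<in> \<Union>D"
        using D division_real_memE by metis
      then have "Inf K \<in> {a..b}" "Sup K \<in> {a..b}" using D by blast+
      then have "norm (g (Sup K) - g (Inf K)) \<le> C * norm (f (Sup K) - f (Inf K))"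
        using g by blast
      also have "\<dots> \<le> C' * norm (f (Sup K) - f (Inf K))"
        using C' by (simp add: mult_right_mono)
      finally show "norm (g (Sup K) - g (Inf K)) \<le> C' * norm (f (Sup K) - f (Inf K))" .
    qed
    also have "\<dots> = C' * (\<Sum>K\<in>D. norm (f (Sup K) - f (Inf K)))"
      by (simp add: sum_distrib_left)
    also have "\<dots> < C' * (\<epsilon> / C')" using \<delta>(2)[OF D] C' by (simp only: mult_strict_left_mono)
    finally show "(\<Sum>K\<in>D. norm (g (Sup K) - g (Inf K))) < \<epsilon>" using C' by simp
  qed
qed

lemma abs_continuous_on_cong:
  assumes "abs_continuous_on a b f" "\<And>x. x \<in> {a..b} \<Longrightarrow> g x = f x"
  shows "abs_continuous_on a b g"
  by (rule abs_continuous_on_dominated[OF assms(1), where C=1]) (simp add: assms(2))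

lemma abs_continuous_on_lipschitz_compose:
  assumes "abs_continuous_on a b f" "C-lipschitz_on S F" "f ` {a..b} \<subseteq> S"
  shows "abs_continuous_on a b (F \<circ> f)"
  by (rule abs_continuous_on_dominated[OF assms(1), where C=C])
    (use assms(2,3) in \<open>auto simp: image_subset_iff intro!: lipschitz_on_normD\<close>)

lemma abs_continuous_on_const: "abs_continuous_on a b (\<lambda>x. c)"
  unfolding abs_continuous_on_def by (auto intro!: exI[of _ 1])

lemma abs_continuous_on_Pair:
  fixes f :: "real \<Rightarrow> 'a::real_normed_vector" and g :: "real \<Rightarrow> 'b::real_normed_vector"
  assumes f: "abs_continuous_on a b f" and g: "abs_continuous_on a b g"
  shows "abs_continuous_on a b (\<lambda>x. (f x, g x))"
  unfolding abs_continuous_on_def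
proof (intro allI impI)
  fix \<epsilon> :: real assume "\<epsilon> > 0"
  then have e2: "\<epsilon> / 2 > 0" by simp
  obtain \<delta>1 where \<delta>1: "\<delta>1 > 0" "\<And>D. D division_of (\<Union>D) \<and> \<Union>D \<subseteq> {a..b} \<and> (\<Sum>K\<in>D. Sup K - Inf K) < \<delta>1
      \<Longrightarrow> (\<Sum>K\<in>D. norm (f (Sup K) - f (Inf K))) < \<epsilon> / 2"
    using f e2 unfolding abs_continuous_on_def by meson
  obtain \<delta>2 where \<delta>2: "\<delta>2 > 0" "\<And>D. D division_of (\<Union>D) \<and> \<Union>D \<subseteq> {a..b} \<and> (\<Sum>K\<in>D. Sup K - Inf K) < \<delta>2
      \<Longrightarrow> (\<Sum>K\<in>D. norm (g (Sup K) - g (Inf K))) < \<epsilon> / 2"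
    using g e2 unfolding abs_continuous_on_def by meson
  show "\<exists>\<delta>>0. \<forall>D. D division_of (\<Union>D) \<and> \<Union>D \<subseteq> {a..b} \<and> (\<Sum>K\<in>D. Sup K - Inf K) < \<delta>
      \<longrightarrow> (\<Sum>K\<in>D. norm ((f (Sup K), g (Sup K)) - (f (Inf K), g (Inf K)))) < \<epsilon>"
  proof (intro exI[of _ "min \<delta>1 \<delta>2"] conjI allI impI)
    fix D assume D: "D division_of (\<Union>D) \<and> \<Union>D \<subseteq> {a..b} \<and> (\<Sum>K\<in>D. Sup K - Inf K) < min \<delta>1 \<delta>2"
    have "(\<Sum>K\<in>D. norm ((f (Sup K), g (Sup K)) - (f (Inf K), g (Inf K))))
        \<le> (\<Sum>K\<in>D. norm (f (Sup K) - f (Inf K)) + norm (g (Sup K) - g (Inf K)))"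
      by (rule sum_mono) (simp add: norm_Pair_le)
    also have "\<dots> < \<epsilon>" using \<delta>1(2)[of D] \<delta>2(2)[of D] D by (simp add: sum.distrib)
    finally show "(\<Sum>K\<in>D. norm ((f (Sup K), g (Sup K)) - (f (Inf K), g (Inf K)))) < \<epsilon>" .
  qed (use \<delta>1 \<delta>2 in auto)
qed

lemma abs_continuous_on_add:
  fixes f :: "real \<Rightarrow> 'a::real_normed_vector"
  assumes f: "abs_continuous_on a b f" and g: "abs_continuous_on a b g"
  shows "abs_continuous_on a b (\<lambda>x. f x + g x)"
proof (rule abs_continuous_on_dominated[OF abs_continuous_on_Pair[OF f g], where C=2])
  fix x y
  have "norm (f x + g x - (f y + g y)) \<le> norm (f x - f y) + norm (g x - g y)"
    by (metis add_diff_add norm_triangle_ineq)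
  also have "\<dots> \<le> 2 * norm ((f x, g x) - (f y, g y))"
    using norm_fst_le[of "f x - f y" "g x - g y"] norm_snd_le[of "g x - g y" "f x - f y"] by simp
  finally show "norm (f x + g x - (f y + g y)) \<le> 2 * norm ((f x, g x) - (f y, g y))" .
qed

text \<open>Freezing an absolutely continuous function outside \<open>{a..b}\<close> keeps it absolutely continuous,
  since the part of a division that is not collapsed by the clamping is a division again.\<close>

lemma abs_continuous_on_clamp:
  fixes f :: "real \<Rightarrow> 'a::real_normed_vector"
  assumes f: "abs_continuous_on a b f" and ab: "a \<le> b"
  shows "abs_continuous_on c d (\<lambda>x. f (max a (min b x)))"
  unfolding abs_continuous_on_def
proof (intro allI impI)
  fix \<epsilon> :: real assume "\<epsilon> > 0"
  then obtain \<delta> where \<delta>: "\<delta> > 0" "\<And>D. D division_of (\<Union>D) \<and> \<Union>D \<subseteq> {a..b} \<and> (\<Sum>K\<in>D. Sup K - Inf K) < \<delta>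
      \<Longrightarrow> (\<Sum>K\<in>D. norm (f (Sup K) - f (Inf K))) < \<epsilon>"
    using f unfolding abs_continuous_on_def by meson
  define q where "q x = max a (min b x)" for x
  have q_lip: "q y - q x \<le> y - x" "q x \<le> q y" if "x \<le> y" for x y
    using that ab by (auto simp: q_def)
  show "\<exists>\<delta>>0. \<forall>D. D division_of (\<Union>D) \<and> \<Union>D \<subseteq> {c..d} \<and> (\<Sum>K\<in>D. Sup K - Inf K) < \<delta>
      \<longrightarrow> (\<Sum>K\<in>D. norm (f (max a (min b (Sup K))) - f (max a (min b (Inf K))))) < \<epsilon>"
  proof (intro exI[of _ \<delta>] conjI allI impI \<delta>(1))
    fix D assume D: "D division_of (\<Union>D) \<and> \<Union>D \<subseteq> {c..d} \<and> (\<Sum>K\<in>D. Sup K - Inf K) < \<delta>"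
    then have div: "D division_of (\<Union>D)" and fin: "finite D" by (auto simp: division_of_def)
    have memE: "\<exists>u v. K = {u..v} \<and> u \<le> v \<and> Inf K = u \<and> Sup K = v" if "K \<in> D" for K
      using division_real_memE[OF div that] by metis
    define D1 where "D1 = {K \<in> D. q (Inf K) < q (Sup K)}"
    define h where "h K = {q (Inf K)..q (Sup K)}" for K
    have D1: "finite D1" "D1 \<subseteq> D" using fin by (auto simp: D1_def)
    have h: "Inf (h K) = q (Inf K)" "Sup (h K) = q (Sup K)" "h K \<noteq> {}" "interior (h K) \<noteq> {}"
        "h K \<subseteq> K" "h K \<subseteq> {a..b}" if "K \<in> D1" for K
    proof -
      have lt: "q (Inf K) < q (Sup K)" using that by (simp add: D1_def)
      show "Inf (h K) = q (Inf K)" "Sup (h K) = q (Sup K)" "h K \<noteq> {}" "interior (h K) \<noteq> {}"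
        using lt by (auto simp: h_def)
      have "K \<in> D" using that D1 by blast
      then obtain u v where uv: "K = {u..v}" "u \<le> v" "Inf K = u" "Sup K = v"
        using memE by metis
      show "h K \<subseteq> K" using lt uv ab by (auto simp: h_def q_def)
      show "h K \<subseteq> {a..b}" using ab by (auto simp: h_def q_def)
    qed
    have disj: "interior (h K) \<inter> interior (h K') = {}" if "K \<in> D1" "K' \<in> D1" "K \<noteq> K'" for K K'
    proof -
      have "interior K \<inter> interior K' = {}" using division_ofD(5)[OF div] that D1 by blast
      then show ?thesis using interior_mono[OF h(5)[OF that(1)]] interior_mono[OF h(5)[OF that(2)]]
        by blast
    qed
    have inj: "inj_on h D1"
    proof (rule inj_onI, rule ccontr)
      fix K K' assume K: "K \<in> D1" "K' \<in> D1" "h K = h K'" "K \<noteq> K'"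
      show False using disj[OF K(1,2,4)] h(4)[OF K(1)] K(3) by simp
    qed
    have "(\<Sum>K\<in>D. norm (f (q (Sup K)) - f (q (Inf K)))) = (\<Sum>K\<in>D1. norm (f (q (Sup K)) - f (q (Inf K))))"
    proof (rule sum.mono_neutral_right[OF fin D1(2)], rule ballI)
      fix K assume K: "K \<in> D - D1"
      then obtain u v where "u \<le> v" "Inf K = u" "Sup K = v" using memE by blast
      then have "q (Inf K) = q (Sup K)" using K q_lip(2) by (auto simp: D1_def not_less intro: antisym)
      then show "norm (f (q (Sup K)) - f (q (Inf K))) = 0" by simp
    qed
    also have "\<dots> = (\<Sum>K\<in>h ` D1. norm (f (Sup K) - f (Inf K)))"
      using inj by (simp add: sum.reindex h)
    also have "\<dots> < \<epsilon>"
    proof (rule \<delta>(2), intro conjI)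
      show "h ` D1 division_of \<Union> (h ` D1)"
      proof (rule division_ofI)
        show "finite (h ` D1)" using D1 by simp
        show "\<And>K. K \<in> h ` D1 \<Longrightarrow> K \<subseteq> \<Union> (h ` D1)" by blast
        show "\<And>K. K \<in> h ` D1 \<Longrightarrow> K \<noteq> {}" using h by blast
        show "\<And>K. K \<in> h ` D1 \<Longrightarrow> \<exists>a b. K = cbox a b" by (force simp: h_def)
        show "\<And>K1 K2. K1 \<in> h ` D1 \<Longrightarrow> K2 \<in> h ` D1 \<Longrightarrow> K1 \<noteq> K2 \<Longrightarrow> interior K1 \<inter> interior K2 = {}"
          using disj by blast
      qed simp
      show "\<Union> (h ` D1) \<subseteq> {a..b}" using h(6) by blast
      have "(\<Sum>K\<in>h ` D1. Sup K - Inf K) = (\<Sum>K\<in>D1. q (Sup K) - q (Inf K))"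
        using inj by (simp add: sum.reindex h)
      also have "\<dots> \<le> (\<Sum>K\<in>D1. Sup K - Inf K)"
        by (rule sum_mono) (metis D1(2) memE q_lip(1) subsetD)
      also have "\<dots> \<le> (\<Sum>K\<in>D. Sup K - Inf K)"
        by (rule sum_mono2[OF fin D1(2)]) (use memE in fastforce)
      finally show "(\<Sum>K\<in>h ` D1. Sup K - Inf K) < \<delta>" using D by simp
    qed
    finally show "(\<Sum>K\<in>D. norm (f (max a (min b (Sup K))) - f (max a (min b (Inf K))))) < \<epsilon>"
      by (simp add: q_def)
  qed
qed

text \<open>A function on two adjacent intervals is a sum of clamped functions, which spares cutting the
  members of a division at the common endpoint.\<close>

lemma abs_continuous_on_combine:
  fixes f :: "real \<Rightarrow> 'a::real_normed_vector"
  assumes f: "abs_continuous_on a b f" "abs_continuous_on b c f" and ab: "a \<le> b" "b \<le> c"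
  shows "abs_continuous_on a c f"
proof -
  have "abs_continuous_on a c (\<lambda>x. (f (max a (min b x)) + f (max b (min c x))) + - f b)"
    by (rule abs_continuous_on_add[OF abs_continuous_on_add[OF abs_continuous_on_clamp[OF f(1) ab(1)]
          abs_continuous_on_clamp[OF f(2) ab(2)]] abs_continuous_on_const])
  then show ?thesis
  proof (rule abs_continuous_on_cong)
    fix x assume "x \<in> {a..c}"
    then show "f x = (f (max a (min b x)) + f (max b (min c x))) + - f b"
      using ab by (cases "x \<le> b") (simp_all add: max_absorb1 max_absorb2 min_absorb1 min_absorb2)
  qed
qed

text \<open>Since the exceptional null set can be covered by an open set of small measure, absolute
  continuity makes its contribution to the Riemann sums negligible.\<close>

theorem abs_continuous_on_has_integral:
  fixes f :: "real \<Rightarrow> 'a::euclidean_space"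
  assumes f: "abs_continuous_on a b f" and ab: "a \<le> b" and N: "negligible N"
    and f': "\<And>x. x \<in> {a..b} - N \<Longrightarrow> (f has_vector_derivative f' x) (at x within {a..b})"
  shows "(f' has_integral f b - f a) {a..b}"
proof -
  define g where "g x = (if x \<in> N then 0 else f' x)" for x
  have "(g has_integral f b - f a) {a..b}"
  proof (cases "a = b")
    case True then show ?thesis using has_integral_refl(2)[of g b] by simp
  next
    case False
    with ab have ab': "a < b" by simp
    show ?thesis
      unfolding has_integral_factor_content_real
    proof (intro allI impI)
      fix e :: real assume e: "e > 0"
      define \<epsilon> where "\<epsilon> = e * (b - a) / 2"
      have "\<epsilon> > 0" using e ab' by (simp add: \<epsilon>_def)
      then obtain \<delta> where \<delta>: "\<delta> > 0" "\<And>D. D division_of (\<Union>D) \<and> \<Union>D \<subseteq> {a..b} \<and> (\<Sum>K\<in>D. Sup K - Inf K) < \<delta>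
          \<Longrightarrow> (\<Sum>K\<in>D. norm (f (Sup K) - f (Inf K))) < \<epsilon>"
        using f unfolding abs_continuous_on_def by meson
      have "N \<in> sets lebesgue" using N negligible_imp_sets by blast
      then obtain T where T: "open T" "N \<subseteq> T" "T - N \<in> lmeasurable" "emeasure lebesgue (T - N) < ennreal \<delta>"
        using sets_lebesgue_outer_open[OF _ \<delta>(1)] by metis
      have Tm: "T \<in> lmeasurable" "measure lebesgue T < \<delta>"
      proof -
        have eq: "T = (T - N) \<union> N" using T by auto
        have Nm: "N \<in> lmeasurable" "measure lebesgue N = 0"
          using N by (auto simp: negligible_iff_measure)
        show Tl: "T \<in> lmeasurable" using T(3) Nm(1) eq by (metis fmeasurable.Un)
        have "measure lebesgue T \<le> measure lebesgue (T - N) + measure lebesgue N"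
          using eq T(3) Nm(1) by (metis fmeasurableD measure_Un_le)
        also have "measure lebesgue (T - N) < \<delta>"
          using T(3,4) \<delta>(1) by (simp add: emeasure_eq_measure2 ennreal_less_iff)
        finally show "measure lebesgue T < \<delta>" using Nm by simp
      qed
      have "\<exists>r>0. \<forall>y\<in>{a..b}. \<bar>y - x\<bar> < r \<longrightarrow> norm (f y - f x - (y - x) *\<^sub>R f' x) \<le> e / 2 * \<bar>y - x\<bar>"
        if "x \<in> {a..b} - N" for x
      proof -
        have "e / 2 > 0" using e by simp
        with f'[OF that] show ?thesis
          unfolding has_vector_derivative_def has_derivative_within_alt real_norm_def by blast
      qed
      then obtain r where r: "\<And>x. x \<in> {a..b} - N \<Longrightarrow> r x > 0"
          "\<And>x y. x \<in> {a..b} - N \<Longrightarrow> y \<in> {a..b} \<Longrightarrow> \<bar>y - x\<bar> < r x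
              \<Longrightarrow> norm (f y - f x - (y - x) *\<^sub>R f' x) \<le> e / 2 * \<bar>y - x\<bar>"
        by metis
      define d where "d x = (if x \<in> N then T else if x \<in> {a..b} then ball x (r x) else ball x 1)" for x
      show "\<exists>d. gauge d \<and> (\<forall>p. p tagged_division_of {a..b} \<and> d fine p \<longrightarrow>
          norm ((\<Sum>(x, k)\<in>p. measure lborel k *\<^sub>R g x) - (f b - f a)) \<le> e * measure lborel {a..b})"
      proof (intro exI[of _ d] conjI allI impI)
        show "gauge d" using T r(1) by (auto simp: gauge_def d_def)
        fix p assume p: "p tagged_division_of {a..b} \<and> d fine p"
        then have ptag: "p tagged_division_of {a..b}" and fine: "d fine p" by auto
        have fin: "finite p" using ptag by blast
        define p1 where "p1 = {z \<in> p. fst z \<in> N}"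
        define p2 where "p2 = {z \<in> p. fst z \<notin> N}"
        have p12: "p = p1 \<union> p2" "p1 \<inter> p2 = {}" "finite p1" "finite p2" "p1 \<subseteq> p" "p2 \<subseteq> p"
          using fin by (auto simp: p1_def p2_def)
        have kE: "\<exists>u v. k = {u..v} \<and> u \<le> v \<and> Inf k = u \<and> Sup k = v \<and> measure lborel k = v - u \<and> u \<in> {a..b} \<and> v \<in> {a..b} \<and> x \<in> {u..v}"
          if xk: "(x,k) \<in> p" for x k
        proof -
          obtain u v where uv: "k = cbox u v" using tagged_division_ofD(4)[OF ptag xk] by blast
          moreover have "x \<in> k" "k \<subseteq> {a..b}" using tagged_division_ofD(2,3)[OF ptag xk] by auto
          ultimately show ?thesis by (intro exI[of _ u] exI[of _ v]) auto
        qed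
        define F where "F k = f (Sup k) - f (Inf k)" for k
        have tot: "(\<Sum>(x,k)\<in>p. F k) = f b - f a"
          unfolding F_def using additive_tagged_division_1[OF ab ptag] by (simp add: case_prod_unfold)
        have S2: "norm (\<Sum>(x,k)\<in>p2. measure lborel k *\<^sub>R g x - F k) \<le> e / 2 * (b - a)"
        proof -
          have "norm (\<Sum>(x,k)\<in>p2. measure lborel k *\<^sub>R g x - F k) \<le> (\<Sum>(x,k)\<in>p2. e / 2 * measure lborel k)"
          proof (rule sum_norm_le, clarify)
            fix x k assume xk: "(x,k) \<in> p2"
            then have xp: "(x,k) \<in> p" and xN: "x \<notin> N" by (auto simp: p2_def)
            obtain u v where uv: "k = {u..v}" "u \<le> v" "Inf k = u" "Sup k = v" "measure lborel k = v - u"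
                "u \<in> {a..b}" "v \<in> {a..b}" "x \<in> {u..v}"
              using kE[OF xp] by blast
            have x: "x \<in> {a..b} - N" using uv xN by auto
            have "k \<subseteq> ball x (r x)" using fineD[OF fine xp] x by (simp add: d_def)
            moreover have "u \<in> k" "v \<in> k" using uv by auto
            ultimately have "\<bar>u - x\<bar> < r x" "\<bar>v - x\<bar> < r x"
              by (auto simp: subset_iff dist_real_def abs_minus_commute)
            then have "norm (f u - f x - (u - x) *\<^sub>R f' x) \<le> e / 2 * \<bar>u - x\<bar>"
                "norm (f v - f x - (v - x) *\<^sub>R f' x) \<le> e / 2 * \<bar>v - x\<bar>"
              using r(2)[OF x] uv(6,7) by blast+
            moreover have "\<bar>u - x\<bar> = x - u" "\<bar>v - x\<bar> = v - x" using uv(8) by auto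
            ultimately have 1: "norm (f u - f x - (u - x) *\<^sub>R f' x) \<le> e / 2 * (x - u)"
                "norm (f v - f x - (v - x) *\<^sub>R f' x) \<le> e / 2 * (v - x)"
              by simp_all
            have "measure lborel k *\<^sub>R g x - F k = (f u - f x - (u - x) *\<^sub>R f' x) - (f v - f x - (v - x) *\<^sub>R f' x)"
              using xN unfolding g_def F_def uv(3-5) by (simp add: algebra_simps)
            then have "norm (measure lborel k *\<^sub>R g x - F k) \<le> e / 2 * (x - u) + e / 2 * (v - x)"
              using 1 norm_triangle_ineq4[of "f u - f x - (u - x) *\<^sub>R f' x" "f v - f x - (v - x) *\<^sub>R f' x"]
              by simp
            also have "\<dots> = e / 2 * measure lborel k" unfolding uv(5) by (simp add: field_simps)
            finally show "norm (measure lborel k *\<^sub>R g x - F k) \<le> e / 2 * measure lborel k" .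
          qed
          also have "\<dots> \<le> (\<Sum>(x,k)\<in>p. e / 2 * measure lborel k)"
            using e p12 fin by (intro sum_mono2) auto
          also have "\<dots> = e / 2 * (\<Sum>(x,k)\<in>p. measure lborel k)" by (simp add: sum_distrib_left case_prod_unfold)
          also have "(\<Sum>(x,k)\<in>p. measure lborel k) = b - a"
            using additive_content_tagged_division[of p a b] ptag ab by simp
          finally show ?thesis .
        qed
        have S1: "norm (\<Sum>(x,k)\<in>p1. measure lborel k *\<^sub>R g x - F k) \<le> \<epsilon>"
        proof -
          have "p1 tagged_partial_division_of {a..b}"
            using ptag p12(5) tagged_partial_division_subset tagged_division_of_def by blast
          then have p1: "p1 tagged_division_of \<Union> (snd ` p1)"
            by (rule tagged_partial_division_of_Union_self)
          then have div: "snd ` p1 division_of \<Union> (snd ` p1)"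
            by (rule division_of_tagged_division)
          have sub: "\<Union> (snd ` p1) \<subseteq> T \<inter> {a..b}"
          proof -
            have "k \<subseteq> T \<and> k \<subseteq> {a..b}" if "(x,k) \<in> p1" for x k
              using that fineD[OF fine, of x k] tagged_division_ofD(3)[OF ptag, of x k]
              by (auto simp: p1_def d_def)
            then have "K \<subseteq> T \<inter> {a..b}" if "K \<in> snd ` p1" for K
              using that by (metis imageE le_inf_iff prod.collapse)
            then show ?thesis by (rule Union_least)
          qed
          have len: "(\<Sum>K\<in>snd ` p1. Sup K - Inf K) < \<delta>"
          proof -
            have "(\<Sum>K\<in>snd ` p1. Sup K - Inf K) = (\<Sum>K\<in>snd ` p1. measure lebesgue K)"
            proof (rule sum.cong[OF refl])
              fix K assume "K \<in> snd ` p1"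
              then obtain x where "(x,K) \<in> p" using p12(5) by auto
              then obtain u v where "K = {u..v}" "u \<le> v" "Inf K = u" "Sup K = v"
                using kE by metis
              then show "Sup K - Inf K = measure lebesgue K" by simp
            qed
            also have "\<dots> = measure lebesgue (\<Union> (snd ` p1))"
              using content_division[OF div] .
            also have "\<dots> \<le> measure lebesgue T"
              using sub Tm(1) lmeasurable_division[OF div] by (intro measure_mono_fmeasurable) (auto dest: fmeasurableD)
            finally show ?thesis using Tm by simp
          qed
          have "norm (\<Sum>(x,k)\<in>p1. measure lborel k *\<^sub>R g x - F k) \<le> (\<Sum>(x,k)\<in>p1. norm (F k))"
          proof (rule sum_norm_le, clarify)
            fix x k assume "(x,k) \<in> p1"
            then have "g x = 0" by (simp add: p1_def g_def)
            then show "norm (measure lborel k *\<^sub>R g x - F k) \<le> norm (F k)" by simp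
          qed
          also have "\<dots> = (\<Sum>K\<in>snd ` p1. norm (F K))"
          proof -
            define H where "H K = (if K = {} then 0 else norm (F K))" for K
            have ne: "k \<noteq> {}" if "(x,k) \<in> p1" for x k
            proof -
              have "(x,k) \<in> p" using that p12(5) by blast
              then show ?thesis by (metis kE empty_iff)
            qed
            have s1: "(\<Sum>(x,k)\<in>p1. norm (F k)) = (\<Sum>(x,k)\<in>p1. H k)"
            proof (rule sum.cong[OF refl], clarify)
              fix x k assume "(x,k) \<in> p1"
              then have "k \<noteq> {}" by (rule ne)
              then show "norm (F k) = H k" by (simp add: H_def)
            qed
            have H0: "H (cbox u v) = 0" if "box u v = {}" for u v :: real
            proof (cases "u = v")
              case True
              show ?thesis unfolding H_def F_def True by simp
            next
              case False
              then have "cbox u v = {}" using that by (simp add: box_real)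
              then show ?thesis unfolding H_def by simp
            qed
            have s2: "(\<Sum>(x,k)\<in>p1. H k) = (\<Sum>K\<in>snd ` p1. H K)"
              by (rule sum.over_tagged_division_lemma[OF p1]) (rule H0)
            have s3: "(\<Sum>K\<in>snd ` p1. H K) = (\<Sum>K\<in>snd ` p1. norm (F K))"
            proof (rule sum.cong[OF refl])
              fix K assume "K \<in> snd ` p1"
              then have "K \<noteq> {}" using ne by force
              then show "H K = norm (F K)" by (simp add: H_def)
            qed
            show ?thesis using s1 s2 s3 by (simp only:)
          qed
          also have "\<dots> < \<epsilon>" unfolding F_def
            by (rule \<delta>(2), intro conjI div len) (use sub in auto)
          finally show ?thesis by simp
        qed
        have "(\<Sum>(x, k)\<in>p. measure lborel k *\<^sub>R g x) - (f b - f a) = (\<Sum>(x, k)\<in>p. measure lborel k *\<^sub>R g x - F k)"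
          by (simp add: tot[symmetric] sum_subtractf case_prod_unfold)
        also have "\<dots> = (\<Sum>(x,k)\<in>p1. measure lborel k *\<^sub>R g x - F k) + (\<Sum>(x,k)\<in>p2. measure lborel k *\<^sub>R g x - F k)"
          by (subst p12(1)) (rule sum.union_disjoint[OF p12(3,4,2)])
        also have "norm \<dots> \<le> \<epsilon> + e / 2 * (b - a)" using S1 S2 by (rule norm_triangle_mono)
        also have "\<dots> = e * measure lborel {a..b}" using ab by (simp add: \<epsilon>_def field_simps)
        finally show "norm ((\<Sum>(x, k)\<in>p. measure lborel k *\<^sub>R g x) - (f b - f a)) \<le> e * measure lborel {a..b}" .
      qed
    qed
  qed
  then show ?thesis
    by (rule has_integral_spike[OF N, rotated]) (simp add: g_def)
qed

text \<open>Compactness of \<open>{a..b}\<close> in the form of an induction over subintervals.\<close>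

lemma interval_local_to_global [consumes 1, case_names combine local]:
  fixes P :: "real \<Rightarrow> real \<Rightarrow> bool"
  assumes "a \<le> b"
    and trans: "\<And>u v w. a \<le> u \<Longrightarrow> u \<le> v \<Longrightarrow> v \<le> w \<Longrightarrow> w \<le> b \<Longrightarrow> P u v \<Longrightarrow> P v w \<Longrightarrow> P u w"
    and local: "\<And>t. a \<le> t \<Longrightarrow> t \<le> b \<Longrightarrow>
      \<exists>d>0. \<forall>u v. a \<le> u \<and> u \<le> t \<and> t \<le> v \<and> v \<le> b \<and> v - u < d \<longrightarrow> P u v"
  shows "P a b"
proof -
  have "a \<le> a \<and> b \<le> b \<longrightarrow> P a b"
  proof (rule Bolzano[OF \<open>a \<le> b\<close>, where P="\<lambda>u v. a \<le> u \<and> v \<le> b \<longrightarrow> P u v"])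
    show "\<And>u v w. (a \<le> u \<and> v \<le> b \<longrightarrow> P u v) \<Longrightarrow> (a \<le> v \<and> w \<le> b \<longrightarrow> P v w) \<Longrightarrow> u \<le> v \<Longrightarrow> v \<le> w
        \<Longrightarrow> a \<le> u \<and> w \<le> b \<longrightarrow> P u w"
      using trans by (meson order_trans)
    show "\<And>t. a \<le> t \<Longrightarrow> t \<le> b \<Longrightarrow>
        \<exists>d>0. \<forall>u v. u \<le> t \<and> t \<le> v \<and> v - u < d \<longrightarrow> a \<le> u \<and> v \<le> b \<longrightarrow> P u v"
      using local by meson
  qed
  then show ?thesis by simp
qed

lemma abs_continuous_on_local_to_global:
  fixes f :: "real \<Rightarrow> 'a::real_normed_vector"
  assumes "a \<le> b"
    and "\<And>t. a \<le> t \<Longrightarrow> t \<le> b \<Longrightarrow>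
      \<exists>d>0. \<forall>u v. a \<le> u \<and> u \<le> t \<and> t \<le> v \<and> v \<le> b \<and> v - u < d \<longrightarrow> abs_continuous_on u v f"
  shows "abs_continuous_on a b f"
  using assms(1)
  by (rule interval_local_to_global) (use assms(2) abs_continuous_on_combine in blast)+

text \<open>On short intervals the variation of \<open>f\<close> is at most \<open>1\<close>, and the derivative of a function of
  bounded variation whose integrals recover \<open>f\<close> is absolutely integrable.\<close>

lemma abs_continuous_on_derivative_absolutely_integrable:
  fixes f :: "real \<Rightarrow> 'a::euclidean_space"
  assumes f: "abs_continuous_on a b f" and ab: "a \<le> b" and N: "negligible N"
    and f': "\<And>x. x \<in> {a..b} - N \<Longrightarrow> (f has_vector_derivative f' x) (at x within {a..b})"
  shows "f' absolutely_integrable_on {a..b}"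
proof -
  obtain \<delta> where \<delta>: "\<delta> > 0" "\<And>D. D division_of (\<Union>D) \<and> \<Union>D \<subseteq> {a..b} \<and> (\<Sum>K\<in>D. Sup K - Inf K) < \<delta>
      \<Longrightarrow> (\<Sum>K\<in>D. norm (f (Sup K) - f (Inf K))) < 1"
    using f unfolding abs_continuous_on_def by (meson zero_less_one)
  have ftc: "(f' has_integral f v - f u) {u..v}" if "a \<le> u" "u \<le> v" "v \<le> b" for u v
  proof (rule abs_continuous_on_has_integral[OF _ that(2) N])
    show "abs_continuous_on u v f" using abs_continuous_on_subinterval[OF f] that by blast
    fix x assume "x \<in> {u..v} - N"
    moreover have "{u..v} \<subseteq> {a..b}" using that by auto
    ultimately show "(f has_vector_derivative f' x) (at x within {u..v})"
      using f'[of x] has_vector_derivative_within_subset by blast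
  qed
  show ?thesis using ab
  proof (rule interval_local_to_global)
    fix t assume t: "a \<le> t" "t \<le> b"
    show "\<exists>d>0. \<forall>u v. a \<le> u \<and> u \<le> t \<and> t \<le> v \<and> v \<le> b \<and> v - u < d
        \<longrightarrow> f' absolutely_integrable_on {u..v}"
    proof (intro exI[of _ \<delta>] conjI allI impI \<delta>(1))
      fix u v assume uv: "a \<le> u \<and> u \<le> t \<and> t \<le> v \<and> v \<le> b \<and> v - u < \<delta>"
      have "f' absolutely_integrable_on cbox u v"
      proof (rule bounded_variation_absolutely_integrable_interval)
        show "f' integrable_on cbox u v" using ftc[of u v] uv by auto
        fix D assume D: "D division_of cbox u v"
        have mem: "\<exists>x y. K = {x..y} \<and> x \<le> y \<and> Inf K = x \<and> Sup K = y \<and> a \<le> x \<and> y \<le> b" if K: "K \<in> D" for K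
        proof -
          obtain x y where "K = {x..y}" "x \<le> y" "Inf K = x" "Sup K = y" "x \<in> cbox u v" "y \<in> cbox u v"
            using division_real_memE[OF D K] by metis
          then show ?thesis using uv by (intro exI[of _ x] exI[of _ y]) auto
        qed
        have U: "\<Union>D = cbox u v" using D by (rule division_ofD(6))
        have "(\<Sum>K\<in>D. norm (integral K f')) = (\<Sum>K\<in>D. norm (f (Sup K) - f (Inf K)))"
        proof (rule sum.cong[OF refl])
          fix K assume "K \<in> D"
          then obtain x y where xy: "K = {x..y}" "x \<le> y" "Inf K = x" "Sup K = y" "a \<le> x" "y \<le> b"
            using mem by blast
          show "norm (integral K f') = norm (f (Sup K) - f (Inf K))"
            using integral_unique[OF ftc[OF xy(5,2,6)]] unfolding xy(3,4) unfolding xy(1) by simp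
        qed
        also have "\<dots> < 1"
        proof (rule \<delta>(2), intro conjI)
          show "D division_of \<Union>D" using D U by simp
          show "\<Union>D \<subseteq> {a..b}" using U uv by auto
          have "(\<Sum>K\<in>D. Sup K - Inf K) = (\<Sum>K\<in>D. measure lborel K)"
          proof (rule sum.cong[OF refl])
            fix K assume "K \<in> D"
            then obtain x y where xy: "K = {x..y}" "x \<le> y" "Inf K = x" "Sup K = y"
              using mem by blast
            show "Sup K - Inf K = measure lborel K" unfolding xy(3,4) unfolding xy(1) using xy(2) by simp
          qed
          also have "\<dots> = measure lborel (cbox u v)"
            using D by (rule additive_content_division)
          also have "\<dots> < \<delta>" using uv by simp
          finally show "(\<Sum>K\<in>D. Sup K - Inf K) < \<delta>" .
        qed
        finally show "(\<Sum>K\<in>D. norm (integral K f')) \<le> 1" by simp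
      qed
      then show "f' absolutely_integrable_on {u..v}" by simp
    qed
  qed (rule absolutely_integrable_on_combine)
qed

text \<open>The indefinite integral of a bounded function is Lipschitz, and an integrable function is a
  bounded one up to an arbitrarily small error in \<open>L\<^sup>1\<close>.\<close>

lemma abs_continuous_on_indefinite_integral:
  fixes w :: "real \<Rightarrow> real"
  assumes w: "w integrable_on {a..b}" and pos: "\<And>x. x \<in> {a..b} \<Longrightarrow> w x \<ge> 0"
  shows "abs_continuous_on a b (\<lambda>x. integral {a..x} w)"
  unfolding abs_continuous_on_def
proof (intro allI impI)
  fix \<epsilon> :: real assume \<epsilon>: "\<epsilon> > 0"
  define wn where "wn n x = min (w x) (real n)" for n x
  have wabs: "w absolutely_integrable_on {a..b}"
    using w pos by (rule nonnegative_absolutely_integrable_1)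
  have wn_int: "wn n integrable_on {a..b}" for n
    unfolding wn_def using absolutely_integrable_min_1[OF wabs, of "\<lambda>x. real n"]
    by (simp add: absolutely_integrable_on_def integrable_on_const)
  have "(\<lambda>n. integral {a..b} (wn n)) \<longlonglongrightarrow> integral {a..b} w"
  proof (rule dominated_convergence(2)[OF wn_int w])
    show "norm (wn n x) \<le> w x" if "x \<in> {a..b}" for n x using pos[OF that] by (auto simp: wn_def)
    show "(\<lambda>n. wn n x) \<longlonglongrightarrow> w x" for x
    proof (rule tendsto_eventually)
      obtain m :: nat where "w x \<le> real m" using real_arch_simple by blast
      then show "\<forall>\<^sub>F n in sequentially. wn n x = w x"
        unfolding eventually_sequentially by (intro exI[of _ m]) (auto simp: wn_def min_def)
    qed
  qed
  then have "\<forall>\<^sub>F n in sequentially. dist (integral {a..b} (wn n)) (integral {a..b} w) < \<epsilon> / 2"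
    by (rule tendstoD) (use \<epsilon> in simp)
  then obtain n where n: "dist (integral {a..b} (wn n)) (integral {a..b} w) < \<epsilon> / 2"
    by (meson eventually_happens' sequentially_bot)
  define r where "r x = w x - wn n x" for x
  have r_int: "r integrable_on {a..b}" unfolding r_def using w wn_int by (rule integrable_diff)
  have r_pos: "r x \<ge> 0" for x by (simp add: r_def wn_def)
  have r_small: "integral {a..b} r < \<epsilon> / 2"
  proof -
    have "integral {a..b} r = integral {a..b} w - integral {a..b} (wn n)"
      unfolding r_def using w wn_int by (rule integral_diff)
    also have "\<dots> < \<epsilon> / 2" using n by (simp add: dist_real_def abs_if split: if_splits)
    finally show ?thesis .
  qed
  show "\<exists>\<delta>>0. \<forall>D. D division_of (\<Union>D) \<and> \<Union>D \<subseteq> {a..b} \<and> (\<Sum>K\<in>D. Sup K - Inf K) < \<delta>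
      \<longrightarrow> (\<Sum>K\<in>D. norm (integral {a..Sup K} w - integral {a..Inf K} w)) < \<epsilon>"
  proof (intro exI[of _ "\<epsilon> / (2 * (real n + 1))"] conjI allI impI)
    show "0 < \<epsilon> / (2 * (real n + 1))" using \<epsilon> by simp
    fix D assume D: "D division_of (\<Union>D) \<and> \<Union>D \<subseteq> {a..b} \<and> (\<Sum>K\<in>D. Sup K - Inf K) < \<epsilon> / (2 * (real n + 1))"
    then have div: "D division_of \<Union>D" and sub: "\<Union>D \<subseteq> {a..b}" by auto
    have mem: "\<exists>x y. K = {x..y} \<and> x \<le> y \<and> Inf K = x \<and> Sup K = y \<and> a \<le> x \<and> y \<le> b" if K: "K \<in> D" for K
    proof -
      obtain x y where "K = {x..y}" "x \<le> y" "Inf K = x" "Sup K = y" "x \<in> \<Union>D" "y \<in> \<Union>D"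
        using division_real_memE[OF div K] by metis
      then show ?thesis using sub by (intro exI[of _ x] exI[of _ y]) auto
    qed
    have rK: "r integrable_on K" if "K \<in> D" for K
    proof -
      obtain x y where "K = {x..y}" "a \<le> x" "y \<le> b" using mem[OF \<open>K \<in> D\<close>] by blast
      then show ?thesis using integrable_on_subinterval[OF r_int, of x y] by auto
    qed
    have "(\<Sum>K\<in>D. norm (integral {a..Sup K} w - integral {a..Inf K} w))
        \<le> (\<Sum>K\<in>D. integral K r + real n * (Sup K - Inf K))"
    proof (rule sum_mono)
      fix K assume KD: "K \<in> D"
      then obtain x y where xy: "K = {x..y}" "x \<le> y" "Inf K = x" "Sup K = y" "a \<le> x" "y \<le> b"
        using mem by blast
      have sub: "{x..y} \<subseteq> {a..b}" using xy by auto
      have wi: "w integrable_on {x..y}" "wn n integrable_on {x..y}" "w integrable_on {a..y}"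
        using integrable_on_subinterval[OF w] integrable_on_subinterval[OF wn_int] xy by auto
      have "integral {a..x} w + integral {x..y} w = integral {a..y} w"
        using Henstock_Kurzweil_Integration.integral_combine[OF xy(5,2) wi(3)] .
      then have "integral {a..y} w - integral {a..x} w = integral {x..y} w" by simp
      moreover have "0 \<le> integral {x..y} w"
        using sub pos by (intro integral_nonneg wi) auto
      moreover have "integral {x..y} w = integral {x..y} r + integral {x..y} (wn n)"
        unfolding r_def using integral_diff[OF wi(1,2)] by simp
      moreover have "integral {x..y} (wn n) \<le> integral {x..y} (\<lambda>_. real n)"
        by (rule integral_le[OF wi(2)]) (auto simp: wn_def)
      moreover have "integral {x..y} (\<lambda>_. real n) = real n * (y - x)" using xy(2) by simp
      ultimately show "norm (integral {a..Sup K} w - integral {a..Inf K} w)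
          \<le> integral K r + real n * (Sup K - Inf K)"
        unfolding xy(3,4) unfolding xy(1) using xy(2) by (simp add: mult.commute)
    qed
    also have "\<dots> = (\<Sum>K\<in>D. integral K r) + real n * (\<Sum>K\<in>D. Sup K - Inf K)"
      by (simp add: sum.distrib sum_distrib_left)
    also have "(\<Sum>K\<in>D. integral K r) = integral (\<Union>D) r"
      using integral_combine_division_bottomup[OF div rK] by simp
    also have "integral (\<Union>D) r \<le> integral {a..b} r"
      using sub r_int r_pos integrable_on_def has_integral_combine_division[OF div integrable_integral[OF rK]]
      by (intro integral_subset_le) auto
    also have "real n * (\<Sum>K\<in>D. Sup K - Inf K) \<le> real n * (\<epsilon> / (2 * (real n + 1)))"
      using D by (intro mult_left_mono) auto
    also have "\<dots> \<le> \<epsilon> / 2" using \<epsilon> by (simp add: field_simps)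
    finally show "(\<Sum>K\<in>D. norm (integral {a..Sup K} w - integral {a..Inf K} w)) < \<epsilon>"
      using r_small by linarith
  qed
qed

text \<open>The fact \<open>integrable_ccontinuous_explicit\<close> treats the difference quotients from the right; those
  from the left are obtained by applying it to the reflected function.\<close>

lemma has_vector_derivative_indefinite_integral_AE:
  fixes f :: "real \<Rightarrow> real"
  assumes f: "f integrable_on {a..b}"
  obtains N where "negligible N"
    "\<And>x. x \<in> {a..b} - N \<Longrightarrow> ((\<lambda>x. integral {a..x} f) has_vector_derivative f x) (at x within {a..b})"
proof -
  define g where "g x = (if x \<in> {a..b} then f x else 0)" for x
  have gU: "g integrable_on UNIV" unfolding g_def using f integrable_restrict_UNIV by blast
  have g: "g integrable_on cbox u v" for u v
    using integrable_on_subcbox[OF gU] by simp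
  have g_minus: "(\<lambda>x. g (- x)) integrable_on cbox u v" for u v
    using g[of "-v" "-u"] Henstock_Kurzweil_Integration.integrable_reflect_real[where f=g and a="-v" and b="-u"] by simp
  obtain N1 where N1: "negligible N1" "\<And>x e. x \<notin> N1 \<Longrightarrow> 0 < e \<Longrightarrow>
      \<exists>d>0. \<forall>h. 0 < h \<and> h < d \<longrightarrow> norm (integral (cbox x (x + h *\<^sub>R One)) g /\<^sub>R h ^ DIM(real) - g x) < e"
    using integrable_ccontinuous_explicit[OF g] by blast
  obtain N2 where N2: "negligible N2" "\<And>x e. x \<notin> N2 \<Longrightarrow> 0 < e \<Longrightarrow>
      \<exists>d>0. \<forall>h. 0 < h \<and> h < d \<longrightarrow>
        norm (integral (cbox x (x + h *\<^sub>R One)) (\<lambda>x. g (-x)) /\<^sub>R h ^ DIM(real) - g (-x)) < e"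
    using integrable_ccontinuous_explicit[OF g_minus] by blast
  define N where "N = N1 \<union> uminus ` N2"
  have negN: "negligible N"
    unfolding N_def using N1(1) negligible_differentiable_image_negligible[OF _ N2(1), of uminus]
    by (simp add: negligible_Un differentiable_on_def)
  have int_eq: "integral {x..y} g = integral {a..y} f - integral {a..x} f"
    if "a \<le> x" "x \<le> y" "y \<le> b" for x y
  proof -
    have "integral {a..x} f + integral {x..y} f = integral {a..y} f"
      using that by (intro Henstock_Kurzweil_Integration.integral_combine integrable_on_subinterval[OF f]) auto
    moreover have "integral {x..y} g = integral {x..y} f"
      using that by (intro integral_cong) (auto simp: g_def)
    ultimately show ?thesis by simp
  qed
  show thesis
  proof (rule that[OF negN])
    fix x assume x: "x \<in> {a..b} - N"
    then have xab: "a \<le> x" "x \<le> b" and xN: "x \<notin> N1" "-x \<notin> N2" by (force simp: N_def)+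
    have gx: "g x = f x" using xab by (simp add: g_def)
    show "((\<lambda>x. integral {a..x} f) has_vector_derivative f x) (at x within {a..b})"
      unfolding has_vector_derivative_def has_derivative_within_alt
    proof (intro conjI allI impI bounded_linear_scaleR_left)
      fix e :: real assume e: "e > 0"
      obtain d1 where d1: "d1 > 0" "\<And>h. 0 < h \<Longrightarrow> h < d1 \<Longrightarrow> \<bar>integral {x..x+h} g / h - f x\<bar> < e"
        using N1(2)[OF xN(1) e] gx by (auto simp: divide_inverse_commute)
      obtain d2 where d2: "d2 > 0" "\<And>h. 0 < h \<Longrightarrow> h < d2 \<Longrightarrow> \<bar>integral {-x..-x+h} (\<lambda>x. g (-x)) / h - f x\<bar> < e"
        using N2(2)[OF xN(2) e] gx by (auto simp: divide_inverse_commute)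
      show "\<exists>d>0. \<forall>y\<in>{a..b}. norm (y - x) < d \<longrightarrow>
          norm (integral {a..y} f - integral {a..x} f - (y - x) *\<^sub>R f x) \<le> e * norm (y - x)"
      proof (intro exI[of _ "min d1 d2"] conjI ballI impI)
        fix y assume y: "y \<in> {a..b}" "norm (y - x) < min d1 d2"
        consider "y = x" | "y > x" | "y < x" by linarith
        then show "norm (integral {a..y} f - integral {a..x} f - (y - x) *\<^sub>R f x) \<le> e * norm (y - x)"
        proof cases
          case 1 then show ?thesis by simp
        next
          case 2
          have "\<bar>integral {x..x+(y-x)} g / (y - x) - f x\<bar> < e" using y 2 by (intro d1) auto
          then have "\<bar>(integral {a..y} f - integral {a..x} f) / (y - x) - f x\<bar> < e"
            using 2 int_eq[of x y] xab y(1) by simp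
          then have "\<bar>(integral {a..y} f - integral {a..x} f) / (y - x) - f x\<bar> * (y - x) \<le> e * (y - x)"
            using 2 by simp
          moreover have "\<bar>(integral {a..y} f - integral {a..x} f) / (y - x) - f x\<bar> * (y - x)
              = \<bar>((integral {a..y} f - integral {a..x} f) / (y - x) - f x) * (y - x)\<bar>"
            using 2 by (simp add: abs_mult)
          moreover have "((integral {a..y} f - integral {a..x} f) / (y - x) - f x) * (y - x)
              = integral {a..y} f - integral {a..x} f - (y - x) * f x"
            using 2 by (simp add: field_simps)
          ultimately show ?thesis using 2 by simp
        next
          case 3
          have "\<bar>integral {-x..-x+(x-y)} (\<lambda>x. g (-x)) / (x - y) - f x\<bar> < e" using y 3 by (intro d2) auto
          moreover have "integral {-x..-x+(x-y)} (\<lambda>x. g (-x)) = integral {a..x} f - integral {a..y} f"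
            using Henstock_Kurzweil_Integration.integral_reflect_real[where f=g and a=y and b=x] int_eq[of y x] 3 xab y(1) by simp
          ultimately have "\<bar>(integral {a..x} f - integral {a..y} f) / (x - y) - f x\<bar> * (x - y) \<le> e * (x - y)"
            using 3 by simp
          moreover have "\<bar>(integral {a..x} f - integral {a..y} f) / (x - y) - f x\<bar> * (x - y)
              = \<bar>((integral {a..x} f - integral {a..y} f) / (x - y) - f x) * (x - y)\<bar>"
            using 3 by (simp add: abs_mult)
          moreover have "((integral {a..x} f - integral {a..y} f) / (x - y) - f x) * (x - y)
              = - (integral {a..y} f - integral {a..x} f - (y - x) * f x)"
            using 3 by (simp add: field_simps)
          ultimately show ?thesis using 3 by simp
        qed
      qed (use d1 d2 in auto)
    qed
  qed
qed

section \<open>Calculus in Euclidean spaces\<close>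

lemma linear_eq_sum_Basis:
  fixes f :: "'a::euclidean_space \<Rightarrow> 'b::real_vector"
  assumes "linear f"
  shows "f v = (\<Sum>b\<in>Basis. (v \<bullet> b) *\<^sub>R f b)"
proof -
  have "f v = f (\<Sum>b\<in>Basis. (v \<bullet> b) *\<^sub>R b)" by (simp add: euclidean_representation)
  also have "\<dots> = (\<Sum>b\<in>Basis. (v \<bullet> b) *\<^sub>R f b)" using assms by (simp add: linear_sum linear_scale)
  finally show ?thesis .
qed

lemma norm_linear_le_sum_Basis:
  fixes f :: "'a::euclidean_space \<Rightarrow> 'b::real_normed_vector"
  assumes "linear f"
  shows "norm (f v) \<le> (\<Sum>b\<in>Basis. norm (f b)) * norm v"
proof -
  have "norm (f v) \<le> (\<Sum>b\<in>Basis. norm ((v \<bullet> b) *\<^sub>R f b))"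
    by (subst linear_eq_sum_Basis[OF assms]) (rule norm_sum)
  also have "\<dots> \<le> (\<Sum>b\<in>Basis. norm (f b) * norm v)"
    by (rule sum_mono) (simp, subst mult.commute, simp add: mult_left_mono Basis_le_norm)
  finally show ?thesis by (simp add: sum_distrib_right)
qed

text \<open>The partial derivatives are bounded near \<open>x\<close>, and they bound the operator norm of the
  derivative.\<close>

lemma locally_lipschitz_if_C1:
  fixes f :: "'a::euclidean_space \<Rightarrow> 'b::real_normed_vector"
  assumes S: "open S" "x \<in> S"
    and f': "\<And>y. y \<in> S \<Longrightarrow> (f has_derivative f' y) (at y)"
    and cont: "\<And>v. continuous (at x) (\<lambda>y. f' y v)"
  obtains L r where "r > 0" "cball x r \<subseteq> S" "L-lipschitz_on (cball x r) f"
proof -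
  define B where "B y = (\<Sum>b\<in>Basis. norm (f' y b))" for y
  have "continuous (at x) B" unfolding B_def by (intro continuous_intros cont)
  then have "\<forall>\<^sub>F y in at x. dist (B y) (B x) < 1"
    unfolding continuous_within using zero_less_one by (rule tendstoD)
  then have "\<forall>\<^sub>F y in nhds x. B y \<le> B x + 1"
    unfolding eventually_at_filter by eventually_elim (auto simp: dist_real_def)
  moreover have "\<forall>\<^sub>F y in nhds x. y \<in> S" using S by (rule eventually_nhds_in_open)
  ultimately have "\<forall>\<^sub>F y in nhds x. B y \<le> B x + 1 \<and> y \<in> S" by (rule eventually_conj)
  then obtain d where d: "d > 0" "\<And>y. dist y x < d \<Longrightarrow> B y \<le> B x + 1 \<and> y \<in> S"
    unfolding eventually_nhds_metric by blast
  define r where "r = d / 2"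
  have r: "r > 0" "\<And>y. y \<in> cball x r \<Longrightarrow> B y \<le> B x + 1 \<and> y \<in> S"
    using d by (auto simp: r_def dist_commute)
  have B0: "B y \<ge> 0" for y unfolding B_def by (simp add: sum_nonneg)
  have "(B x + 1)-lipschitz_on (cball x r) f"
  proof (rule lipschitz_onI)
    fix y z assume yz: "y \<in> cball x r" "z \<in> cball x r"
    have "norm (f y - f z) \<le> (B x + 1) * norm (y - z)"
    proof (rule differentiable_bound[OF convex_cball _ _ yz])
      fix u assume u: "u \<in> cball x r"
      show "(f has_derivative f' u) (at u within cball x r)"
        using f' r(2)[OF u] has_derivative_at_withinI by blast
      have "linear (f' u)" using f' r(2)[OF u] has_derivative_linear by blast
      then have "norm (f' u v) \<le> B u * norm v" for v
        unfolding B_def by (rule norm_linear_le_sum_Basis)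
      then show "onorm (f' u) \<le> B x + 1"
        using r(2)[OF u] by (meson onorm_bound B0 order_trans)
    qed
    then show "dist (f y) (f z) \<le> (B x + 1) * dist y z" by (simp add: dist_norm)
  qed (use B0[of x] in simp)
  with that r show thesis by blast
qed

text \<open>The mixed second difference of \<open>f\<close> at \<open>x\<close> is, by the mean value theorem applied in both orders,
  a value of either mixed second derivative near \<open>x\<close>.\<close>

lemma symmetric_second_derivative_real:
  fixes f :: "'a::real_normed_vector \<Rightarrow> real"
  assumes S: "open S" "x \<in> S"
    and f': "\<And>y. y \<in> S \<Longrightarrow> (f has_derivative f' y) (at y)"
    and f'': "\<And>y v. y \<in> S \<Longrightarrow> ((\<lambda>y. f' y v) has_derivative f'' y v) (at y)"
    and cont: "\<And>v w. continuous (at x) (\<lambda>y. f'' y v w)"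
  shows "f'' x v w = f'' x w v"
proof (rule ccontr)
  assume neq: "f'' x v w \<noteq> f'' x w v"
  define \<epsilon> where "\<epsilon> = \<bar>f'' x v w - f'' x w v\<bar> / 2"
  have \<epsilon>: "\<epsilon> > 0" using neq by (simp add: \<epsilon>_def)
  have near: "\<forall>\<^sub>F y in nhds x. \<bar>f'' y v w - f'' x v w\<bar> < \<epsilon>" for v w
  proof -
    have "\<forall>\<^sub>F y in at x. dist (f'' y v w) (f'' x v w) < \<epsilon>"
      using cont[of v w] \<epsilon> unfolding continuous_within by (rule tendstoD)
    then show ?thesis unfolding eventually_at_filter
      by eventually_elim (use \<epsilon> in \<open>auto simp: dist_real_def\<close>)
  qed
  have "\<forall>\<^sub>F y in nhds x. \<bar>f'' y v w - f'' x v w\<bar> < \<epsilon> \<and> \<bar>f'' y w v - f'' x w v\<bar> < \<epsilon> \<and> y \<in> S"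
    using near[of v w] near[of w v] eventually_nhds_in_open[OF S] by eventually_elim auto
  then obtain d where d: "d > 0"
      "\<And>y. dist y x < d \<Longrightarrow> \<bar>f'' y v w - f'' x v w\<bar> < \<epsilon> \<and> \<bar>f'' y w v - f'' x w v\<bar> < \<epsilon> \<and> y \<in> S"
    unfolding eventually_nhds_metric by blast
  define s where "s = d / (2 * (norm v + norm w + 1))"
  have s0: "s > 0" unfolding s_def using d(1) by (intro divide_pos_pos) (auto simp: add_nonneg_pos)
  have close: "dist (x + a *\<^sub>R v + b *\<^sub>R w) x < d" if "0 \<le> a" "a \<le> s" "0 \<le> b" "b \<le> s" for a b
  proof -
    have "dist (x + a *\<^sub>R v + b *\<^sub>R w) x = norm (a *\<^sub>R v + b *\<^sub>R w)" by (simp add: dist_norm add.assoc)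
    also have "\<dots> \<le> a * norm v + b * norm w" using that by (metis abs_of_nonneg norm_scaleR norm_triangle_ineq)
    also have "\<dots> \<le> s * norm v + s * norm w" using that by (intro add_mono mult_right_mono) auto
    also have "\<dots> = s * (norm v + norm w)" by (simp add: algebra_simps)
    also have "\<dots> \<le> s * (norm v + norm w + 1)" using s0 by simp
    also have "\<dots> = d / 2"
    proof -
      define n where "n = norm v + norm w + 1"
      have "n > 0" unfolding n_def by (simp add: add_nonneg_pos)
      then show ?thesis unfolding s_def n_def[symmetric] by (simp add: field_simps)
    qed
    finally show ?thesis using d(1) by simp
  qed
  \<comment> \<open>The mean value theorem, first in the direction of \<open>v\<close>, then in the direction of \<open>w\<close>.\<close>
  have mvt: "\<exists>a b. 0 \<le> a \<and> a \<le> s \<and> 0 \<le> b \<and> b \<le> s \<and>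
      f (x + s *\<^sub>R v + s *\<^sub>R w) - f (x + s *\<^sub>R v) - f (x + s *\<^sub>R w) + f x = s * s * f'' (x + a *\<^sub>R v + b *\<^sub>R w) v w"
    if close: "\<And>a b. 0 \<le> a \<Longrightarrow> a \<le> s \<Longrightarrow> 0 \<le> b \<Longrightarrow> b \<le> s \<Longrightarrow> x + a *\<^sub>R v + b *\<^sub>R w \<in> S" for v w
  proof -
    define g where "g \<tau> = f (x + \<tau> *\<^sub>R v + s *\<^sub>R w) - f (x + \<tau> *\<^sub>R v)" for \<tau>
    have g': "DERIV g \<tau> :> f' (x + \<tau> *\<^sub>R v + s *\<^sub>R w) v - f' (x + \<tau> *\<^sub>R v) v" if \<tau>: "0 \<le> \<tau>" "\<tau> \<le> s" for \<tau>
    proof -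
      have in1: "x + \<tau> *\<^sub>R v + s *\<^sub>R w \<in> S" and in2: "x + \<tau> *\<^sub>R v \<in> S"
        using close[of \<tau> s] close[of \<tau> 0] \<tau> s0 by auto
      have 1: "((\<lambda>\<tau>. x + \<tau> *\<^sub>R v + s *\<^sub>R w) has_derivative (\<lambda>h. h *\<^sub>R v)) (at \<tau>)"
        by (auto intro!: derivative_eq_intros)
      have 2: "((\<lambda>\<tau>. x + \<tau> *\<^sub>R v) has_derivative (\<lambda>h. h *\<^sub>R v)) (at \<tau>)"
        by (auto intro!: derivative_eq_intros)
      have D: "(g has_derivative (\<lambda>h. f' (x + \<tau> *\<^sub>R v + s *\<^sub>R w) (h *\<^sub>R v) - f' (x + \<tau> *\<^sub>R v) (h *\<^sub>R v))) (at \<tau>)"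
        unfolding g_def
        by (rule has_derivative_diff[OF has_derivative_compose[OF 1 f'[OF in1]] has_derivative_compose[OF 2 f'[OF in2]]])
      have lin: "f' (x + \<tau> *\<^sub>R v + s *\<^sub>R w) (h *\<^sub>R v) = h * f' (x + \<tau> *\<^sub>R v + s *\<^sub>R w) v"
          "f' (x + \<tau> *\<^sub>R v) (h *\<^sub>R v) = h * f' (x + \<tau> *\<^sub>R v) v" for h
        using linear_scale[OF has_derivative_linear[OF f'[OF in1]], of h v]
          linear_scale[OF has_derivative_linear[OF f'[OF in2]], of h v] by simp_all
      show ?thesis
        unfolding has_field_derivative_def
        by (rule has_derivative_eq_rhs[OF D]) (simp add: fun_eq_iff lin right_diff_distrib mult.commute)
    qed
    obtain a where a: "0 < a" "a < s" "g s - g 0 = (s - 0) * (f' (x + a *\<^sub>R v + s *\<^sub>R w) v - f' (x + a *\<^sub>R v) v)"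
      using MVT2[OF s0 g'] by blast
    define k where "k \<tau> = f' (x + a *\<^sub>R v + \<tau> *\<^sub>R w) v" for \<tau>
    have k': "DERIV k \<tau> :> f'' (x + a *\<^sub>R v + \<tau> *\<^sub>R w) v w" if \<tau>: "0 \<le> \<tau>" "\<tau> \<le> s" for \<tau>
    proof -
      have in1: "x + a *\<^sub>R v + \<tau> *\<^sub>R w \<in> S" using close[of a \<tau>] \<tau> a by auto
      have 1: "((\<lambda>\<tau>. x + a *\<^sub>R v + \<tau> *\<^sub>R w) has_derivative (\<lambda>h. h *\<^sub>R w)) (at \<tau>)"
        by (auto intro!: derivative_eq_intros)
      note 2 = f''[OF in1, where v=v]
      have D: "(k has_derivative (\<lambda>h. f'' (x + a *\<^sub>R v + \<tau> *\<^sub>R w) v (h *\<^sub>R w))) (at \<tau>)"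
        unfolding k_def by (rule has_derivative_compose[OF 1 2])
      have lin: "f'' (x + a *\<^sub>R v + \<tau> *\<^sub>R w) v (c *\<^sub>R w) = c * f'' (x + a *\<^sub>R v + \<tau> *\<^sub>R w) v w" for c
        using linear_scale[OF has_derivative_linear[OF 2], of c w] by simp
      show ?thesis
        unfolding has_field_derivative_def
        by (rule has_derivative_eq_rhs[OF D]) (simp only: fun_eq_iff lin mult.commute simp_thms)
    qed
    obtain b where b: "0 < b" "b < s" "k s - k 0 = (s - 0) * f'' (x + a *\<^sub>R v + b *\<^sub>R w) v w"
      using MVT2[OF s0 k'] by blast
    have "f (x + s *\<^sub>R v + s *\<^sub>R w) - f (x + s *\<^sub>R v) - f (x + s *\<^sub>R w) + f x = g s - g 0" by (simp add: g_def)
    also have "\<dots> = s * (k s - k 0)" using a(3) by (simp add: k_def)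
    also have "\<dots> = s * s * f'' (x + a *\<^sub>R v + b *\<^sub>R w) v w" using b(3) by simp
    finally show ?thesis using a b by (intro exI[of _ a] exI[of _ b]) auto
  qed
  have inS: "x + a *\<^sub>R v + b *\<^sub>R w \<in> S" if "0 \<le> a" "a \<le> s" "0 \<le> b" "b \<le> s" for a b
    using d(2) close that by blast
  then have inS': "x + a *\<^sub>R w + b *\<^sub>R v \<in> S" if "0 \<le> a" "a \<le> s" "0 \<le> b" "b \<le> s" for a b
    using inS[of b a] that by (simp add: add.commute add.left_commute)
  obtain a b where ab: "0 \<le> a" "a \<le> s" "0 \<le> b" "b \<le> s"
      "f (x + s *\<^sub>R v + s *\<^sub>R w) - f (x + s *\<^sub>R v) - f (x + s *\<^sub>R w) + f x = s * s * f'' (x + a *\<^sub>R v + b *\<^sub>R w) v w"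
    using mvt[OF inS] by blast
  obtain a' b' where ab': "0 \<le> a'" "a' \<le> s" "0 \<le> b'" "b' \<le> s"
      "f (x + s *\<^sub>R w + s *\<^sub>R v) - f (x + s *\<^sub>R w) - f (x + s *\<^sub>R v) + f x = s * s * f'' (x + a' *\<^sub>R w + b' *\<^sub>R v) w v"
    using mvt[OF inS'] by blast
  have swap: "x + s *\<^sub>R w + s *\<^sub>R v = x + s *\<^sub>R v + s *\<^sub>R w" "x + a' *\<^sub>R w + b' *\<^sub>R v = x + b' *\<^sub>R v + a' *\<^sub>R w"
    by (simp_all add: algebra_simps)
  have "s * s * f'' (x + a *\<^sub>R v + b *\<^sub>R w) v w = s * s * f'' (x + b' *\<^sub>R v + a' *\<^sub>R w) w v"
    using ab(5) ab'(5) unfolding swap by linarith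
  then have "f'' (x + a *\<^sub>R v + b *\<^sub>R w) v w = f'' (x + b' *\<^sub>R v + a' *\<^sub>R w) w v" using s0 by simp
  moreover have "\<bar>f'' (x + a *\<^sub>R v + b *\<^sub>R w) v w - f'' x v w\<bar> < \<epsilon>" using d(2)[OF close[OF ab(1-4)]] by blast
  moreover have "\<bar>f'' (x + b' *\<^sub>R v + a' *\<^sub>R w) w v - f'' x w v\<bar> < \<epsilon>"
    using d(2)[OF close[OF ab'(3,4,1,2)]] by blast
  ultimately show False unfolding \<epsilon>_def by (simp add: abs_if split: if_splits)
qed

lemma symmetric_second_derivative:
  fixes f :: "'a::real_normed_vector \<Rightarrow> 'b::euclidean_space"
  assumes S: "open S" "x \<in> S"
    and f': "\<And>y. y \<in> S \<Longrightarrow> (f has_derivative f' y) (at y)"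
    and f'': "\<And>y v. y \<in> S \<Longrightarrow> ((\<lambda>y. f' y v) has_derivative f'' y v) (at y)"
    and cont: "\<And>v w. continuous (at x) (\<lambda>y. f'' y v w)"
  shows "f'' x v w = f'' x w v"
proof (rule euclidean_eqI)
  fix b :: 'b assume "b \<in> Basis"
  show "f'' x v w \<bullet> b = f'' x w v \<bullet> b"
  proof (rule symmetric_second_derivative_real[OF S, where f="\<lambda>y. f y \<bullet> b" and f'="\<lambda>y v. f' y v \<bullet> b" and f''="\<lambda>y v w. f'' y v w \<bullet> b"])
    show "((\<lambda>y. f y \<bullet> b) has_derivative (\<lambda>v. f' y v \<bullet> b)) (at y)" if "y \<in> S" for y
      using f'[OF that] by (rule has_derivative_inner_left)
    show "((\<lambda>y. f' y v \<bullet> b) has_derivative (\<lambda>w. f'' y v w \<bullet> b)) (at y)" if "y \<in> S" for y v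
      using f''[OF that] by (rule has_derivative_inner_left)
    show "continuous (at x) (\<lambda>y. f'' y v w \<bullet> b)" for v w by (intro continuous_intros cont)
  qed
qed

text \<open>The product rule for a family of linear maps of which only the derivatives at fixed vectors are
  known.\<close>

lemma has_derivative_apply_linear:
  fixes A :: "'c::real_normed_vector \<Rightarrow> 'a::euclidean_space \<Rightarrow> 'b::real_normed_vector"
  assumes A: "\<And>v. ((\<lambda>y. A y v) has_derivative A' v) (at x)" and lin: "\<And>y. y \<in> S \<Longrightarrow> linear (A y)"
    and S: "open S" "x \<in> S"
    and w: "(w has_derivative w') (at x)"
  shows "((\<lambda>y. A y (w y)) has_derivative (\<lambda>h. A' (w x) h + A x (w' h))) (at x)"
proof -
  have "((\<lambda>y. \<Sum>b\<in>Basis. (w y \<bullet> b) *\<^sub>R A y b) has_derivative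
      (\<lambda>h. \<Sum>b\<in>Basis. (w x \<bullet> b) *\<^sub>R A' b h + (w' h \<bullet> b) *\<^sub>R A x b)) (at x)"
    by (intro has_derivative_sum has_derivative_scaleR has_derivative_inner_left w A)
  moreover have "(\<Sum>b\<in>Basis. (w x \<bullet> b) *\<^sub>R A' b h + (w' h \<bullet> b) *\<^sub>R A x b) = A' (w x) h + A x (w' h)" for h
  proof -
    have "A' (w x) = (\<lambda>h. \<Sum>b\<in>Basis. (w x \<bullet> b) *\<^sub>R A' b h)"
    proof (rule has_derivative_unique[OF A])
      have "((\<lambda>y. \<Sum>b\<in>Basis. (w x \<bullet> b) *\<^sub>R A y b) has_derivative (\<lambda>h. \<Sum>b\<in>Basis. (w x \<bullet> b) *\<^sub>R A' b h)) (at x)"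
        by (intro has_derivative_sum has_derivative_scaleR_right A)
      then show "((\<lambda>y. A y (w x)) has_derivative (\<lambda>h. \<Sum>b\<in>Basis. (w x \<bullet> b) *\<^sub>R A' b h)) (at x)"
        by (rule has_derivative_transform_within_open[OF _ S]) (rule linear_eq_sum_Basis[OF lin, symmetric])
    qed
    then show ?thesis
      by (simp add: sum.distrib linear_eq_sum_Basis[OF lin[OF S(2)], of "w' h"])
  qed
  ultimately have "((\<lambda>y. \<Sum>b\<in>Basis. (w y \<bullet> b) *\<^sub>R A y b) has_derivative (\<lambda>h. A' (w x) h + A x (w' h))) (at x)"
    by simp
  then show ?thesis
    by (rule has_derivative_transform_within_open[OF _ S]) (rule linear_eq_sum_Basis[OF lin, symmetric])
qed

text \<open>Integrate the form along the rays from the centre; differentiation under the integral and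
  closedness turn the derivative of the result into the integral of an exact derivative.\<close>

theorem Poincare_ball:
  fixes \<alpha> :: "'a::euclidean_space \<Rightarrow> 'a \<Rightarrow> real"
  assumes lin: "\<And>x. x \<in> ball c r \<Longrightarrow> linear (\<alpha> x)"
    and \<alpha>': "\<And>x w. x \<in> ball c r \<Longrightarrow> ((\<lambda>x. \<alpha> x w) has_derivative (\<lambda>h. \<alpha>' x h w)) (at x)"
    and cont: "\<And>h w. continuous_on (ball c r) (\<lambda>x. \<alpha>' x h w)"
    and closed: "\<And>x h w. x \<in> ball c r \<Longrightarrow> \<alpha>' x h w = \<alpha>' x w h"
  obtains f where "\<And>x. x \<in> ball c r \<Longrightarrow> (f has_derivative \<alpha> x) (at x)"
proof -
  define y where "y x \<tau> = c + \<tau> *\<^sub>R (x - c)" for x and \<tau> :: real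
  have y: "y x \<tau> \<in> ball c r" if "x \<in> ball c r" "\<tau> \<in> cbox 0 1" for x \<tau>
  proof -
    have "norm (\<tau> *\<^sub>R (x - c)) \<le> norm (x - c)" using that(2) by (auto intro: mult_left_le_one_le)
    then show ?thesis using that(1) by (simp add: y_def dist_norm norm_minus_commute)
  qed
  have lin': "linear (\<lambda>w. \<alpha>' x h w)" if x: "x \<in> ball c r" for x h
    unfolding closed[OF x, of h] by (rule has_derivative_linear[OF \<alpha>'[OF x]])
  have y_cont: "continuous_on (ball c r \<times> cbox 0 1) (\<lambda>z. y (fst z) (snd z))"
    unfolding y_def by (intro continuous_intros)
  have \<alpha>'_cont: "continuous_on (ball c r \<times> cbox 0 1) (\<lambda>z. \<alpha>' (y (fst z) (snd z)) h w)" for h w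
    by (rule continuous_on_compose2[OF cont y_cont]) (use y in auto)
  have \<alpha>_on: "continuous_on (ball c r) (\<lambda>x. \<alpha> x w)" for w
    by (rule continuous_at_imp_continuous_on) (use has_derivative_continuous[OF \<alpha>'] in blast)
  have \<alpha>_cont: "continuous_on (ball c r \<times> cbox 0 1) (\<lambda>z. \<alpha> (y (fst z) (snd z)) w)" for w
    by (rule continuous_on_compose2[OF \<alpha>_on y_cont]) (use y in auto)
  define D where "D x \<tau> h = \<tau> * \<alpha>' (y x \<tau>) h (x - c) + \<alpha> (y x \<tau>) h" for x \<tau> h
  have D_sum: "D x \<tau> h = \<tau> * (\<Sum>b\<in>Basis. ((x - c) \<bullet> b) * \<alpha>' (y x \<tau>) h b) + \<alpha> (y x \<tau>) h"
    if "x \<in> ball c r" "\<tau> \<in> cbox 0 1" for x \<tau> h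
    unfolding D_def using linear_eq_sum_Basis[OF lin'[OF y[OF that]], of "h" "x - c"] by simp
  define F where "F x = integral (cbox 0 1) (\<lambda>\<tau>. \<alpha> (y x \<tau>) (x - c))" for x
  have deriv: "((\<lambda>x. \<alpha> (y x \<tau>) (x - c)) has_derivative D x \<tau>) (at x)"
    if x: "x \<in> ball c r" and \<tau>: "\<tau> \<in> cbox 0 1" for x \<tau>
  proof -
    have y': "((\<lambda>x. y x \<tau>) has_derivative (\<lambda>h. \<tau> *\<^sub>R h)) (at x)"
      unfolding y_def by (auto intro!: derivative_eq_intros)
    have "((\<lambda>x. \<alpha> (y x \<tau>) (x - c)) has_derivative (\<lambda>h. \<alpha>' (y x \<tau>) (\<tau> *\<^sub>R h) (x - c) + \<alpha> (y x \<tau>) h)) (at x)"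
    proof (rule has_derivative_apply_linear[where S="ball c r" and A="\<lambda>x. \<alpha> (y x \<tau>)" and A'="\<lambda>v h. \<alpha>' (y x \<tau>) (\<tau> *\<^sub>R h) v"])
      show "((\<lambda>x. \<alpha> (y x \<tau>) v) has_derivative (\<lambda>h. \<alpha>' (y x \<tau>) (\<tau> *\<^sub>R h) v)) (at x)" for v
        using has_derivative_compose[OF y' \<alpha>'[OF y[OF x \<tau>], of v]] .
      show "linear (\<alpha> (y z \<tau>))" if "z \<in> ball c r" for z using lin[OF y[OF that \<tau>]] .
    qed (use x in \<open>auto intro!: derivative_eq_intros\<close>)
    moreover have "\<alpha>' (y x \<tau>) (\<tau> *\<^sub>R h) (x - c) = \<tau> * \<alpha>' (y x \<tau>) h (x - c)" for h
      using linear_scale[OF has_derivative_linear[OF \<alpha>'[OF y[OF x \<tau>]]]] by simp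
    ultimately show ?thesis by (simp add: D_def[abs_def])
  qed
  have D_bl: "bounded_linear (D x \<tau>)" if "x \<in> ball c r" "\<tau> \<in> cbox 0 1" for x \<tau>
    using deriv[OF that] by (rule has_derivative_bounded_linear)
  have "(F has_derivative \<alpha> x) (at x)" if x: "x \<in> ball c r" for x
  proof -
    have contD: "continuous_on (ball c r \<times> cbox 0 1) (\<lambda>(x, t). Blinfun (D x t))"
    proof (rule continuous_on_blinfun_componentwise)
      fix i :: 'a
      have "continuous_on (ball c r \<times> cbox 0 1)
          (\<lambda>z. snd z * (\<Sum>b\<in>Basis. ((fst z - c) \<bullet> b) * \<alpha>' (y (fst z) (snd z)) i b) + \<alpha> (y (fst z) (snd z)) i)"
        by (intro continuous_intros \<alpha>'_cont \<alpha>_cont)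
      then show "continuous_on (ball c r \<times> cbox 0 1) (\<lambda>z. blinfun_apply (case z of (x, t) \<Rightarrow> Blinfun (D x t)) i)"
        by (rule continuous_on_cong[THEN iffD1, rotated 2])
          (auto simp: bounded_linear_Blinfun_apply[OF D_bl] D_sum)
    qed
    have "(F has_derivative blinfun_apply (integral (cbox 0 1) (\<lambda>\<tau>. Blinfun (D x \<tau>)))) (at x within ball c r)"
      unfolding F_def
    proof (rule leibniz_rule[OF _ _ contD x convex_ball])
      fix z \<tau> assume z: "z \<in> ball c r" "\<tau> \<in> cbox 0 (1::real)"
      show "((\<lambda>x. \<alpha> (y x \<tau>) (x - c)) has_derivative blinfun_apply (Blinfun (D z \<tau>))) (at z within ball c r)"
        unfolding bounded_linear_Blinfun_apply[OF D_bl[OF z]]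
        using deriv[OF z] by (rule has_derivative_at_withinI)
    next
      fix z assume z: "z \<in> ball c r"
      have "continuous_on (cbox 0 1) (\<lambda>\<tau>. \<Sum>b\<in>Basis. ((z - c) \<bullet> b) *\<^sub>R \<alpha> (y z \<tau>) b)"
        by (intro continuous_intros continuous_on_compose2[OF \<alpha>_cont, where f="Pair z", simplified]) (use z in auto)
      then have "(\<lambda>\<tau>. \<Sum>b\<in>Basis. ((z - c) \<bullet> b) *\<^sub>R \<alpha> (y z \<tau>) b) integrable_on cbox 0 1"
        by (rule integrable_continuous)
      then show "(\<lambda>\<tau>. \<alpha> (y z \<tau>) (z - c)) integrable_on cbox 0 1"
        by (rule integrable_eq) (simp add: linear_eq_sum_Basis[OF lin[OF y[OF z]], of _ "z - c"])
    qed
    moreover have "blinfun_apply (integral (cbox 0 1) (\<lambda>\<tau>. Blinfun (D x \<tau>))) h = \<alpha> x h" for h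
    proof -
      have "continuous_on (cbox 0 1) (\<lambda>\<tau>. Blinfun (D x \<tau>))"
        by (rule continuous_on_compose2[OF contD, where f="Pair x", simplified]) (use x in \<open>auto intro!: continuous_intros\<close>)
      then have int: "(\<lambda>\<tau>. Blinfun (D x \<tau>)) integrable_on cbox 0 1" by (rule integrable_continuous)
      have "((\<lambda>\<tau>. D x \<tau> h) has_integral (1 * \<alpha> (y x 1) h - 0 * \<alpha> (y x 0) h)) {0..1}"
      proof (rule fundamental_theorem_of_calculus)
        fix \<tau> :: real assume "\<tau> \<in> {0..1}"
        then have \<tau>: "\<tau> \<in> cbox 0 1" by simp
        have y': "(y x has_derivative (\<lambda>h. h *\<^sub>R (x - c))) (at \<tau>)"
          unfolding y_def by (auto intro!: derivative_eq_intros)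
        have "((\<lambda>\<tau>. \<alpha> (y x \<tau>) h) has_derivative (\<lambda>k. \<alpha>' (y x \<tau>) (k *\<^sub>R (x - c)) h)) (at \<tau>)"
          using has_derivative_compose[OF y' \<alpha>'[OF y[OF x \<tau>]]] .
        then have "((\<lambda>\<tau>. \<tau> * \<alpha> (y x \<tau>) h) has_derivative
            (\<lambda>k. \<tau> * \<alpha>' (y x \<tau>) (k *\<^sub>R (x - c)) h + k * \<alpha> (y x \<tau>) h)) (at \<tau>)"
          by (intro has_derivative_mult has_derivative_ident)
        moreover have "\<alpha>' (y x \<tau>) (k *\<^sub>R (x - c)) h = k * \<alpha>' (y x \<tau>) h (x - c)" for k
          using linear_scale[OF has_derivative_linear[OF \<alpha>'[OF y[OF x \<tau>]]], of k "x - c" h]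
            closed[OF y[OF x \<tau>], of "x - c" h] by simp
        ultimately have "((\<lambda>\<tau>. \<tau> * \<alpha> (y x \<tau>) h) has_derivative (\<lambda>k. k *\<^sub>R D x \<tau> h)) (at \<tau>)"
          by (simp add: D_def algebra_simps)
        then show "((\<lambda>\<tau>. \<tau> * \<alpha> (y x \<tau>) h) has_vector_derivative D x \<tau> h) (at \<tau> within {0..1})"
          unfolding has_vector_derivative_def by (rule has_derivative_at_withinI)
      qed simp
      then have "integral (cbox 0 1) (\<lambda>\<tau>. D x \<tau> h) = \<alpha> x h" by (simp add: integral_unique y_def)
      moreover have "integral (cbox 0 1) (\<lambda>\<tau>. blinfun_apply (Blinfun (D x \<tau>)) h) = integral (cbox 0 1) (\<lambda>\<tau>. D x \<tau> h)"
        by (rule integral_cong) (simp add: bounded_linear_Blinfun_apply[OF D_bl[OF x]])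
      ultimately show ?thesis using blinfun_apply_integral[OF int] by simp
    qed
    ultimately have "(F has_derivative \<alpha> x) (at x within ball c r)"
      by (metis (no_types, lifting) ext)
    then show ?thesis using x by (simp add: at_within_open[OF _ open_ball])
  qed
  with that show thesis by blast
qed

text \<open>Picard iteration on a short interval, for the field extended to the whole space by projecting
  to the ball.\<close>

theorem local_integral_curve:
  fixes X :: "'a::euclidean_space \<Rightarrow> 'a"
  assumes X: "L-lipschitz_on (cball c r) X" and r: "r > 0"
  obtains e \<delta> where "\<delta> > 0" "e 0 = c"
    "\<And>s. s \<in> {-\<delta>..\<delta>} \<Longrightarrow> e s \<in> cball c r"
    "\<And>s. s \<in> {-\<delta>..\<delta>} \<Longrightarrow> (e has_vector_derivative X (e s)) (at s within {-\<delta>..\<delta>})"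
proof -
  have L: "L \<ge> 0" using X by (rule lipschitz_on_nonneg)
  define Y where "Y x = X (closest_point (cball c r) x)" for x
  have cp: "closest_point (cball c r) x \<in> cball c r" for x
    using r by (intro closest_point_in_set) auto
  have Y_lip: "norm (Y x - Y y) \<le> L * norm (x - y)" for x y
  proof -
    have "norm (Y x - Y y) \<le> L * norm (closest_point (cball c r) x - closest_point (cball c r) y)"
      unfolding Y_def using lipschitz_on_normD[OF X cp cp] .
    also have "\<dots> \<le> L * norm (x - y)"
      using closest_point_lipschitz[of "cball c r" x y] r L by (intro mult_left_mono) (auto simp: dist_norm)
    finally show ?thesis .
  qed
  have Y_cont: "continuous_on UNIV Y"
    by (rule lipschitz_on_continuous_on[of L]) (use Y_lip L in \<open>auto intro!: lipschitz_onI simp: dist_norm\<close>)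
  define M where "M = norm (X c) + L * r"
  have M: "M \<ge> 0" "norm (Y x) \<le> M" for x
  proof -
    show "M \<ge> 0" using L r by (simp add: M_def)
    have "norm (Y x - X c) \<le> L * norm (closest_point (cball c r) x - c)"
      unfolding Y_def using r by (intro lipschitz_on_normD[OF X cp]) auto
    also have "\<dots> \<le> L * r" using cp[of x] L by (intro mult_left_mono) (auto simp: dist_norm norm_minus_commute)
    finally show "norm (Y x) \<le> M" unfolding M_def using norm_triangle_sub[of "Y x" "X c"] by linarith
  qed
  define \<delta> where "\<delta> = min (1 / (4 * (L + 1))) (r / (M + 1))"
  have \<delta>: "\<delta> > 0" "\<delta> * L \<le> 1 / 4" "\<delta> * M \<le> r"
  proof -
    show "\<delta> > 0" using L M r by (simp add: \<delta>_def)
    have "\<delta> * L \<le> 1 / (4 * (L + 1)) * L" using L by (intro mult_right_mono) (auto simp: \<delta>_def)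
    also have "\<dots> \<le> 1 / 4" using L by (simp add: field_simps)
    finally show "\<delta> * L \<le> 1 / 4" .
    have "\<delta> * M \<le> r / (M + 1) * M" using M by (intro mult_right_mono) (auto simp: \<delta>_def)
    also have "\<dots> \<le> r" using M(1) r by (simp add: field_simps)
    finally show "\<delta> * M \<le> r" .
  qed
  define q where "q t = max (-\<delta>) (min \<delta> t)" for t :: real
  have q: "-\<delta> \<le> q t" "q t \<le> \<delta>" for t using \<delta>(1) by (auto simp: q_def)
  define T where "T \<phi> t = c + (integral {-\<delta>..q t} (\<lambda>s. Y (\<phi> s)) - integral {-\<delta>..0} (\<lambda>s. Y (\<phi> s)))" for \<phi> t
  have Y\<phi>: "continuous_on I (\<lambda>s. Y (apply_bcontfun \<phi> s))" for I and \<phi> :: "real \<Rightarrow>\<^sub>C 'a"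
    by (rule continuous_on_compose2[OF Y_cont]) auto
  have int: "(\<lambda>s. Y (apply_bcontfun \<phi> s)) integrable_on {u..v}" for u v and \<phi> :: "real \<Rightarrow>\<^sub>C 'a"
    using Y\<phi> by (rule integrable_continuous_real)
  have bound: "norm (integral {-\<delta>..u} f) \<le> B * (2 * \<delta>)"
    if "continuous_on {-\<delta>..u} f" "\<And>s. norm (f s) \<le> B" "-\<delta> \<le> u" "u \<le> \<delta>" "B \<ge> 0" for f :: "real \<Rightarrow> 'a" and u B
  proof -
    have "norm (integral {-\<delta>..u} f) \<le> B * (u - (-\<delta>))" using that by (intro integral_bound) auto
    also have "\<dots> \<le> B * (2 * \<delta>)" using that by (intro mult_left_mono) auto
    finally show ?thesis .
  qed
  have T_in: "T (apply_bcontfun \<phi>) \<in> bcontfun" for \<phi> :: "real \<Rightarrow>\<^sub>C 'a"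
  proof (rule bcontfun_normI)
    have "continuous_on {-\<delta>..\<delta>} (\<lambda>u. integral {-\<delta>..u} (\<lambda>s. Y (apply_bcontfun \<phi> s)))"
      using int by (rule indefinite_integral_continuous_1)
    moreover have "continuous_on UNIV q" unfolding q_def by (intro continuous_intros)
    ultimately have "continuous_on UNIV (\<lambda>t. integral {-\<delta>..q t} (\<lambda>s. Y (apply_bcontfun \<phi> s)))"
      by (rule continuous_on_compose2) (use q in auto)
    then show "continuous_on UNIV (T (apply_bcontfun \<phi>))" unfolding T_def by (intro continuous_intros)
    fix t
    have "norm (integral {-\<delta>..u} (\<lambda>s. Y (apply_bcontfun \<phi> s))) \<le> M * (2 * \<delta>)" if "-\<delta> \<le> u" "u \<le> \<delta>" for u
      using bound[OF Y\<phi> M(2) that M(1)] .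
    from this[OF q] this[of 0] \<delta>(1)
    show "norm (T (apply_bcontfun \<phi>) t) \<le> norm c + (M * (2 * \<delta>) + M * (2 * \<delta>))"
      unfolding T_def by (intro norm_triangle_mono[OF order_refl] order_trans[OF norm_triangle_ineq4] add_mono) auto
  qed
  define TT where "TT \<phi> = Bcontfun (T (apply_bcontfun \<phi>))" for \<phi> :: "real \<Rightarrow>\<^sub>C 'a"
  have TT: "apply_bcontfun (TT \<phi>) = T (apply_bcontfun \<phi>)" for \<phi>
    unfolding TT_def using T_in by (rule Bcontfun_inverse)
  have "\<exists>!\<phi>. TT \<phi> = \<phi>"
  proof (rule banach_fix_type)
    show "\<forall>\<phi> \<psi>. dist (TT \<phi>) (TT \<psi>) \<le> 3 / 4 * dist \<phi> \<psi>"
    proof (intro allI dist_bound)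
      fix \<phi> \<psi> :: "real \<Rightarrow>\<^sub>C 'a" and t
      let ?d = "\<lambda>s. Y (apply_bcontfun \<phi> s) - Y (apply_bcontfun \<psi> s)"
      define B where "B = L * dist \<phi> \<psi>"
      have B: "B \<ge> 0" "norm (?d s) \<le> B" for s
      proof -
        show "B \<ge> 0" using L by (simp add: B_def)
        have "norm (?d s) \<le> L * dist (apply_bcontfun \<phi> s) (apply_bcontfun \<psi> s)"
          using Y_lip by (simp add: dist_norm)
        also have "\<dots> \<le> B" unfolding B_def using L dist_bounded by (intro mult_left_mono) auto
        finally show "norm (?d s) \<le> B" .
      qed
      have dc: "continuous_on I ?d" for I by (intro continuous_intros Y\<phi>)
      have "norm (integral {-\<delta>..0} ?d) \<le> B * (0 - (-\<delta>))"
        using dc B \<delta>(1) by (intro integral_bound) auto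
      moreover have "norm (integral {-\<delta>..q t} ?d) \<le> B * (2 * \<delta>)"
        using bound[OF dc B(2) q B(1)] .
      moreover have "T (apply_bcontfun \<phi>) t - T (apply_bcontfun \<psi>) t = integral {-\<delta>..q t} ?d - integral {-\<delta>..0} ?d"
        unfolding T_def by (simp add: integral_diff[OF int int])
      ultimately have "norm (T (apply_bcontfun \<phi>) t - T (apply_bcontfun \<psi>) t) \<le> B * (2 * \<delta>) + B * \<delta>"
        using norm_triangle_ineq4[of "integral {-\<delta>..q t} ?d" "integral {-\<delta>..0} ?d"] by simp
      also have "\<dots> = 3 * (\<delta> * L) * dist \<phi> \<psi>" by (simp add: B_def)
      also have "\<dots> \<le> 3 / 4 * dist \<phi> \<psi>" using \<delta>(2) by (intro mult_right_mono) (linarith, simp)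
      finally show "dist (apply_bcontfun (TT \<phi>) t) (apply_bcontfun (TT \<psi>) t) \<le> 3 / 4 * dist \<phi> \<psi>"
        unfolding TT dist_norm .
    qed
  qed auto
  then obtain \<phi> where "TT \<phi> = \<phi>" by blast
  define e where "e = apply_bcontfun \<phi>"
  have e: "e t = T e t" for t using TT[of \<phi>] \<open>TT \<phi> = \<phi>\<close> by (simp add: e_def)
  have e0: "e 0 = c" unfolding e[of 0] T_def q_def using \<delta>(1) by simp
  have e': "(e has_vector_derivative Y (e s)) (at s within {-\<delta>..\<delta>})" if s: "s \<in> {-\<delta>..\<delta>}" for s
  proof -
    have "((\<lambda>u. integral {-\<delta>..u} (\<lambda>s. Y (e s))) has_vector_derivative Y (e s)) (at s within {-\<delta>..\<delta>})"
      unfolding e_def using Y\<phi> s by (rule integral_has_vector_derivative)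
    then have "((\<lambda>u. c + (integral {-\<delta>..u} (\<lambda>s. Y (e s)) - integral {-\<delta>..0} (\<lambda>s. Y (e s))))
        has_vector_derivative Y (e s)) (at s within {-\<delta>..\<delta>})"
      by (auto intro!: derivative_eq_intros)
    then show ?thesis
      by (rule has_vector_derivative_transform[OF s, rotated])
        (subst e, auto simp: T_def q_def min_absorb2 max_absorb2)
  qed
  have e_in: "e s \<in> cball c r" if s: "s \<in> {-\<delta>..\<delta>}" for s
  proof -
    have "norm (e s - e 0) \<le> M * norm (s - 0)"
    proof (rule differentiable_bound[of "{-\<delta>..\<delta>}"])
      show "(e has_derivative (\<lambda>h. h *\<^sub>R Y (e u))) (at u within {-\<delta>..\<delta>})" if "u \<in> {-\<delta>..\<delta>}" for u
        using e'[OF that] by (simp add: has_vector_derivative_def)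
      show "onorm (\<lambda>h. h *\<^sub>R Y (e u)) \<le> M" if "u \<in> {-\<delta>..\<delta>}" for u
        using M by (intro onorm_bound) (auto simp: mult.commute[of M] intro!: mult_left_mono)
    qed (use s \<delta>(1) in auto)
    also have "\<dots> \<le> M * \<delta>" using s M(1) by (intro mult_left_mono) auto
    also have "\<dots> \<le> r" using \<delta>(3) by (simp add: mult.commute)
    finally show ?thesis by (simp add: e0 dist_norm norm_minus_commute)
  qed
  have YX: "Y (e s) = X (e s)" if "s \<in> {-\<delta>..\<delta>}" for s
    unfolding Y_def using closest_point_self[OF e_in[OF that]] by simp
  show thesis
  proof (rule that[of \<delta> e])
    show "(e has_vector_derivative X (e s)) (at s within {-\<delta>..\<delta>})" if "s \<in> {-\<delta>..\<delta>}" for s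
      using e'[OF that] YX[OF that] by simp
  qed (use \<delta>(1) e0 e_in in auto)
qed

section \<open>Primitives on simply connected spaces\<close>

lemma simply_connected_UNIV_path:
  fixes x y :: "'g::topological_space"
  assumes "simply_connected (UNIV :: 'g set)"
  shows "\<exists>p. path p \<and> pathstart p = x \<and> pathfinish p = y"
proof -
  have "homotopic_loops UNIV (\<lambda>_::real. x) (\<lambda>_. y)"
    using assms unfolding simply_connected_def
    by (auto simp: path_def pathstart_def pathfinish_def continuous_on_const)
  then obtain h where h: "continuous_on ({0..1::real} \<times> {0..1::real}) h"
      "\<forall>t\<in>{0..1}. h (0, t) = x" "\<forall>t\<in>{0..1}. h (1, t) = y"
    unfolding homotopic_loops by blast
  have "continuous_on {0..1} (h \<circ> (\<lambda>s. (s, 0)))"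
    by (rule continuous_on_compose) (auto intro!: continuous_intros continuous_on_subset[OF h(1)])
  then have "path (h \<circ> (\<lambda>s. (s, 0)))" by (simp add: path_def)
  then show ?thesis using h(2,3)
    by (intro exI[of _ "h \<circ> (\<lambda>s. (s, 0))"]) (auto simp: pathstart_def pathfinish_def)
qed

lemma simply_connected_UNIV_connected:
  assumes "simply_connected (UNIV :: 'g::topological_space set)"
  shows "connected (UNIV :: 'g set)"
  by (rule path_connected_imp_connected)
    (use simply_connected_UNIV_path[OF assms] in \<open>auto simp: path_connected_def\<close>)

text \<open>The pairs \<open>(U, f)\<close> in \<open>F\<close> are the primitives, on open sets \<open>U\<close>, of a closed one-form, of which
  only this is recorded: any two of them differ by a locally constant function. A primitive along a map
  \<open>h\<close> is a primitive of the pulled-back form.\<close>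

definition primitive_along ::
    "('g::topological_space set \<times> ('g \<Rightarrow> real)) set \<Rightarrow> 'k::topological_space set \<Rightarrow> ('k \<Rightarrow> 'g) \<Rightarrow> ('k \<Rightarrow> real) \<Rightarrow> bool" where
  "primitive_along F K h g \<longleftrightarrow>
     (\<forall>x\<in>K. \<forall>(U, f)\<in>F. h x \<in> U \<longrightarrow> (\<forall>\<^sub>F y in at x within K. g y - f (h y) = g x - f (h x)))"

locale compatible_primitives =
  fixes F :: "('g::topological_space set \<times> ('g \<Rightarrow> real)) set"
  assumes open_dom: "(U, f) \<in> F \<Longrightarrow> open U"
    and cover: "\<exists>U f. (U, f) \<in> F \<and> x \<in> U"
    and compat: "(U, f) \<in> F \<Longrightarrow> (U', f') \<in> F \<Longrightarrow> x \<in> U \<Longrightarrow> x \<in> U' \<Longrightarrow>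
      \<forall>\<^sub>F y in nhds x. f y - f' y = f x - f' x"
begin

abbreviation "prim \<equiv> primitive_along F"

text \<open>It suffices to compare with one member of \<open>F\<close> around each point, since the members agree up to
  locally constant functions.\<close>

lemma primitive_alongI:
  assumes h: "continuous_on K h"
    and ex: "\<And>x. x \<in> K \<Longrightarrow> \<exists>U f. (U, f) \<in> F \<and> h x \<in> U \<and>
      (\<forall>\<^sub>F y in at x within K. g y - f (h y) = g x - f (h x))"
  shows "prim K h g"
  unfolding primitive_along_def
proof (clarify)
  fix x U f assume x: "x \<in> K" and U: "(U, f) \<in> F" "h x \<in> U"
  obtain U' f' where U': "(U', f') \<in> F" "h x \<in> U'"
    and ev: "\<forall>\<^sub>F y in at x within K. g y - f' (h y) = g x - f' (h x)"
    using ex[OF x] by blast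
  have "(h \<longlongrightarrow> h x) (at x within K)" using h x by (simp add: continuous_on_def)
  then have "\<forall>\<^sub>F y in at x within K. f' (h y) - f (h y) = f' (h x) - f (h x)"
    using eventually_compose_filterlim[OF compat[OF U'(1) U(1) U'(2) U(2)]] by blast
  with ev show "\<forall>\<^sub>F y in at x within K. g y - f (h y) = g x - f (h x)"
    by eventually_elim linarith
qed

lemma primitive_along_unique:
  assumes "prim K h g" "prim K h g'" "connected K" "x \<in> K" "y \<in> K"
  shows "g y - g x = g' y - g' x"
proof -
  have "(\<lambda>z. g z - g' z) x = (\<lambda>z. g z - g' z) y"
  proof (rule connected_local_const[OF assms(3-5)], rule ballI)
    fix a assume a: "a \<in> K"
    obtain U f where U: "(U, f) \<in> F" "h a \<in> U" using cover by blast
    have "\<forall>\<^sub>F y in at a within K. g y - f (h y) = g a - f (h a)"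
      "\<forall>\<^sub>F y in at a within K. g' y - f (h y) = g' a - f (h a)"
      using assms(1,2) a U unfolding primitive_along_def by blast+
    then show "\<forall>\<^sub>F b in at a within K. g a - g' a = g b - g' b"
      by eventually_elim linarith
  qed
  then show ?thesis by simp
qed

lemma primitive_along_cong:
  assumes g: "prim K h g" and eq: "\<And>x. x \<in> K \<Longrightarrow> k x = h x"
  shows "prim K k g"
  unfolding primitive_along_def
proof (clarify)
  fix x U f assume x: "x \<in> K" and U: "(U, f) \<in> F" "k x \<in> U"
  have "\<forall>\<^sub>F y in at x within K. g y - f (h y) = g x - f (h x)"
    using g x U eq[OF x] unfolding primitive_along_def by force
  moreover have "\<forall>\<^sub>F y in at x within K. y \<in> K" by (simp add: eventually_at_filter)
  ultimately show "\<forall>\<^sub>F y in at x within K. g y - f (k y) = g x - f (k x)"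
    by eventually_elim (simp add: eq x)
qed

lemma primitive_along_in_domain:
  assumes "continuous_on K h" "(U, f) \<in> F" "h ` K \<subseteq> U"
  shows "prim K h (f \<circ> h)"
  using assms by (intro primitive_alongI exI[of _ U] exI[of _ f]) auto

lemma primitive_along_compose:
  assumes g: "prim K h g" and \<phi>: "continuous_on K' \<phi>" "\<phi> ` K' \<subseteq> K"
  shows "prim K' (h \<circ> \<phi>) (g \<circ> \<phi>)"
  unfolding primitive_along_def
proof (clarify)
  fix x U f assume x: "x \<in> K'" and U: "(U, f) \<in> F" "(h \<circ> \<phi>) x \<in> U"
  have "\<forall>\<^sub>F y in at (\<phi> x) within K. g y - f (h y) = g (\<phi> x) - f (h (\<phi> x))"
    using g x U \<phi>(2) unfolding primitive_along_def by force
  then have "\<forall>\<^sub>F y in nhds (\<phi> x). y \<in> K \<longrightarrow> g y - f (h y) = g (\<phi> x) - f (h (\<phi> x))"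
    unfolding eventually_at_filter by eventually_elim auto
  moreover have "(\<phi> \<longlongrightarrow> \<phi> x) (at x within K')" using \<phi>(1) x by (simp add: continuous_on_def)
  ultimately have "\<forall>\<^sub>F y in at x within K'. \<phi> y \<in> K \<longrightarrow> g (\<phi> y) - f (h (\<phi> y)) = g (\<phi> x) - f (h (\<phi> x))"
    by (rule eventually_compose_filterlim)
  moreover have "\<forall>\<^sub>F y in at x within K'. y \<in> K'"
    by (simp add: eventually_at_filter)
  ultimately show "\<forall>\<^sub>F y in at x within K'. (g \<circ> \<phi>) y - f ((h \<circ> \<phi>) y) = (g \<circ> \<phi>) x - f ((h \<circ> \<phi>) x)"
    by eventually_elim (use \<phi>(2) in auto)
qed

text \<open>The two primitives differ by a constant on the connected intersection, and one of them can be
  shifted by it.\<close>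

lemma primitive_along_Un:
  assumes h: "continuous_on (K1 \<union> K2) h" and g: "prim K1 h g1" "prim K2 h g2"
    and K: "closed K1" "closed K2" "connected (K1 \<inter> K2)"
  shows "\<exists>g. prim (K1 \<union> K2) h g"
proof -
  define c where "c = (if K1 \<inter> K2 = {} then 0 else let z = SOME z. z \<in> K1 \<inter> K2 in g1 z - g2 z)"
  define g where "g x = (if x \<in> K1 then g1 x else g2 x + c)" for x
  have "prim (K1 \<inter> K2) h g1" "prim (K1 \<inter> K2) h g2"
    using primitive_along_compose[OF g(1), of "K1 \<inter> K2" id] primitive_along_compose[OF g(2), of "K1 \<inter> K2" id]
    by (auto simp: continuous_on_id[unfolded id_def[symmetric]])
  then have g12: "g1 x = g2 x + c" if "x \<in> K1 \<inter> K2" for x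
  proof -
    have ne: "K1 \<inter> K2 \<noteq> {}" using that by blast
    define z where "z = (SOME z. z \<in> K1 \<inter> K2)"
    have z: "z \<in> K1 \<inter> K2" unfolding z_def using that by (rule someI)
    have "c = g1 z - g2 z" using ne by (simp only: c_def z_def Let_def if_False)
    moreover have "g1 x - g1 z = g2 x - g2 z"
      using primitive_along_unique[OF \<open>prim (K1 \<inter> K2) h g1\<close> \<open>prim (K1 \<inter> K2) h g2\<close> K(3) z that] .
    ultimately show ?thesis by simp
  qed
  have gK: "g x = g1 x" if "x \<in> K1" for x using that by (simp add: g_def)
  have gK2: "g x = g2 x + c" if "x \<in> K2" for x using that g12 by (auto simp: g_def)
  have one: "\<forall>\<^sub>F y in nhds x. y \<in> K \<longrightarrow> g y - f (h y) = g x - f (h x)"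
    if "closed K" "x \<in> K \<Longrightarrow> \<forall>\<^sub>F y in at x within K. g y - f (h y) = g x - f (h x)" for K x f
  proof (cases "x \<in> K")
    case True
    then show ?thesis using that(2)[OF True] unfolding eventually_at_filter by eventually_elim auto
  next
    case False
    then have "\<forall>\<^sub>F y in nhds x. y \<in> - K" using \<open>closed K\<close> by (intro eventually_nhds_in_open) auto
    then show ?thesis by eventually_elim auto
  qed
  have "prim (K1 \<union> K2) h g"
    unfolding primitive_along_def
  proof (clarify)
    fix x U f assume x: "x \<in> K1 \<union> K2" and U: "(U, f) \<in> F" "h x \<in> U"
    have "\<forall>\<^sub>F y in nhds x. y \<in> K1 \<longrightarrow> g y - f (h y) = g x - f (h x)"
    proof (rule one[OF K(1)])
      assume x1: "x \<in> K1"
      have "\<forall>\<^sub>F y in at x within K1. g1 y - f (h y) = g1 x - f (h x)"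
        using g(1) x1 U unfolding primitive_along_def by blast
      moreover have "\<forall>\<^sub>F y in at x within K1. y \<in> K1" by (simp add: eventually_at_filter)
      ultimately show "\<forall>\<^sub>F y in at x within K1. g y - f (h y) = g x - f (h x)"
        by eventually_elim (simp add: gK x1)
    qed
    moreover have "\<forall>\<^sub>F y in nhds x. y \<in> K2 \<longrightarrow> g y - f (h y) = g x - f (h x)"
    proof (rule one[OF K(2)])
      assume x1: "x \<in> K2"
      have "\<forall>\<^sub>F y in at x within K2. g2 y - f (h y) = g2 x - f (h x)"
        using g(2) x1 U unfolding primitive_along_def by blast
      moreover have "\<forall>\<^sub>F y in at x within K2. y \<in> K2" by (simp add: eventually_at_filter)
      ultimately show "\<forall>\<^sub>F y in at x within K2. g y - f (h y) = g x - f (h x)"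
        by eventually_elim (simp add: gK2 x1)
    qed
    ultimately show "\<forall>\<^sub>F y in at x within K1 \<union> K2. g y - f (h y) = g x - f (h x)"
      unfolding eventually_at_filter by eventually_elim auto
  qed
  then show ?thesis by blast
qed

text \<open>By compactness a fine subdivision of the square has cells that \<open>h\<close> maps into the domains of
  members of \<open>F\<close>. The cells are glued to columns and the columns to the square; the intersections
  that occur are segments, hence connected.\<close>

lemma primitive_along_square:
  fixes h :: "real \<times> real \<Rightarrow> 'g"
  assumes h: "continuous_on ({0..1} \<times> {0..1}) h"
  obtains g where "prim ({0..1} \<times> {0..1}) h g"
proof -
  let ?S = "{0..1::real} \<times> {0..1::real}"
  define G where "G = {V. open V \<and> (\<exists>U f. (U, f) \<in> F \<and> h ` (V \<inter> ?S) \<subseteq> U)}"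
  have "?S \<subseteq> \<Union>G"
  proof
    fix x assume x: "x \<in> ?S"
    obtain U f where U: "(U, f) \<in> F" "h x \<in> U" using cover by blast
    obtain V where "open V" "x \<in> V" "\<forall>y\<in>?S. y \<in> V \<longrightarrow> h y \<in> U"
      using h x U(2) open_dom[OF U(1)] unfolding continuous_on_topological by metis
    then show "x \<in> \<Union>G" using U unfolding G_def by blast
  qed
  moreover have "compact ?S" by (intro compact_Times compact_Icc)
  moreover have "\<And>V. V \<in> G \<Longrightarrow> open V" by (simp add: G_def)
  ultimately obtain \<epsilon> where \<epsilon>: "\<epsilon> > 0" "\<And>x. x \<in> ?S \<Longrightarrow> \<exists>V\<in>G. ball x \<epsilon> \<subseteq> V"
    using Heine_Borel_lemma[of ?S G] by metis
  have "\<exists>g. prim ({0..1} \<times> {0..1}) h g"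
  proof (rule interval_local_to_global[where P="\<lambda>u v. \<exists>g. prim ({u..v} \<times> {0..1}) h g"])
    fix u v w :: real assume uvw: "0 \<le> u" "u \<le> v" "v \<le> w" "w \<le> 1"
      and P: "\<exists>g. prim ({u..v} \<times> {0..1}) h g" "\<exists>g. prim ({v..w} \<times> {0..1}) h g"
    have eq: "{u..w} \<times> {0..1::real} = {u..v} \<times> {0..1} \<union> {v..w} \<times> {0..1}" using uvw by auto
    have int: "({u..v} \<times> {0..1}) \<inter> ({v..w} \<times> {0..1::real}) = {v} \<times> {0..1}" using uvw by auto
    obtain g1 g2 where g: "prim ({u..v} \<times> {0..1}) h g1" "prim ({v..w} \<times> {0..1}) h g2" using P by blast
    have "{u..v} \<times> {0..1} \<union> {v..w} \<times> {0..1::real} \<subseteq> ?S"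
      unfolding eq[symmetric] using uvw by (intro Sigma_mono) auto
    then have cont: "continuous_on ({u..v} \<times> {0..1} \<union> {v..w} \<times> {0..1::real}) h"
      by (rule continuous_on_subset[OF h])
    show "\<exists>g. prim ({u..w} \<times> {0..1}) h g"
      unfolding eq
    proof (rule primitive_along_Un[OF cont g])
      show "connected (({u..v} \<times> {0..1}) \<inter> ({v..w} \<times> {0..1::real}))"
        unfolding int by (rule connected_Times) auto
    qed (intro closed_Times closed_atLeastAtMost)+
  next
    fix s :: real assume s: "0 \<le> s" "s \<le> 1"
    show "\<exists>d>0. \<forall>u v. 0 \<le> u \<and> u \<le> s \<and> s \<le> v \<and> v \<le> 1 \<and> v - u < d \<longrightarrow> (\<exists>g. prim ({u..v} \<times> {0..1}) h g)"
    proof (intro exI[of _ "\<epsilon> / 2"] conjI allI impI)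
      fix u v assume uv: "0 \<le> u \<and> u \<le> s \<and> s \<le> v \<and> v \<le> 1 \<and> v - u < \<epsilon> / 2"
      show "\<exists>g. prim ({u..v} \<times> {0..1}) h g"
      proof (rule interval_local_to_global[where P="\<lambda>a b. \<exists>g. prim ({u..v} \<times> {a..b}) h g"])
        fix a b c :: real assume abc: "0 \<le> a" "a \<le> b" "b \<le> c" "c \<le> 1"
          and P: "\<exists>g. prim ({u..v} \<times> {a..b}) h g" "\<exists>g. prim ({u..v} \<times> {b..c}) h g"
        have eq: "{u..v} \<times> {a..c} = {u..v} \<times> {a..b} \<union> {u..v} \<times> {b..c}" using abc by auto
        have int: "({u..v} \<times> {a..b}) \<inter> ({u..v} \<times> {b..c}) = {u..v} \<times> {b}" using abc by auto
        obtain g1 g2 where g: "prim ({u..v} \<times> {a..b}) h g1" "prim ({u..v} \<times> {b..c}) h g2" using P by blast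
        have cont: "continuous_on ({u..v} \<times> {a..b} \<union> {u..v} \<times> {b..c}) h"
          by (rule continuous_on_subset[OF h]) (use uv abc in auto)
        show "\<exists>g. prim ({u..v} \<times> {a..c}) h g"
          unfolding eq
        proof (rule primitive_along_Un[OF cont g])
          show "connected (({u..v} \<times> {a..b}) \<inter> ({u..v} \<times> {b..c}))"
            unfolding int by (rule connected_Times) auto
        qed (intro closed_Times closed_atLeastAtMost)+
      next
        fix t :: real assume t: "0 \<le> t" "t \<le> 1"
        show "\<exists>d>0. \<forall>a b. 0 \<le> a \<and> a \<le> t \<and> t \<le> b \<and> b \<le> 1 \<and> b - a < d \<longrightarrow> (\<exists>g. prim ({u..v} \<times> {a..b}) h g)"
        proof (intro exI[of _ "\<epsilon> / 2"] conjI allI impI)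
          fix a b assume ab: "0 \<le> a \<and> a \<le> t \<and> t \<le> b \<and> b \<le> 1 \<and> b - a < \<epsilon> / 2"
          obtain V where V: "V \<in> G" "ball (s, t) \<epsilon> \<subseteq> V" using \<epsilon>(2)[of "(s,t)"] s t by auto
          then obtain U f where U: "(U, f) \<in> F" "h ` (V \<inter> ?S) \<subseteq> U" by (auto simp: G_def)
          have sub: "{u..v} \<times> {a..b} \<subseteq> V \<inter> ?S"
          proof
            fix z assume "z \<in> {u..v} \<times> {a..b}"
            then obtain x y where z: "z = (x, y)" "x \<in> {u..v}" "y \<in> {a..b}" by blast
            have "dist (s, t) (x, y) \<le> dist s x + dist t y"
              unfolding dist_prod_def using sqrt_sum_squares_le_sum[of "dist s x" "dist t y"] by simp
            also have "\<dots> < \<epsilon> / 2 + \<epsilon> / 2"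
              using z(2,3) uv ab unfolding dist_real_def atLeastAtMost_iff
              by (intro add_strict_mono; linarith)
            finally show "z \<in> V \<inter> ?S" using V(2) z uv ab by auto
          qed
          have "continuous_on ({u..v} \<times> {a..b}) h" using h sub by (meson continuous_on_subset le_inf_iff)
          moreover have "h ` ({u..v} \<times> {a..b}) \<subseteq> U" using U(2) sub by (meson image_mono order_trans)
          ultimately have "prim ({u..v} \<times> {a..b}) h (f \<circ> h)"
            using U(1) by (intro primitive_along_in_domain)
          then show "\<exists>g. prim ({u..v} \<times> {a..b}) h g" by blast
        qed (use \<epsilon> in simp)
      qed simp
    qed (use \<epsilon> in simp)
  qed simp
  then show thesis using that by blast
qed

lemma primitive_along_path:
  assumes "path p"
  obtains g where "prim {0..1} p g"
proof -
  have p: "continuous_on {0..1} p" using assms by (simp add: path_def)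
  have "continuous_on ({0..1::real} \<times> {0..1}) (p \<circ> snd)"
    by (rule continuous_on_compose[OF continuous_on_snd[OF continuous_on_id]])
      (auto intro: continuous_on_subset[OF p])
  then obtain g where g: "prim ({0..1::real} \<times> {0..1}) (p \<circ> snd) g"
    using primitive_along_square by blast
  have "prim {0..1} ((p \<circ> snd) \<circ> (\<lambda>t. (0::real, t))) (g \<circ> (\<lambda>t. (0, t)))"
    by (rule primitive_along_compose[OF g]) (auto intro!: continuous_intros)
  then have "prim {0..1} p (g \<circ> Pair 0)" by (simp add: o_def)
  with that show thesis by blast
qed

text \<open>Along a homotopy of loops to a constant loop, the increment of the primitive around the loop
  is locally constant in the homotopy parameter and ends up at \<open>0\<close>.\<close>

lemma primitive_along_loop:
  assumes sc: "simply_connected (UNIV :: 'g set)"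
    and p: "path p" "pathfinish p = pathstart p" and g: "prim {0..1} p g"
  shows "g 1 = g 0"
proof -
  define q where "q = (\<lambda>t::real. p 0)"
  have "path q" by (simp add: q_def path_def continuous_on_const)
  then have "homotopic_loops UNIV p q"
    using sc p unfolding simply_connected_def by (auto simp: q_def pathstart_def pathfinish_def)
  then obtain h where h: "continuous_on ({0..1::real} \<times> {0..1}) h"
      "\<forall>x\<in>{0..1}. h (0, x) = p x" "\<forall>x\<in>{0..1}. h (1, x) = q x"
      "\<forall>t\<in>{0..1}. pathfinish (h \<circ> Pair t) = pathstart (h \<circ> Pair t)"
    unfolding homotopic_loops by blast
  obtain G where G: "prim ({0..1} \<times> {0..1}) h G" using h(1) by (rule primitive_along_square)
  have side: "prim {0..1} (\<lambda>t. h (\<phi> t)) (\<lambda>t. G (\<phi> t))"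
    if "continuous_on {0..1} \<phi>" "\<phi> ` {0..1::real} \<subseteq> {0..1} \<times> {0..1}" for \<phi>
    using primitive_along_compose[OF G that] by (simp add: o_def)
  have con: "connected {0..1::real}" by simp
  note cong = primitive_along_cong[where K="{0..1::real}"]
  have "prim {0..1} (\<lambda>t. h (0, t)) (\<lambda>t. G (0, t))" by (rule side) (auto intro!: continuous_intros)
  then have "prim {0..1} p (\<lambda>t. G (0, t))" by (rule cong) (use h(2) in auto)
  then have 1: "g 1 - g 0 = G (0, 1) - G (0, 0)"
    using primitive_along_unique[OF g _ con, of _ 0 1] by simp
  have "prim {0..1} (\<lambda>s. h (s, 0)) (\<lambda>s. G (s, 0))" "prim {0..1} (\<lambda>s. h (s, 1)) (\<lambda>s. G (s, 1))"
    by (rule side; auto intro!: continuous_intros)+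
  moreover have "h (s, 1) = h (s, 0)" if "s \<in> {0..1}" for s
    using h(4) that by (auto simp: pathstart_def pathfinish_def)
  ultimately have "G (1, 0) - G (0, 0) = G (1, 1) - G (0, 1)"
    using primitive_along_unique[OF _ cong con, of "\<lambda>s. h (s, 0)" "\<lambda>s. G (s, 0)" "\<lambda>s. h (s, 1)" "\<lambda>s. G (s, 1)" 0 1]
    by simp
  moreover have "G (1, 1) = G (1, 0)"
  proof -
    obtain U f where U: "(U, f) \<in> F" "p 0 \<in> U" using cover by blast
    have "prim {0..1} (\<lambda>t. h (1, t)) (\<lambda>t. G (1, t))" by (rule side) (auto intro!: continuous_intros)
    then have "prim {0..1} q (\<lambda>t. G (1, t))" by (rule cong) (use h(3) in auto)
    moreover have "prim {0..1} q (f \<circ> q)"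
      using U by (intro primitive_along_in_domain) (auto simp: q_def continuous_on_const)
    ultimately show ?thesis
      using primitive_along_unique[OF _ _ con, of q _ _ 0 1] by (force simp: q_def)
  qed
  ultimately show ?thesis using 1 by simp
qed

text \<open>Apply the statement about loops to the first path followed by the reversed second one.\<close>

lemma primitive_along_paths_eq:
  assumes sc: "simply_connected (UNIV :: 'g set)"
    and p: "path p" "path q" "pathstart p = pathstart q" "pathfinish p = pathfinish q"
    and g: "prim {0..1} p g" "prim {0..1} q g'"
  shows "g 1 - g 0 = g' 1 - g' 0"
proof -
  define l where "l = p +++ reversepath q"
  have l: "path l" "pathfinish l = pathstart l" using p by (auto simp: l_def)
  obtain G where G: "prim {0..1} l G" using primitive_along_path[OF l(1)] by blast
  have con: "connected {0..1::real}" by simp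
  have "prim {0..1} (l \<circ> (\<lambda>t. t / 2)) (G \<circ> (\<lambda>t. t / 2))"
    by (rule primitive_along_compose[OF G]) (auto intro!: continuous_intros)
  then have Gp: "prim {0..1} p (G \<circ> (\<lambda>t. t / 2))"
    by (rule primitive_along_cong) (auto simp: l_def joinpaths_def)
  have "prim {0..1} (l \<circ> (\<lambda>t. 1 - t / 2)) (G \<circ> (\<lambda>t. 1 - t / 2))"
    by (rule primitive_along_compose[OF G]) (auto intro!: continuous_intros)
  then have Gq: "prim {0..1} q (G \<circ> (\<lambda>t. 1 - t / 2))"
  proof (rule primitive_along_cong)
    fix t :: real assume t: "t \<in> {0..1}"
    have "p 1 = q 1" using p(4) by (simp add: pathfinish_def)
    then show "q t = (l \<circ> (\<lambda>t. 1 - t / 2)) t"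
      using t by (cases "t = 1") (auto simp: l_def joinpaths_def reversepath_def field_simps)
  qed
  show ?thesis
    using primitive_along_unique[OF g(1) Gp con, of 0 1] primitive_along_unique[OF g(2) Gq con, of 0 1]
      primitive_along_loop[OF sc l G]
    by simp
qed

text \<open>Develop the local primitives along paths from a base point. The result depends on the
  endpoint only, and near a point it is a local primitive up to a constant.\<close>

theorem global_primitive:
  assumes sc: "simply_connected (UNIV :: 'g set)"
    and lpc: "\<And>x (U :: 'g set). open U \<Longrightarrow> x \<in> U \<Longrightarrow> \<exists>W. open W \<and> x \<in> W \<and> W \<subseteq> U \<and> path_connected W"
  obtains g where "\<And>U f x. (U, f) \<in> F \<Longrightarrow> x \<in> U \<Longrightarrow> \<forall>\<^sub>F y in nhds x. g y - f y = g x - f x"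
proof -
  fix x0 :: 'g
  have con: "connected {0..1::real}" by simp
  note ex_path = simply_connected_UNIV_path[OF sc, of x0]
  define P where "P x pg \<longleftrightarrow> path (fst pg) \<and> pathstart (fst pg) = x0 \<and> pathfinish (fst pg) = x
      \<and> prim {0..1} (fst pg) (snd pg)" for x pg
  have "\<exists>pg. P x pg" for x
  proof -
    obtain p where p: "path p" "pathstart p = x0" "pathfinish p = x" using ex_path by blast
    obtain g where "prim {0..1} p g" using primitive_along_path[OF p(1)] by blast
    then show ?thesis using p unfolding P_def by (intro exI[of _ "(p, g)"]) simp
  qed
  then obtain PG where PG: "\<And>x. P x (PG x)" by metis
  define g where "g x = snd (PG x) 1 - snd (PG x) 0" for x
  have g_eq: "g x = \<phi> 1 - \<phi> 0"
    if "path p" "pathstart p = x0" "pathfinish p = x" "prim {0..1} p \<phi>" for x p \<phi>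
    using primitive_along_paths_eq[OF sc, of "fst (PG x)" p "snd (PG x)" \<phi>] PG[of x] that
    unfolding P_def g_def by simp
  have "\<forall>\<^sub>F y in nhds x. g y - f y = g x - f x" if U: "(U, f) \<in> F" and x: "x \<in> U" for U f x
  proof -
    obtain W where W: "open W" "x \<in> W" "W \<subseteq> U" "path_connected W"
      using lpc[OF open_dom[OF U] x] by blast
    have "g y - f y = g x - f x" if y: "y \<in> W" for y
    proof -
      obtain q where q: "path q" "path_image q \<subseteq> W" "pathstart q = x" "pathfinish q = y"
        using W(2,4) y unfolding path_connected_def by blast
      obtain p where p: "path p" "pathstart p = x0" "pathfinish p = x" using ex_path by blast
      define r where "r = p +++ q"
      have r: "path r" "pathstart r = x0" "pathfinish r = y" using p q by (auto simp: r_def)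
      obtain \<phi> where \<phi>: "prim {0..1} r \<phi>" using primitive_along_path[OF r(1)] by blast
      have "prim {0..1} (r \<circ> (\<lambda>t. t / 2)) (\<phi> \<circ> (\<lambda>t. t / 2))"
        by (rule primitive_along_compose[OF \<phi>]) (auto intro!: continuous_intros)
      then have \<phi>p: "prim {0..1} p (\<phi> \<circ> (\<lambda>t. t / 2))"
        by (rule primitive_along_cong) (auto simp: r_def joinpaths_def)
      have "prim {0..1} (r \<circ> (\<lambda>t. 1 / 2 + t / 2)) (\<phi> \<circ> (\<lambda>t. 1 / 2 + t / 2))"
        by (rule primitive_along_compose[OF \<phi>]) (auto intro!: continuous_intros)
      then have \<phi>q: "prim {0..1} q (\<phi> \<circ> (\<lambda>t. 1 / 2 + t / 2))"
      proof (rule primitive_along_cong)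
        fix t :: real assume t: "t \<in> {0..1}"
        have "p 1 = q 0" using p(3) q(3) by (simp add: pathfinish_def pathstart_def)
        then show "q t = (r \<circ> (\<lambda>t. 1 / 2 + t / 2)) t"
          using t by (cases "t = 0") (auto simp: r_def joinpaths_def field_simps)
      qed
      have "prim {0..1} q (f \<circ> q)"
        using q W(3) by (intro primitive_along_in_domain[OF _ U]) (auto simp: path_def path_image_def)
      then have "\<phi> 1 - \<phi> (1/2) = f y - f x"
        using primitive_along_unique[OF \<phi>q _ con, of "f \<circ> q" 0 1] q(3,4)
        by (simp add: pathfinish_def pathstart_def)
      moreover have "g x = \<phi> (1/2) - \<phi> 0" using g_eq[OF p \<phi>p] by simp
      moreover have "g y = \<phi> 1 - \<phi> 0" using g_eq[OF r \<phi>] .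
      ultimately show ?thesis by simp
    qed
    then show ?thesis using eventually_nhds_in_open[OF W(1,2)] by (auto elim: eventually_mono)
  qed
  with that show thesis by blast
qed

end

section \<open>Lie groups in a chart at the identity\<close>

text \<open>The derivatives in \<open>Ck_on\<close> are limits along all of the space, which near the points of an open set
  \<open>S\<close> depend on the values on \<open>S\<close> only.\<close>

lemma Ck_on_cong:
  assumes "open S" "\<And>x. x \<in> S \<Longrightarrow> f x = g x" "Ck_on k f S"
  shows "Ck_on k g S"
  using assms(2,3)
proof (induction k arbitrary: f g)
  case 0 then show ?case using continuous_on_cong by (metis Ck_on.simps(1))
next
  case (Suc k)
  have eq: "(f has_derivative D) (at x) \<longleftrightarrow> (g has_derivative D) (at x)" if "x \<in> S" for x D
    using has_derivative_transform_within_open[OF _ \<open>open S\<close> that, of f D UNIV g]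
      has_derivative_transform_within_open[OF _ \<open>open S\<close> that, of g D UNIV f] Suc.prems(1) by auto
  have "frechet_derivative f (at x) = frechet_derivative g (at x)" if "x \<in> S" for x
    unfolding frechet_derivative_def using eq[OF that] by simp
  then have "Ck_on k (\<lambda>x. frechet_derivative g (at x) v) S" for v
    using Suc.IH[of "\<lambda>x. frechet_derivative f (at x) v" "\<lambda>x. frechet_derivative g (at x) v"] Suc.prems(2)
    by simp
  moreover have "g differentiable at x" if "x \<in> S" for x
  proof -
    have "f differentiable at x" using Suc.prems(2) that by simp
    then show ?thesis using eq[OF that] unfolding differentiable_def by blast
  qed
  ultimately show ?case by simp
qed

abbreviation deriv1 :: "('a::real_normed_vector \<Rightarrow> 'b::real_normed_vector) \<Rightarrow> 'a \<Rightarrow> 'a \<Rightarrow> 'b" where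
  "deriv1 f x \<equiv> frechet_derivative f (at x)"

abbreviation deriv2 :: "('a::real_normed_vector \<Rightarrow> 'b::real_normed_vector) \<Rightarrow> 'a \<Rightarrow> 'a \<Rightarrow> 'a \<Rightarrow> 'b" where
  "deriv2 f x v \<equiv> frechet_derivative (\<lambda>y. deriv1 f y v) (at x)"

lemma smooth_on_deriv:
  assumes "smooth_on S f" "x \<in> S"
  shows "(f has_derivative deriv1 f x) (at x)"
    and "((\<lambda>y. deriv1 f y v) has_derivative deriv2 f x v) (at x)"
proof -
  have "Ck_on (Suc (Suc 0)) f S" using assms(1) unfolding smooth_on_def by blast
  then show "(f has_derivative deriv1 f x) (at x)"
    "((\<lambda>y. deriv1 f y v) has_derivative deriv2 f x v) (at x)"
    using assms(2) by (auto simp: frechet_derivative_works[symmetric])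
qed

lemma smooth_on_continuous_deriv:
  assumes "smooth_on S f"
  shows "continuous_on S f" "continuous_on S (\<lambda>x. deriv1 f x v)" "continuous_on S (\<lambda>x. deriv2 f x v w)"
proof -
  have "Ck_on 0 f S" "Ck_on (Suc 0) f S" "Ck_on (Suc (Suc 0)) f S" using assms unfolding smooth_on_def by blast+
  then show "continuous_on S f" "continuous_on S (\<lambda>x. deriv1 f x v)" "continuous_on S (\<lambda>x. deriv2 f x v w)"
    by auto
qed

lemma smooth_on_deriv2_commute:
  fixes f :: "'a::real_normed_vector \<Rightarrow> 'b::euclidean_space"
  assumes f: "smooth_on S f" and S: "open S" "x \<in> S"
  shows "deriv2 f x v w = deriv2 f x w v"
proof (rule symmetric_second_derivative[OF S, where f'="deriv1 f"])
  show "continuous (at x) (\<lambda>y. deriv2 f y v w)" for v w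
    using smooth_on_continuous_deriv(3)[OF f] S by (simp add: continuous_on_eq_continuous_at)
qed (use smooth_on_deriv[OF f] in auto)

lemma continuous_on_apply_linear:
  fixes A :: "'c::topological_space \<Rightarrow> 'a::euclidean_space \<Rightarrow> 'b::real_normed_vector"
  assumes "\<And>v. continuous_on S (\<lambda>x. A x v)" "\<And>x. x \<in> S \<Longrightarrow> linear (A x)" "continuous_on S w"
  shows "continuous_on S (\<lambda>x. A x (w x))"
proof -
  have "continuous_on S (\<lambda>x. \<Sum>b\<in>Basis. (w x \<bullet> b) *\<^sub>R A x b)"
    by (intro continuous_intros assms)
  then show ?thesis
    by (rule continuous_on_eq) (use linear_eq_sum_Basis[OF assms(2)] in metis)
qed

locale lie_group_in_charts =
  fixes A :: "('g::{t2_space,second_countable_topology}, 'a::euclidean_space) chart set"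
    and mul :: "'g \<Rightarrow> 'g \<Rightarrow> 'g" and e :: 'g and iv :: "'g \<Rightarrow> 'g"
  assumes lie_group: "lie_group A mul e iv"
begin

notation mul (infixl "\<odot>" 70)

sublocale grp: group mul e iv
  using lie_group by (simp add: lie_group_def)

lemma mul_cancel [simp]: "iv p \<odot> (p \<odot> q) = q" "p \<odot> (iv p \<odot> q) = q"
    "q \<odot> p \<odot> iv p = q" "q \<odot> iv p \<odot> p = q" "e \<odot> p = p" "p \<odot> e = p" "iv p \<odot> p = e" "p \<odot> iv p = e"
    "iv (iv p) = p" "iv e = e"
proof -
  show "e \<odot> p = p" "p \<odot> e = p" "iv p \<odot> p = e" "p \<odot> iv p = e" "iv (iv p) = p" "iv e = e"
    by (rule grp.left_neutral grp.right_neutral grp.left_inverse grp.right_inverse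
        grp.inverse_inverse grp.inverse_neutral)+
  note rules = grp.left_neutral grp.right_neutral grp.left_inverse grp.right_inverse
  show "iv p \<odot> (p \<odot> q) = q" "p \<odot> (iv p \<odot> q) = q"
    by (simp_all add: grp.assoc[symmetric] rules)
  show "q \<odot> p \<odot> iv p = q" "q \<odot> iv p \<odot> p = q"
    by (simp_all add: grp.assoc rules)
qed

lemma iv_mul: "iv (p \<odot> q) = iv q \<odot> iv p"
  by (rule grp.inverse_distrib_swap)

lemma chart:
  assumes "c \<in> A"
  shows "open (fst c)" "open (snd c ` fst c)"
    "continuous_on (fst c) (snd c)" "continuous_on (snd c ` fst c) (chart_inv c)"
    "q \<in> fst c \<Longrightarrow> chart_inv c (snd c q) = q"
    "x \<in> snd c ` fst c \<Longrightarrow> chart_inv c x \<in> fst c"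
    "x \<in> snd c ` fst c \<Longrightarrow> snd c (chart_inv c x) = x"
    "inj_on (snd c) (fst c)"
proof -
  have *: "open (fst c)" "open (snd c ` fst c)" "homeomorphism (fst c) (snd c ` fst c) (snd c) (chart_inv c)"
    using lie_group assms by (auto simp: lie_group_def smooth_atlas_def)
  then show "open (fst c)" "open (snd c ` fst c)" by auto
  show "continuous_on (fst c) (snd c)" "continuous_on (snd c ` fst c) (chart_inv c)"
    "q \<in> fst c \<Longrightarrow> chart_inv c (snd c q) = q"
    using *(3) by (auto simp: homeomorphism_def)
  show "x \<in> snd c ` fst c \<Longrightarrow> chart_inv c x \<in> fst c" "x \<in> snd c ` fst c \<Longrightarrow> snd c (chart_inv c x) = x"
    by (auto simp: inv_into_into f_inv_into_f)
  show "inj_on (snd c) (fst c)" 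
    by (rule inj_on_inverseI[where g="chart_inv c"]) (use *(3) in \<open>auto simp: homeomorphism_def\<close>)
qed

lemma chart_at: "chart_at A p \<in> A" "p \<in> fst (chart_at A p)"
proof -
  have "(\<Union>c\<in>A. fst c) = UNIV" using lie_group by (simp add: lie_group_def smooth_atlas_def)
  then have "\<exists>c. c \<in> A \<and> p \<in> fst c" by blast
  then show "chart_at A p \<in> A" "p \<in> fst (chart_at A p)"
    unfolding chart_at_def by (metis (mono_tags, lifting) someI_ex)+
qed

lemma continuous_mul: "continuous_on UNIV (\<lambda>(p, q). p \<odot> q)" and continuous_iv: "continuous_on UNIV iv"
  using lie_group by (auto simp: lie_group_def smooth_map_def)

lemma continuous_on_mul [continuous_intros]:
  assumes "continuous_on S f" "continuous_on S g"
  shows "continuous_on S (\<lambda>x. f x \<odot> g x)"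
proof -
  have "continuous_on S (\<lambda>x. (\<lambda>(p, q). p \<odot> q) (f x, g x))"
    by (rule continuous_on_compose2[OF continuous_mul]) (auto intro!: continuous_intros assms)
  then show ?thesis by simp
qed

lemma continuous_on_iv [continuous_intros]:
  "continuous_on S f \<Longrightarrow> continuous_on S (\<lambda>x. iv (f x))"
  by (rule continuous_on_compose2[OF continuous_iv]) auto

definition mul_rep :: "('g, 'a) chart \<Rightarrow> ('g, 'a) chart \<Rightarrow> ('g, 'a) chart \<Rightarrow> 'a \<times> 'a \<Rightarrow> 'a" where
  "mul_rep a b c z = snd c (chart_inv a (fst z) \<odot> chart_inv b (snd z))"

definition mul_dom :: "('g, 'a) chart \<Rightarrow> ('g, 'a) chart \<Rightarrow> ('g, 'a) chart \<Rightarrow> ('a \<times> 'a) set" where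
  "mul_dom a b c = {z \<in> (snd a ` fst a) \<times> (snd b ` fst b). chart_inv a (fst z) \<odot> chart_inv b (snd z) \<in> fst c}"

lemma mul_rep_smooth:
  assumes "a \<in> A" "b \<in> A" "c \<in> A"
  shows "open (mul_dom a b c)" "smooth_on (mul_dom a b c) (mul_rep a b c)"
proof -
  have "continuous_on ((snd a ` fst a) \<times> (snd b ` fst b)) (\<lambda>z. chart_inv a (fst z) \<odot> chart_inv b (snd z))"
    by (intro continuous_intros continuous_on_compose2[OF chart(4)[OF assms(1)]]
        continuous_on_compose2[OF chart(4)[OF assms(2)]]) auto
  moreover have "open ((snd a ` fst a) \<times> (snd b ` fst b))"
    by (intro open_Times chart(2) assms)
  ultimately have "open (((snd a ` fst a) \<times> (snd b ` fst b)) \<inter>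
      (\<lambda>z. chart_inv a (fst z) \<odot> chart_inv b (snd z)) -` fst c)"
    using chart(1)[OF assms(3)] by (rule continuous_open_preimage)
  moreover have "\<dots> = mul_dom a b c" by (auto simp: mul_dom_def)
  ultimately show op: "open (mul_dom a b c)" by simp
  let ?ab = "(fst a \<times> fst b, map_prod (snd a) (snd b))"
  have inv: "inv_into (fst a \<times> fst b) (map_prod (snd a) (snd b)) z = (chart_inv a (fst z), chart_inv b (snd z))"
    if "z \<in> (snd a ` fst a) \<times> (snd b ` fst b)" for z
  proof (rule inv_into_f_eq)
    show "inj_on (map_prod (snd a) (snd b)) (fst a \<times> fst b)"
      by (intro map_prod_inj_on chart(8) assms)
    show "(chart_inv a (fst z), chart_inv b (snd z)) \<in> fst a \<times> fst b"
      "map_prod (snd a) (snd b) (chart_inv a (fst z), chart_inv b (snd z)) = z"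
      using that chart(6,7)[OF assms(1)] chart(6,7)[OF assms(2)] by (auto simp: mem_Times_iff)
  qed
  have "?ab \<in> prod_atlas A A" using assms unfolding prod_atlas_def by blast
  moreover have "smooth_map (prod_atlas A A) A (\<lambda>(p, q). p \<odot> q)" using lie_group by (simp add: lie_group_def)
  ultimately have sm: "smooth_on (snd ?ab ` (fst ?ab \<inter> (\<lambda>(p, q). p \<odot> q) -` fst c))
      (snd c \<circ> (\<lambda>(p, q). p \<odot> q) \<circ> chart_inv ?ab)"
    using assms(3) unfolding smooth_map_def by blast
  have dom: "snd ?ab ` (fst ?ab \<inter> (\<lambda>(p, q). p \<odot> q) -` fst c) = mul_dom a b c"
  proof (intro equalityI subsetI)
    fix z assume "z \<in> snd ?ab ` (fst ?ab \<inter> (\<lambda>(p, q). p \<odot> q) -` fst c)"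
    then obtain p q where pq: "p \<in> fst a" "q \<in> fst b" "p \<odot> q \<in> fst c" "z = (snd a p, snd b q)" by auto
    then show "z \<in> mul_dom a b c"
      using chart(5)[OF assms(1) pq(1)] chart(5)[OF assms(2) pq(2)] by (auto simp: mul_dom_def)
  next
    fix z assume z: "z \<in> mul_dom a b c"
    then have "chart_inv a (fst z) \<in> fst a" "chart_inv b (snd z) \<in> fst b"
        "snd a (chart_inv a (fst z)) = fst z" "snd b (chart_inv b (snd z)) = snd z"
      using chart(6,7)[OF assms(1)] chart(6,7)[OF assms(2)] by (auto simp: mul_dom_def)
    with z show "z \<in> snd ?ab ` (fst ?ab \<inter> (\<lambda>(p, q). p \<odot> q) -` fst c)"
      by (intro image_eqI[of _ _ "(chart_inv a (fst z), chart_inv b (snd z))"]) (auto simp: mul_dom_def)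
  qed
  have eq: "(snd c \<circ> (\<lambda>(p, q). p \<odot> q) \<circ> chart_inv ?ab) z = mul_rep a b c z" if "z \<in> mul_dom a b c" for z
    using inv[of z] that by (auto simp: mul_dom_def mul_rep_def)
  show "smooth_on (mul_dom a b c) (mul_rep a b c)"
    unfolding smooth_on_def
  proof (intro allI)
    fix k
    show "Ck_on k (mul_rep a b c) (mul_dom a b c)"
      by (rule Ck_on_cong[OF op, where f="snd c \<circ> (\<lambda>(p, q). p \<odot> q) \<circ> chart_inv ?ab"])
        (use eq sm[unfolded dom smooth_on_def] in blast)+
  qed
qed

definition iv_rep :: "('g, 'a) chart \<Rightarrow> ('g, 'a) chart \<Rightarrow> 'a \<Rightarrow> 'a" where
  "iv_rep a c x = snd c (iv (chart_inv a x))"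

definition iv_dom :: "('g, 'a) chart \<Rightarrow> ('g, 'a) chart \<Rightarrow> 'a set" where
  "iv_dom a c = {x \<in> snd a ` fst a. iv (chart_inv a x) \<in> fst c}"

lemma iv_rep_smooth:
  assumes "a \<in> A" "c \<in> A"
  shows "open (iv_dom a c)" "smooth_on (iv_dom a c) (iv_rep a c)"
proof -
  have "continuous_on (snd a ` fst a) (\<lambda>x. iv (chart_inv a x))"
    by (intro continuous_intros chart(4) assms)
  then have "open ((snd a ` fst a) \<inter> (\<lambda>x. iv (chart_inv a x)) -` fst c)"
    using chart(1)[OF assms(2)] chart(2)[OF assms(1)] continuous_open_preimage by blast
  moreover have "\<dots> = iv_dom a c" by (auto simp: iv_dom_def)
  ultimately show op: "open (iv_dom a c)" by simp
  have sm: "smooth_on (snd a ` (fst a \<inter> iv -` fst c)) (snd c \<circ> iv \<circ> chart_inv a)"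
    using lie_group assms unfolding lie_group_def smooth_map_def by blast
  have dom: "snd a ` (fst a \<inter> iv -` fst c) = iv_dom a c"
  proof (intro equalityI subsetI)
    fix z assume "z \<in> iv_dom a c"
    then show "z \<in> snd a ` (fst a \<inter> iv -` fst c)"
      using chart(6,7)[OF assms(1)]
      by (intro image_eqI[of _ _ "chart_inv a z"]) (auto simp: iv_dom_def)
  qed (use chart(5)[OF assms(1)] in \<open>auto simp: iv_dom_def\<close>)
  show "smooth_on (iv_dom a c) (iv_rep a c)"
    using sm unfolding dom by (simp add: iv_rep_def[abs_def] o_def)
qed

text \<open>All computations take place in the chart \<open>\<phi>\<close> selected at the identity, with inverse \<open>\<iota>\<close>. A
  neighbourhood of any other point \<open>p\<close> is parametrised by \<open>\<lambda>x. p \<odot> \<iota> x\<close>; in these coordinates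
  left-invariant objects have the same expressions everywhere.\<close>

abbreviation "\<phi> \<equiv> snd (chart_at A e)"
abbreviation "\<iota> \<equiv> chart_inv (chart_at A e)"
abbreviation "U0 \<equiv> fst (chart_at A e)"
abbreviation "O0 \<equiv> \<phi> ` U0"
abbreviation "x0 \<equiv> \<phi> e"
abbreviation "m \<equiv> mul_rep (chart_at A e) (chart_at A e) (chart_at A e)"
abbreviation "mdom \<equiv> mul_dom (chart_at A e) (chart_at A e) (chart_at A e)"
abbreviation "i \<equiv> iv_rep (chart_at A e) (chart_at A e)"
abbreviation "idom \<equiv> iv_dom (chart_at A e) (chart_at A e)"

lemma \<iota>_\<phi>: "q \<in> U0 \<Longrightarrow> \<iota> (\<phi> q) = q"
  and \<phi>_\<iota>: "x \<in> O0 \<Longrightarrow> \<phi> (\<iota> x) = x"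
  and \<iota>_in: "x \<in> O0 \<Longrightarrow> \<iota> x \<in> U0"
  and open_O0: "open O0" and open_U0: "open U0" and e_in: "e \<in> U0" and x0_in: "x0 \<in> O0" and \<iota>_x0: "\<iota> x0 = e"
  using chart[OF chart_at(1)[of e]] chart_at(2)[of e] by auto

lemma m_deriv:
  shows "z \<in> mdom \<Longrightarrow> (m has_derivative deriv1 m z) (at z)"
    and "z \<in> mdom \<Longrightarrow> ((\<lambda>z. deriv1 m z v) has_derivative deriv2 m z v) (at z)"
    and "z \<in> mdom \<Longrightarrow> deriv2 m z v w = deriv2 m z w v"
    and "continuous_on mdom (\<lambda>z. deriv1 m z v)" and "continuous_on mdom (\<lambda>z. deriv2 m z v w)"
    and "open mdom"
proof -
  note sm = mul_rep_smooth[OF chart_at(1) chart_at(1) chart_at(1), of e e e]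
  show "z \<in> mdom \<Longrightarrow> (m has_derivative deriv1 m z) (at z)"
    "z \<in> mdom \<Longrightarrow> ((\<lambda>z. deriv1 m z v) has_derivative deriv2 m z v) (at z)"
    using smooth_on_deriv[OF sm(2)] by blast+
  show "z \<in> mdom \<Longrightarrow> deriv2 m z v w = deriv2 m z w v" using smooth_on_deriv2_commute[OF sm(2,1)] .
  show "continuous_on mdom (\<lambda>z. deriv1 m z v)" "continuous_on mdom (\<lambda>z. deriv2 m z v w)" "open mdom"
    using smooth_on_continuous_deriv[OF sm(2)] sm(1) by blast+
qed

lemma i_deriv:
  shows "x \<in> idom \<Longrightarrow> (i has_derivative deriv1 i x) (at x)"
    and "continuous_on idom i" and "continuous_on idom (\<lambda>x. deriv1 i x v)" and "open idom"
proof -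
  note sm = iv_rep_smooth[OF chart_at(1) chart_at(1), of e e]
  show "x \<in> idom \<Longrightarrow> (i has_derivative deriv1 i x) (at x)" using smooth_on_deriv[OF sm(2)] by blast
  show "continuous_on idom i" "continuous_on idom (\<lambda>x. deriv1 i x v)" "open idom"
    using smooth_on_continuous_deriv[OF sm(2)] sm(1) by blast+
qed

lemma mdom_iff: "(x, y) \<in> mdom \<longleftrightarrow> x \<in> O0 \<and> y \<in> O0 \<and> \<iota> x \<odot> \<iota> y \<in> U0"
  by (auto simp: mul_dom_def)

lemma idom_iff: "x \<in> idom \<longleftrightarrow> x \<in> O0 \<and> iv (\<iota> x) \<in> U0"
  by (auto simp: iv_dom_def)

lemma \<iota>_m: "(x, y) \<in> mdom \<Longrightarrow> \<iota> (m (x, y)) = \<iota> x \<odot> \<iota> y"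
  by (simp add: mdom_iff mul_rep_def \<iota>_\<phi>)

lemma \<iota>_i: "x \<in> idom \<Longrightarrow> \<iota> (i x) = iv (\<iota> x)"
  by (simp add: idom_iff iv_rep_def \<iota>_\<phi>)

lemma m_x0 [simp]: "x \<in> O0 \<Longrightarrow> m (x, x0) = x" "x \<in> O0 \<Longrightarrow> m (x0, x) = x"
  by (simp_all add: mul_rep_def \<iota>_x0 \<phi>_\<iota>)

lemma i_x0 [simp]: "i x0 = x0" by (simp add: iv_rep_def \<iota>_x0)

lemma in_doms: "x \<in> O0 \<Longrightarrow> (x, x0) \<in> mdom" "x \<in> O0 \<Longrightarrow> (x0, x) \<in> mdom" "x0 \<in> idom"
    "x \<in> idom \<Longrightarrow> (i x, x) \<in> mdom" "x \<in> idom \<Longrightarrow> (x, i x) \<in> mdom" "x \<in> idom \<Longrightarrow> x \<in> O0" "x \<in> idom \<Longrightarrow> i x \<in> O0"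
  using \<iota>_in e_in x0_in by (auto simp: mdom_iff idom_iff \<iota>_x0 iv_rep_def \<iota>_\<phi>)

lemma has_derivative_Pair_const:
  "((\<lambda>y. (x, y)) has_derivative (\<lambda>v. (0, v))) (at y within S)"
  "((\<lambda>x. (x, y)) has_derivative (\<lambda>v. (v, 0))) (at x within S)"
  by (auto intro!: derivative_eq_intros)

lemma m_snd_deriv:
  assumes "(x, y) \<in> mdom"
  shows "((\<lambda>y. m (x, y)) has_derivative (\<lambda>v. deriv1 m (x, y) (0, v))) (at y)"
  by (rule has_derivative_compose[OF has_derivative_Pair_const(1) m_deriv(1)[OF assms]])

lemma m_fst_deriv:
  assumes "(x, y) \<in> mdom"
  shows "((\<lambda>x. m (x, y)) has_derivative (\<lambda>v. deriv1 m (x, y) (v, 0))) (at x)"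
  by (rule has_derivative_compose[OF has_derivative_Pair_const(2) m_deriv(1)[OF assms]])

lemma m_deriv_linear: "z \<in> mdom \<Longrightarrow> linear (deriv1 m z)" "z \<in> mdom \<Longrightarrow> linear (deriv2 m z v)"
  using m_deriv(1,2) has_derivative_linear by blast+

text \<open>\<open>M x\<close> is the differential at the identity of the left translation by \<open>\<iota> x\<close>, so that \<open>\<lambda>x. M x v\<close>
  is a left-invariant field in the chart, and \<open>K x\<close> is its inverse.\<close>

definition M :: "'a \<Rightarrow> 'a \<Rightarrow> 'a" where "M x v = deriv1 m (x, x0) (0, v)"
definition M' :: "'a \<Rightarrow> 'a \<Rightarrow> 'a \<Rightarrow> 'a" where "M' x h v = deriv2 m (x, x0) (0, v) (h, 0)"
definition K :: "'a \<Rightarrow> 'a \<Rightarrow> 'a" where "K x v = deriv1 m (i x, x) (0, v)"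
definition K' :: "'a \<Rightarrow> 'a \<Rightarrow> 'a \<Rightarrow> 'a" where "K' x h v = deriv2 m (i x, x) (0, v) (deriv1 i x h, h)"

lemma linear_Pair0: "linear (\<lambda>v. (0, v))" "linear (\<lambda>v. (v, 0))"
  by (auto intro!: linearI)

lemma K_linear: "x \<in> idom \<Longrightarrow> linear (K x)"
  unfolding K_def[abs_def] using linear_compose[OF linear_Pair0(1) m_deriv_linear(1)] in_doms by (simp add: o_def)

lemma M_deriv:
  assumes "x \<in> O0"
  shows "((\<lambda>x. M x v) has_derivative (\<lambda>h. M' x h v)) (at x)"
  unfolding M_def M'_def
  by (rule has_derivative_compose[OF has_derivative_Pair_const(2) m_deriv(2)[OF in_doms(1)[OF assms]]])

lemma K_deriv:
  assumes "x \<in> idom"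
  shows "((\<lambda>x. K x v) has_derivative (\<lambda>h. K' x h v)) (at x)"
  unfolding K_def K'_def
  by (rule has_derivative_compose[OF has_derivative_Pair[OF i_deriv(1)[OF assms] has_derivative_ident]
        m_deriv(2)[OF in_doms(4)[OF assms]]])

lemma K'_continuous: "continuous_on idom (\<lambda>x. K' x h v)"
  unfolding K'_def
proof (rule continuous_on_apply_linear[where A="\<lambda>x. deriv2 m (i x, x) (0, v)"])
  have "continuous_on idom (\<lambda>x. (i x, x))" by (intro continuous_intros i_deriv)
  then show "continuous_on idom (\<lambda>x. deriv2 m (i x, x) (0, v) w)" for w
    by (rule continuous_on_compose2[OF m_deriv(5)]) (use in_doms in auto)
  show "continuous_on idom (\<lambda>x. (deriv1 i x h, h))" by (intro continuous_intros i_deriv)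
qed (use m_deriv_linear in_doms in auto)

lemma K_continuous: "continuous_on idom (\<lambda>x. K x v)"
  using K_deriv by (intro continuous_at_imp_continuous_on) (blast intro: has_derivative_continuous)

text \<open>The product of \<open>x\<inverse>\<close> and \<open>y\<close> in the chart: the coordinates of \<open>\<iota> y\<close> seen from \<open>\<iota> x\<close>.\<close>

definition n :: "'a \<Rightarrow> 'a \<Rightarrow> 'a" where "n x y = m (i x, y)"

lemma \<iota>_n: "x \<in> idom \<Longrightarrow> (i x, y) \<in> mdom \<Longrightarrow> \<iota> (n x y) = iv (\<iota> x) \<odot> \<iota> y"
  by (simp add: n_def \<iota>_m \<iota>_i)

lemma n_refl [simp]: "x \<in> idom \<Longrightarrow> n x x = x0"
  by (simp add: n_def mul_rep_def \<iota>_i)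

lemma n_deriv:
  assumes "x \<in> idom"
  shows "(n x has_derivative K x) (at x)"
  using m_snd_deriv[OF in_doms(4)[OF assms]] by (simp add: n_def[abs_def] K_def[abs_def])

lemma eventually_dom:
  assumes "(x, y) \<in> mdom"
  shows "\<forall>\<^sub>F y in nhds y. (x, y) \<in> mdom" "\<forall>\<^sub>F x in nhds x. (x, y) \<in> mdom"
proof -
  have *: "\<forall>\<^sub>F z in nhds (x, y). z \<in> mdom" using m_deriv(6) assms by (rule eventually_nhds_in_open)
  have "((\<lambda>y. (x, y)) \<longlongrightarrow> (x, y)) (nhds y)" "((\<lambda>x. (x, y)) \<longlongrightarrow> (x, y)) (nhds x)"
    by (intro tendsto_intros filterlim_ident)+
  then show "\<forall>\<^sub>F y in nhds y. (x, y) \<in> mdom" "\<forall>\<^sub>F x in nhds x. (x, y) \<in> mdom"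
    using eventually_compose_filterlim[OF *] by blast+
qed

lemma has_derivative_cong_nhds:
  assumes "(f has_derivative D) (at x)" "\<forall>\<^sub>F y in nhds x. f y = g y"
  shows "(g has_derivative D) (at x)"
proof -
  have "f x = g x" using assms(2) by (rule eventually_nhds_x_imp_x)
  then show ?thesis
    using has_derivative_transform_eventually[OF assms(1), of g] assms(2)
    by (simp add: eventually_nhds_conv_at)
qed

lemma has_derivative_unique_nhds:
  assumes "(f has_derivative D) (at x)" "(g has_derivative D') (at x)" "\<forall>\<^sub>F y in nhds x. f y = g y"
  shows "D = D'"
  using has_derivative_unique[OF has_derivative_cong_nhds[OF assms(1,3)] assms(2)] .

lemma M_x0: "M x0 v = v"
proof -
  have "\<forall>\<^sub>F y in nhds x0. m (x0, y) = y"
    using eventually_nhds_in_open[OF open_O0 x0_in] by eventually_elim simp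
  from fun_cong[OF has_derivative_unique_nhds[OF m_snd_deriv[OF in_doms(1)[OF x0_in]] has_derivative_ident this], of v]
  show ?thesis unfolding M_def .
qed

lemma K_x0: "K x0 v = v"
  unfolding K_def i_x0 by (rule M_x0[unfolded M_def])

text \<open>Differentiate \<open>n x (m (x, y)) = y\<close> in \<open>y\<close> at the identity.\<close>

lemma K_M: assumes x: "x \<in> idom" shows "K x (M x v) = v"
proof -
  have dom: "(x, x0) \<in> mdom" by (rule in_doms(1)[OF in_doms(6)[OF x]])
  have "n x (m (x, y)) = y" if "(x, y) \<in> mdom" for y
    using that x by (simp add: n_def mul_rep_def[of _ _ _ "(i x, _)"] \<iota>_m \<iota>_i \<phi>_\<iota> mdom_iff)
  then have ev: "\<forall>\<^sub>F y in nhds x0. n x (m (x, y)) = y"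
    using eventually_dom(1)[OF dom] by (auto elim: eventually_mono)
  have "(n x has_derivative K x) (at (m (x, x0)))" using n_deriv[OF x] m_x0(1)[OF in_doms(6)[OF x]] by simp
  from has_derivative_unique_nhds[OF has_derivative_compose[OF m_snd_deriv[OF dom] this] has_derivative_ident ev]
  show ?thesis by (metis M_def)
qed

text \<open>In coordinates the bracket of two left-invariant fields is the skew part of the mixed second
  derivative of the multiplication at the identity.\<close>

definition B :: "'a \<Rightarrow> 'a \<Rightarrow> 'a" where "B v w = M' x0 v w - M' x0 w v"

lemma B_skew: "B w v = - B v w" by (simp add: B_def)

lemma M'_linear:
  assumes x: "x \<in> O0"
  shows "linear (\<lambda>h. M' x h v)" "linear (\<lambda>v. M' x h v)"
proof -
  show "linear (\<lambda>h. M' x h v)" using M_deriv[OF x] by (rule has_derivative_linear)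
  have "M' x h v = deriv2 m (x, x0) (h, 0) (0, v)" for v
    unfolding M'_def using m_deriv(3)[OF in_doms(1)[OF x]] .
  then show "linear (\<lambda>v. M' x h v)"
    using linear_compose[OF linear_Pair0(1) m_deriv_linear(2)[OF in_doms(1)[OF x]], of "(h, 0)"]
    by (simp add: o_def)
qed

lemma bilinear_B: "bilinear B"
  unfolding bilinear_def B_def[abs_def]
  using M'_linear[OF x0_in] by (auto intro!: linear_compose_sub)

text \<open>The Maurer--Cartan equation. Differentiate \<open>n x y = n (n g x) (n g y)\<close>, first in \<open>y\<close> at \<open>y = x\<close>,
  then in \<open>x\<close> at \<open>x = g\<close>; the pure second derivative in the second argument is symmetric.\<close>

lemma Maurer_Cartan:
  assumes g: "g \<in> idom"
  shows "K' g h w - K' g w h = - B (K g h) (K g w)"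
proof -
  have K'_x0: "K' x0 a b = - M' x0 a b" for a b
  proof -
    have "((\<lambda>x. K x (M x b)) has_derivative (\<lambda>h. K' x0 h (M x0 b) + K x0 (M' x0 h b))) (at x0)"
      by (rule has_derivative_apply_linear[where S=idom, OF K_deriv[OF in_doms(3)] K_linear i_deriv(4) in_doms(3) M_deriv[OF x0_in]])
    moreover have "\<forall>\<^sub>F x in nhds x0. K x (M x b) = b"
      using eventually_nhds_in_open[OF i_deriv(4) in_doms(3)] by eventually_elim (rule K_M)
    ultimately have "(\<lambda>h. K' x0 h (M x0 b) + K x0 (M' x0 h b)) = (\<lambda>h. 0)"
      using has_derivative_unique_nhds[OF _ has_derivative_const] by blast
    from fun_cong[OF this, of a] have "K' x0 a b + M' x0 a b = 0" unfolding M_x0 K_x0 .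
    then show ?thesis by (rule eq_neg_iff_add_eq_0[THEN iffD2])
  qed
  have dom: "(i g, g) \<in> mdom" by (rule in_doms(4)[OF g])
  have ng: "(n g has_derivative K g) (at g)" by (rule n_deriv[OF g])
  have ev_n: "\<forall>\<^sub>F x in nhds g. n g x \<in> idom"
  proof -
    have "isCont (n g) g" using ng by (rule has_derivative_continuous)
    then have "(n g \<longlongrightarrow> n g g) (nhds g)" by (simp add: isCont_def tendsto_at_iff_tendsto_nhds)
    then have "(n g \<longlongrightarrow> x0) (nhds g)" using g by simp
    then show ?thesis using topological_tendstoD[OF _ i_deriv(4) in_doms(3)] by blast
  qed
  have ev: "\<forall>\<^sub>F x in nhds g. K x w = K (n g x) (deriv1 m (i g, x) (0, w))" for w
    using eventually_dom(1)[OF dom] ev_n eventually_nhds_in_open[OF i_deriv(4) g]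
  proof eventually_elim
    case (elim x)
    have nd: "(n g has_derivative (\<lambda>v. deriv1 m (i g, x) (0, v))) (at x)"
      unfolding n_def[abs_def] using m_snd_deriv[OF elim(1)] .
    have "((\<lambda>y. n (n g x) (n g y)) has_derivative (\<lambda>v. K (n g x) (deriv1 m (i g, x) (0, v)))) (at x)"
      by (rule has_derivative_compose[OF nd n_deriv[OF elim(2)]])
    moreover have "\<forall>\<^sub>F y in nhds x. n (n g x) (n g y) = n x y"
      using eventually_dom(1)[OF elim(1)] eventually_dom(1)[OF in_doms(4)[OF elim(3)]]
    proof eventually_elim
      case (elim y)
      then show ?case using \<open>n g x \<in> idom\<close> \<open>(i g, x) \<in> mdom\<close> \<open>x \<in> idom\<close> g
        by (simp add: n_def[of "n g x"] n_def[of x] mul_rep_def[of _ _ _ "(i _, n _ _)"] mul_rep_def[of _ _ _ "(i x, _)"]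
            \<iota>_n \<iota>_i iv_mul grp.assoc)
    qed
    ultimately have "(\<lambda>v. K (n g x) (deriv1 m (i g, x) (0, v))) = K x"
      using has_derivative_unique_nhds n_deriv[OF elim(3)] by blast
    then show ?case by metis
  qed
  have K'_g: "K' g h w = K' x0 (K g h) (K g w) + deriv2 m (i g, g) (0, w) (0, h)" for h w
  proof -
    have S: "open (n g -` idom \<inter> {x. (i g, x) \<in> mdom} )" "g \<in> n g -` idom \<inter> {x. (i g, x) \<in> mdom}"
    proof -
      have "open (Pair (i g) -` mdom)" by (rule open_vimage[OF m_deriv(6)]) (intro continuous_intros)
      then have o: "open {x. (i g, x) \<in> mdom}" by (simp add: vimage_def)
      have "continuous_on {x. (i g, x) \<in> mdom} (n g)"
        unfolding n_def[abs_def]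
        by (rule continuous_at_imp_continuous_on) (blast intro: has_derivative_continuous[OF m_snd_deriv])
      from continuous_open_preimage[OF this o i_deriv(4)]
      show "open (n g -` idom \<inter> {x. (i g, x) \<in> mdom})" by (simp add: Int_commute)
      show "g \<in> n g -` idom \<inter> {x. (i g, x) \<in> mdom}" using g dom in_doms by simp
    qed
    have "((\<lambda>x. K (n g x) v) has_derivative (\<lambda>h. K' x0 (K g h) v)) (at g)" for v
    proof -
      have "((\<lambda>x. K x v) has_derivative (\<lambda>h. K' x0 h v)) (at (n g g))" using K_deriv[OF in_doms(3)] g by simp
      from has_derivative_compose[OF ng this] show ?thesis .
    qed
    moreover have "((\<lambda>x. deriv1 m (i g, x) (0, w)) has_derivative (\<lambda>h. deriv2 m (i g, g) (0, w) (0, h))) (at g)"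
      by (rule has_derivative_compose[OF has_derivative_Pair_const(1) m_deriv(2)[OF dom]])
    ultimately have "((\<lambda>x. K (n g x) (deriv1 m (i g, x) (0, w))) has_derivative
        (\<lambda>h. K' x0 (K g h) (deriv1 m (i g, g) (0, w)) + K (n g g) (deriv2 m (i g, g) (0, w) (0, h)))) (at g)"
      using has_derivative_apply_linear[where A="\<lambda>x. K (n g x)" and A'="\<lambda>v h. K' x0 (K g h) v", OF _ _ S] K_linear
      by blast
    moreover have "\<forall>\<^sub>F x in nhds g. K (n g x) (deriv1 m (i g, x) (0, w)) = K x w"
      using ev[of w] by eventually_elim simp
    ultimately have "(\<lambda>h. K' x0 (K g h) (deriv1 m (i g, g) (0, w)) + K (n g g) (deriv2 m (i g, g) (0, w) (0, h)))
        = (\<lambda>h. K' g h w)"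
      using has_derivative_unique_nhds K_deriv[OF g] by blast
    from fun_cong[OF this, of h] show ?thesis unfolding n_refl[OF g] K_x0 K_def[symmetric] by (rule sym)
  qed
  show ?thesis
    using m_deriv(3)[OF dom, of "(0, w)" "(0, h)"] by (simp add: K'_g K'_x0 B_def)
qed

end

lemma has_vector_derivative_compose_deriv:
  assumes f: "(f has_vector_derivative u) (at t within S)" and F: "(F has_derivative D) (at (f t))"
  shows "((\<lambda>\<tau>. F (f \<tau>)) has_vector_derivative D u) (at t within S)"
proof -
  have "((\<lambda>\<tau>. F (f \<tau>)) has_derivative (\<lambda>h. D (h *\<^sub>R u))) (at t within S)"
    using has_derivative_compose[OF f[unfolded has_vector_derivative_def] F] .
  then show ?thesis unfolding has_vector_derivative_def
    by (simp add: linear_scale[OF has_derivative_linear[OF F]])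
qed

lemma has_vector_derivative_cong_nhds:
  assumes "(f has_vector_derivative u) (at t within S)" "t \<in> S"
    and "\<forall>\<^sub>F \<tau> in at t within S. f \<tau> = g \<tau>" "f t = g t"
  shows "(g has_vector_derivative u) (at t within S)"
  using assms has_derivative_transform_eventually unfolding has_vector_derivative_def by blast

context lie_group_in_charts
begin

section \<open>Translations, the adjoint representation and left derivatives\<close>

lemma eventually_in_chart:
  assumes "b \<in> A" "q \<in> fst b" "continuous_on UNIV f" "open W" "f q \<in> W"
  shows "\<forall>\<^sub>F x in nhds (snd b q). x \<in> snd b ` fst b \<and> f (chart_inv b x) \<in> W"
proof -
  have "continuous_on (snd b ` fst b) (\<lambda>x. f (chart_inv b x))"
    by (rule continuous_on_compose2[OF assms(3) chart(4)[OF assms(1)]]) auto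
  from continuous_open_preimage[OF this chart(2)[OF assms(1)] assms(4)]
  have "open (snd b ` fst b \<inter> (\<lambda>x. f (chart_inv b x)) -` W)" .
  moreover have "snd b q \<in> snd b ` fst b \<inter> (\<lambda>x. f (chart_inv b x)) -` W"
    using assms chart(5)[OF assms(1,2)] by auto
  ultimately have "\<forall>\<^sub>F x in nhds (snd b q). x \<in> snd b ` fst b \<inter> (\<lambda>x. f (chart_inv b x)) -` W"
    by (rule eventually_nhds_in_open)
  then show ?thesis by eventually_elim auto
qed

lemma eventually_near_x0:
  assumes "continuous_on UNIV f" "open W" "f e \<in> W"
  shows "\<forall>\<^sub>F x in nhds x0. x \<in> O0 \<and> f (\<iota> x) \<in> W"
  using eventually_in_chart[OF chart_at(1) chart_at(2) assms] .

lemma left_translation_differentiable: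
  assumes "b \<in> A" "c \<in> A" "q \<in> fst b" "p \<odot> q \<in> fst c"
  shows "(\<lambda>y. snd c (p \<odot> chart_inv b y)) differentiable (at (snd b q))"
proof -
  let ?a = "chart_at A p"
  note a = chart_at(1)[of p] chart_at(2)[of p]
  have dom: "(snd ?a p, snd b q) \<in> mul_dom ?a b c"
    using a assms chart(5)[OF a] chart(5)[OF assms(1,3)] by (simp add: mul_dom_def)
  have "(mul_rep ?a b c has_derivative deriv1 (mul_rep ?a b c) (snd ?a p, snd b q)) (at (snd ?a p, snd b q))"
    by (rule smooth_on_deriv(1)[OF mul_rep_smooth(2)[OF a(1) assms(1,2)] dom])
  from has_derivative_compose[OF has_derivative_Pair_const(1) this]
  have "(\<lambda>y. mul_rep ?a b c (snd ?a p, y)) differentiable (at (snd b q))"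
    unfolding differentiable_def by blast
  then show ?thesis unfolding mul_rep_def fst_conv snd_conv chart(5)[OF a] .
qed

lemma right_translation_differentiable:
  assumes "b \<in> A" "c \<in> A" "q \<in> fst b" "q \<odot> p \<in> fst c"
  shows "(\<lambda>y. snd c (chart_inv b y \<odot> p)) differentiable (at (snd b q))"
proof -
  let ?a = "chart_at A p"
  note a = chart_at(1)[of p] chart_at(2)[of p]
  have dom: "(snd b q, snd ?a p) \<in> mul_dom b ?a c"
    using a assms chart(5)[OF a] chart(5)[OF assms(1,3)] by (simp add: mul_dom_def)
  have "(mul_rep b ?a c has_derivative deriv1 (mul_rep b ?a c) (snd b q, snd ?a p)) (at (snd b q, snd ?a p))"
    by (rule smooth_on_deriv(1)[OF mul_rep_smooth(2)[OF assms(1) a(1) assms(2)] dom])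
  from has_derivative_compose[OF has_derivative_Pair_const(2) this]
  have "(\<lambda>y. mul_rep b ?a c (y, snd ?a p)) differentiable (at (snd b q))"
    unfolding differentiable_def by blast
  then show ?thesis unfolding mul_rep_def fst_conv snd_conv chart(5)[OF a] .
qed

text \<open>\<open>Ad\<close> is the differential at the identity of the conjugation by \<open>p\<close>.\<close>

definition conj_rep :: "'g \<Rightarrow> 'a \<Rightarrow> 'a" where "conj_rep p x = \<phi> (p \<odot> \<iota> x \<odot> iv p)"
definition Ad :: "'g \<Rightarrow> 'a \<Rightarrow> 'a" where "Ad p = deriv1 (conj_rep p) x0"

lemma conj_rep_x0 [simp]: "conj_rep p x0 = x0"
  unfolding conj_rep_def \<iota>_x0 by simp

lemma \<iota>_conj_rep: "\<forall>\<^sub>F x in nhds x0. x \<in> O0 \<and> \<iota> (conj_rep p x) = p \<odot> \<iota> x \<odot> iv p \<and> p \<odot> \<iota> x \<odot> iv p \<in> U0"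
proof -
  have "\<forall>\<^sub>F x in nhds x0. x \<in> O0 \<and> p \<odot> \<iota> x \<odot> iv p \<in> U0"
    by (rule eventually_near_x0[where f="\<lambda>q. p \<odot> q \<odot> iv p"])
      (use e_in open_U0 in \<open>auto intro!: continuous_intros\<close>)
  then show ?thesis by eventually_elim (simp add: conj_rep_def \<iota>_\<phi>)
qed

lemma Ad_deriv: "(conj_rep p has_derivative Ad p) (at x0)"
proof -
  let ?c = "chart_at A (iv p)"
  note c = chart_at(1)[of "iv p"] chart_at(2)[of "iv p"]
  have 1: "(\<lambda>x. snd ?c (\<iota> x \<odot> iv p)) differentiable (at x0)"
    by (rule right_translation_differentiable[OF chart_at(1) c(1) chart_at(2)]) (use c in simp)
  have 2: "(\<lambda>y. \<phi> (p \<odot> chart_inv ?c y)) differentiable (at (snd ?c (\<iota> x0 \<odot> iv p)))"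
    unfolding \<iota>_x0 mul_cancel(5)
    by (rule left_translation_differentiable[OF c(1) chart_at(1) c(2)]) (use e_in in simp)
  obtain D1 D2 where D: "((\<lambda>x. snd ?c (\<iota> x \<odot> iv p)) has_derivative D1) (at x0)"
      "((\<lambda>y. \<phi> (p \<odot> chart_inv ?c y)) has_derivative D2) (at (snd ?c (\<iota> x0 \<odot> iv p)))"
    using 1 2 unfolding differentiable_def by blast
  have "\<forall>\<^sub>F x in nhds x0. x \<in> O0 \<and> \<iota> x \<odot> iv p \<in> fst ?c"
    by (rule eventually_near_x0[where f="\<lambda>q. q \<odot> iv p"])
      (use c chart(1)[OF c(1)] in \<open>auto intro!: continuous_intros\<close>)
  then have "\<forall>\<^sub>F x in nhds x0. \<phi> (p \<odot> chart_inv ?c (snd ?c (\<iota> x \<odot> iv p))) = conj_rep p x"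
    by eventually_elim (simp add: chart(5)[OF c(1)] conj_rep_def grp.assoc)
  from has_derivative_cong_nhds[OF has_derivative_compose[OF D] this]
  have "conj_rep p differentiable (at x0)" unfolding differentiable_def by blast
  then show ?thesis unfolding Ad_def by (simp add: frechet_derivative_works)
qed

lemma Ad_linear: "linear (Ad p)"
  using Ad_deriv by (rule has_derivative_linear)

lemma Ad_e: "Ad e v = v"
proof -
  have "\<forall>\<^sub>F x in nhds x0. conj_rep e x = x"
    using eventually_nhds_in_open[OF open_O0 x0_in] by eventually_elim (simp add: conj_rep_def \<phi>_\<iota>)
  from fun_cong[OF has_derivative_unique_nhds[OF Ad_deriv has_derivative_ident this], of v]
  show ?thesis .
qed

lemma Ad_mul: "Ad (p \<odot> q) v = Ad p (Ad q v)"
proof -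
  have "(conj_rep p has_derivative Ad p) (at (conj_rep q x0))" using Ad_deriv by simp
  note D = has_derivative_compose[OF Ad_deriv this]
  have ev: "\<forall>\<^sub>F x in nhds x0. conj_rep p (conj_rep q x) = conj_rep (p \<odot> q) x"
    using \<iota>_conj_rep[of q] by eventually_elim (simp add: conj_rep_def[of p] conj_rep_def[of "p \<odot> q"] iv_mul grp.assoc)
  from fun_cong[OF has_derivative_unique_nhds[OF D Ad_deriv ev], of v] show ?thesis by simp
qed

text \<open>The conjugation by \<open>\<iota> x\<close> is the left translation by \<open>\<iota> x\<close> followed by the right translation by
  its inverse.\<close>

lemma Ad_\<iota>:
  assumes x: "x \<in> idom"
  shows "Ad (\<iota> x) v = deriv1 m (x, i x) (M x v, 0)"
proof -
  have dom: "(x, x0) \<in> mdom" "(m (x, x0), i x) \<in> mdom"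
    using in_doms(1)[OF in_doms(6)[OF x]] m_x0(1)[OF in_doms(6)[OF x]] in_doms(5)[OF x] by simp_all
  note D = has_derivative_compose[OF m_snd_deriv[OF dom(1)] m_fst_deriv[OF dom(2)]]
  have ev: "\<forall>\<^sub>F y in nhds x0. m (m (x, y), i x) = conj_rep (\<iota> x) y"
    using eventually_dom(1)[OF dom(1)]
    by eventually_elim (simp add: mul_rep_def[of _ _ _ "(m _, i x)"] \<iota>_m \<iota>_i x conj_rep_def)
  from fun_cong[OF has_derivative_unique_nhds[OF D Ad_deriv ev], of v]
  show ?thesis using m_x0(1)[of x] in_doms(6)[OF x] by (simp add: M_def)
qed

lemma m_deriv_x0: "deriv1 m (x0, x0) (v, w) = v + w"
proof -
  have dom: "(x0, x0) \<in> mdom" by (rule in_doms(1)[OF x0_in])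
  have ev: "\<forall>\<^sub>F y in nhds x0. m (y, x0) = y"
    using eventually_nhds_in_open[OF open_O0 x0_in] by eventually_elim simp
  have "deriv1 m (x0, x0) (v, 0) = v"
    using fun_cong[OF has_derivative_unique_nhds[OF m_fst_deriv[OF dom] has_derivative_ident ev], of v] .
  moreover have "deriv1 m (x0, x0) (0, w) = w" using M_x0 by (simp add: M_def)
  moreover have "deriv1 m (x0, x0) (v, w) = deriv1 m (x0, x0) (v, 0) + deriv1 m (x0, x0) (0, w)"
    using linear_add[OF m_deriv_linear(1)[OF dom], of "(v, 0)" "(0, w)"] by simp
  ultimately show ?thesis by simp
qed

lemma i_deriv_x0: "deriv1 i x0 h = - h"
proof -
  have D1: "((\<lambda>x. (x, i x)) has_derivative (\<lambda>h. (h, deriv1 i x0 h))) (at x0)"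
    by (rule has_derivative_Pair[OF has_derivative_ident i_deriv(1)[OF in_doms(3)]])
  have "(m has_derivative deriv1 m (x0, x0)) (at (x0, i x0))"
    using m_deriv(1)[OF in_doms(1)[OF x0_in]] by simp
  note D = has_derivative_compose[OF D1 this]
  have ev: "\<forall>\<^sub>F x in nhds x0. m (x, i x) = x0"
    using eventually_nhds_in_open[OF i_deriv(4) in_doms(3)]
    by eventually_elim (simp add: mul_rep_def \<iota>_i)
  from fun_cong[OF has_derivative_unique_nhds[OF D has_derivative_const ev], of h]
  have "h + deriv1 i x0 h = 0" unfolding m_deriv_x0 .
  then show ?thesis by (simp add: eq_neg_iff_add_eq_0 add.commute)
qed

text \<open>Differentiate the formula of \<open>Ad_\<iota>\<close>. The left translation contributes one of the two mixed second
  derivatives of \<open>m\<close>, the right translation by the inverse contributes the other one with the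
  opposite sign, and the pure second derivative vanishes because \<open>m (x, x0) = x\<close>.\<close>

lemma Ad_\<iota>_deriv: "((\<lambda>x. Ad (\<iota> x) v) has_derivative (\<lambda>h. B h v)) (at x0)"
proof -
  have dom: "(x0, x0) \<in> mdom" by (rule in_doms(1)[OF x0_in])
  have pair: "((\<lambda>x. (x, i x)) has_derivative (\<lambda>h. (h, - h))) (at x0)"
    using has_derivative_Pair[OF has_derivative_ident i_deriv(1)[OF in_doms(3)]] unfolding i_deriv_x0 .
  have A: "((\<lambda>x. deriv1 m (x, i x) (w, 0)) has_derivative (\<lambda>h. deriv2 m (x0, x0) (w, 0) (h, - h))) (at x0)" for w
  proof -
    have "((\<lambda>z. deriv1 m z (w, 0)) has_derivative deriv2 m (x0, x0) (w, 0)) (at (x0, i x0))"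
      using m_deriv(2)[OF dom] by simp
    from has_derivative_compose[OF pair this] show ?thesis .
  qed
  have lin: "linear (\<lambda>w. deriv1 m (x, i x) (w, 0))" if "x \<in> idom" for x
    using linear_compose[OF linear_Pair0(2) m_deriv_linear(1)[OF in_doms(5)[OF that]]] by (simp add: o_def)
  have D: "((\<lambda>x. deriv1 m (x, i x) (M x v, 0)) has_derivative
      (\<lambda>h. deriv2 m (x0, x0) (M x0 v, 0) (h, - h) + deriv1 m (x0, i x0) (M' x0 h v, 0))) (at x0)"
    by (rule has_derivative_apply_linear[where A="\<lambda>x w. deriv1 m (x, i x) (w, 0)", OF A lin i_deriv(4) in_doms(3) M_deriv[OF x0_in]])
  have zero: "deriv2 m (x0, x0) (v, 0) (h, 0) = 0" for h
  proof -
    have "((\<lambda>x. deriv1 m (x, x0) (v, 0)) has_derivative (\<lambda>h. deriv2 m (x0, x0) (v, 0) (h, 0))) (at x0)"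
      by (rule has_derivative_compose[OF has_derivative_Pair_const(2) m_deriv(2)[OF dom]])
    moreover have "\<forall>\<^sub>F x in nhds x0. deriv1 m (x, x0) (v, 0) = v"
      using eventually_nhds_in_open[OF open_O0 x0_in]
    proof eventually_elim
      case (elim x)
      have "\<forall>\<^sub>F y in nhds x. m (y, x0) = y"
        using eventually_nhds_in_open[OF open_O0 elim] by eventually_elim simp
      from fun_cong[OF has_derivative_unique_nhds[OF m_fst_deriv[OF in_doms(1)[OF elim]] has_derivative_ident this], of v]
      show ?case .
    qed
    ultimately have "(\<lambda>h. deriv2 m (x0, x0) (v, 0) (h, 0)) = (\<lambda>h. 0)"
      by (rule has_derivative_unique_nhds[OF _ has_derivative_const])
    from fun_cong[OF this, of h] show ?thesis .
  qed
  have "deriv2 m (x0, x0) (v, 0) (h, - h) = deriv2 m (x0, x0) (v, 0) (h, 0) - deriv2 m (x0, x0) (v, 0) (0, h)" for h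
    using linear_diff[OF m_deriv_linear(2)[OF dom], of "(v, 0)" "(h, 0)" "(0, h)"] by simp
  moreover have "deriv2 m (x0, x0) (v, 0) (0, h) = M' x0 v h" for h
    unfolding M'_def using m_deriv(3)[OF dom] .
  ultimately have "deriv2 m (x0, x0) (M x0 v, 0) (h, - h) + deriv1 m (x0, i x0) (M' x0 h v, 0) = B h v" for h
    unfolding M_x0 i_x0 m_deriv_x0 by (simp add: zero B_def)
  with D have "((\<lambda>x. deriv1 m (x, i x) (M x v, 0)) has_derivative (\<lambda>h. B h v)) (at x0)" by simp
  moreover have "\<forall>\<^sub>F x in nhds x0. deriv1 m (x, i x) (M x v, 0) = Ad (\<iota> x) v"
    using eventually_nhds_in_open[OF i_deriv(4) in_doms(3)] by eventually_elim (simp add: Ad_\<iota>)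
  ultimately show ?thesis by (rule has_derivative_cong_nhds)
qed

text \<open>The left derivative of \<open>\<psi>\<close> at \<open>p\<close> in the direction \<open>v\<close> is its derivative along the left-invariant
  field that extends \<open>v\<close>.\<close>

definition left_deriv :: "('g \<Rightarrow> 'b::real_normed_vector) \<Rightarrow> 'g \<Rightarrow> ('a \<Rightarrow> 'b) \<Rightarrow> bool" where
  "left_deriv \<psi> p D \<longleftrightarrow> ((\<lambda>x. \<psi> (p \<odot> \<iota> x)) has_derivative D) (at x0)"

lemma left_deriv_chart:
  assumes x: "x \<in> idom" and D: "left_deriv \<psi> (p \<odot> \<iota> x) D"
  shows "((\<lambda>y. \<psi> (p \<odot> \<iota> y)) has_derivative (\<lambda>h. D (K x h))) (at x)"
proof -
  have "((\<lambda>y. \<psi> (p \<odot> \<iota> x \<odot> \<iota> y)) has_derivative D) (at (n x x))"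
    using D unfolding left_deriv_def n_refl[OF x] .
  from has_derivative_compose[OF n_deriv[OF x] this]
  have "((\<lambda>y. \<psi> (p \<odot> \<iota> x \<odot> \<iota> (n x y))) has_derivative (\<lambda>h. D (K x h))) (at x)" .
  moreover have "\<forall>\<^sub>F y in nhds x. \<psi> (p \<odot> \<iota> x \<odot> \<iota> (n x y)) = \<psi> (p \<odot> \<iota> y)"
    using eventually_dom(1)[OF in_doms(4)[OF x]] by eventually_elim (simp add: \<iota>_n[OF x] grp.assoc)
  ultimately show ?thesis by (rule has_derivative_cong_nhds)
qed

lemma Ad_left_deriv: "left_deriv (\<lambda>p. Ad p v) p (\<lambda>h. Ad p (B h v))"
  unfolding left_deriv_def Ad_mul
  by (rule bounded_linear.has_derivative[OF linear_conv_bounded_linear[THEN iffD1, OF Ad_linear] Ad_\<iota>_deriv])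

lemma eventually_translate:
  assumes "\<forall>\<^sub>F x in nhds x0. P x"
  shows "\<forall>\<^sub>F q in nhds p. iv p \<odot> q \<in> U0 \<and> \<phi> (iv p \<odot> q) \<in> O0 \<and> q = p \<odot> \<iota> (\<phi> (iv p \<odot> q)) \<and> P (\<phi> (iv p \<odot> q))"
proof -
  have c: "continuous_on UNIV (\<lambda>q. iv p \<odot> q)" by (intro continuous_intros)
  have "open ((\<lambda>q. iv p \<odot> q) -` U0)" by (rule open_vimage[OF open_U0 c])
  then have ev: "\<forall>\<^sub>F q in nhds p. iv p \<odot> q \<in> U0"
    using eventually_nhds_in_open[of "(\<lambda>q. iv p \<odot> q) -` U0" p] e_in by simp
  have "isCont (\<lambda>q. iv p \<odot> q) p" using c by (simp add: continuous_on_eq_continuous_at)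
  moreover have "isCont \<phi> (iv p \<odot> p)"
    using chart(3)[OF chart_at(1)[of e]] e_in unfolding continuous_on_eq_continuous_at[OF open_U0] by simp
  ultimately have "isCont (\<lambda>q. \<phi> (iv p \<odot> q)) p" by (rule isCont_o2)
  then have "((\<lambda>q. \<phi> (iv p \<odot> q)) \<longlongrightarrow> \<phi> (iv p \<odot> p)) (nhds p)"
    unfolding isCont_def by (rule tendsto_at_iff_tendsto_nhds[THEN iffD1])
  then have "((\<lambda>q. \<phi> (iv p \<odot> q)) \<longlongrightarrow> x0) (nhds p)" by simp
  from eventually_compose_filterlim[OF assms this] ev
  show ?thesis by eventually_elim (simp add: \<iota>_\<phi>)
qed

lemma left_deriv_continuous:
  assumes "left_deriv \<psi> p D"
  shows "(\<psi> \<longlongrightarrow> \<psi> p) (nhds p)"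
proof -
  have "isCont (\<lambda>x. \<psi> (p \<odot> \<iota> x)) x0" using assms unfolding left_deriv_def by (rule has_derivative_continuous)
  then have "((\<lambda>x. \<psi> (p \<odot> \<iota> x)) \<longlongrightarrow> \<psi> (p \<odot> \<iota> x0)) (nhds x0)"
    unfolding isCont_def by (rule tendsto_at_iff_tendsto_nhds[THEN iffD1])
  then have lim: "((\<lambda>x. \<psi> (p \<odot> \<iota> x)) \<longlongrightarrow> \<psi> p) (nhds x0)" by (simp add: \<iota>_x0)
  show ?thesis
  proof (rule topological_tendstoI)
    fix S assume S: "open S" "\<psi> p \<in> S"
    have "\<forall>\<^sub>F x in nhds x0. \<psi> (p \<odot> \<iota> x) \<in> S" using topological_tendstoD[OF lim S] .
    from eventually_translate[OF this, of p] show "\<forall>\<^sub>F q in nhds p. \<psi> q \<in> S"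
      by eventually_elim metis
  qed
qed

lemma left_deriv_zero_locally_constant:
  assumes U: "open U" "p \<in> U" and D: "\<And>q. q \<in> U \<Longrightarrow> left_deriv \<psi> q (\<lambda>_. 0)"
  shows "\<forall>\<^sub>F q in nhds p. \<psi> q = \<psi> p"
proof -
  have c: "continuous_on UNIV (\<lambda>q. p \<odot> q)" by (intro continuous_intros)
  have "\<forall>\<^sub>F x in nhds x0. x \<in> O0 \<and> p \<odot> \<iota> x \<in> U" by (rule eventually_near_x0[OF c]) (use U in simp_all)
  with eventually_nhds_in_open[OF i_deriv(4) in_doms(3)]
  have "\<forall>\<^sub>F x in nhds x0. x \<in> idom \<and> p \<odot> \<iota> x \<in> U" by eventually_elim blast
  then obtain r where r: "r > 0" "\<And>x. dist x x0 < r \<Longrightarrow> x \<in> idom \<and> p \<odot> \<iota> x \<in> U"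
    unfolding eventually_nhds_metric by blast
  have const: "\<psi> (p \<odot> \<iota> x) = \<psi> (p \<odot> \<iota> x0)" if "x \<in> ball x0 r" for x
  proof (rule has_derivative_zero_unique[OF convex_ball[of x0 r] _ that])
    show "((\<lambda>x. \<psi> (p \<odot> \<iota> x)) has_derivative (\<lambda>h. 0)) (at y within ball x0 r)" if "y \<in> ball x0 r" for y
      using left_deriv_chart[of y \<psi> p "\<lambda>_. 0"] D r(2)[of y] that
      by (auto simp: dist_commute intro: has_derivative_at_withinI)
  qed (use r in simp)
  have "\<forall>\<^sub>F x in nhds x0. x \<in> ball x0 r" using r by (intro eventually_nhds_in_open) auto
  from eventually_translate[OF this, of p] show ?thesis
    by eventually_elim (metis const \<iota>_x0 mul_cancel(6))
qed

section \<open>Velocities\<close>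

text \<open>\<open>T p\<close> identifies the tangent space at the identity with the one at \<open>p\<close>, and \<open>T_inv p\<close> is its
  inverse.\<close>

definition T :: "'g \<Rightarrow> 'a \<Rightarrow> 'a" where "T p = tangent_map A (mul p) e"
definition T_inv :: "'g \<Rightarrow> 'a \<Rightarrow> 'a" where
  "T_inv p = deriv1 (\<lambda>y. \<phi> (iv p \<odot> chart_inv (chart_at A p) y)) (snd (chart_at A p) p)"

lemma T_deriv: "((\<lambda>x. snd (chart_at A p) (p \<odot> \<iota> x)) has_derivative T p) (at x0)"
proof -
  have "(\<lambda>x. snd (chart_at A p) (p \<odot> \<iota> x)) differentiable (at x0)"
    by (rule left_translation_differentiable[OF chart_at(1) chart_at(1) chart_at(2)]) (use chart_at in simp)
  then show ?thesis unfolding T_def tangent_map_def mul_cancel(6) o_def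
    by (simp add: frechet_derivative_works)
qed

lemma T_inv_deriv: "((\<lambda>y. \<phi> (iv p \<odot> chart_inv (chart_at A p) y)) has_derivative T_inv p) (at (snd (chart_at A p) p))"
proof -
  have "(\<lambda>y. \<phi> (iv p \<odot> chart_inv (chart_at A p) y)) differentiable (at (snd (chart_at A p) p))"
    by (rule left_translation_differentiable[OF chart_at(1) chart_at(1) chart_at(2)]) (use e_in in simp)
  then show ?thesis unfolding T_inv_def by (simp add: frechet_derivative_works)
qed

lemma T_inv_T: "T_inv p (T p v) = v"
proof -
  note c = chart_at(1)[of p] chart_at(2)[of p]
  have "((\<lambda>y. \<phi> (iv p \<odot> chart_inv (chart_at A p) y)) has_derivative T_inv p) (at (snd (chart_at A p) (p \<odot> \<iota> x0)))"
    using T_inv_deriv unfolding \<iota>_x0 by simp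
  note D = has_derivative_compose[OF T_deriv this]
  have "\<forall>\<^sub>F x in nhds x0. x \<in> O0 \<and> p \<odot> \<iota> x \<in> fst (chart_at A p)"
    by (rule eventually_near_x0) (use c chart(1)[OF c(1)] in \<open>auto intro!: continuous_intros\<close>)
  then have "\<forall>\<^sub>F x in nhds x0. \<phi> (iv p \<odot> chart_inv (chart_at A p) (snd (chart_at A p) (p \<odot> \<iota> x))) = x"
    by eventually_elim (simp add: chart(5)[OF c(1)] \<phi>_\<iota>)
  from fun_cong[OF has_derivative_unique_nhds[OF D has_derivative_ident this], of v] show ?thesis .
qed

text \<open>The velocity of \<open>\<gamma>\<close> at time \<open>t\<close>, translated back to the identity: the Maurer--Cartan form applied to
  it.\<close>

definition left_vel :: "(real \<Rightarrow> 'g) \<Rightarrow> real \<Rightarrow> 'a \<Rightarrow> bool" where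
  "left_vel \<gamma> t u \<longleftrightarrow> ((\<lambda>\<tau>. \<phi> (iv (\<gamma> t) \<odot> \<gamma> \<tau>)) has_vector_derivative u) (at t within {0..1})"

lemma eventually_curve:
  assumes "continuous_on {0..1} \<gamma>" "t \<in> {0..1}" "\<forall>\<^sub>F q in nhds (\<gamma> t). P q"
  shows "\<forall>\<^sub>F \<tau> in at t within {0..1::real}. P (\<gamma> \<tau>)"
proof -
  have "(\<gamma> \<longlongrightarrow> \<gamma> t) (at t within {0..1})" using assms(1,2) by (simp add: continuous_on_def)
  with assms(3) show ?thesis by (rule eventually_compose_filterlim)
qed

lemma left_vel_if_velocity:
  assumes \<gamma>: "continuous_on {0..1} \<gamma>" and t: "t \<in> {0..1}"
    and diff: "curve_differentiable A \<gamma> t" and vel: "velocity A \<gamma> t = T (\<gamma> t) u"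
  shows "left_vel \<gamma> t u"
proof -
  let ?c = "chart_at A (\<gamma> t)"
  note c = chart_at(1)[of "\<gamma> t"] chart_at(2)[of "\<gamma> t"]
  have "((snd ?c \<circ> \<gamma>) has_vector_derivative T (\<gamma> t) u) (at t within {0..1})"
    using diff vel unfolding curve_differentiable_def velocity_def by (simp add: vector_derivative_works)
  then have "((\<lambda>\<tau>. snd ?c (\<gamma> \<tau>)) has_vector_derivative T (\<gamma> t) u) (at t within {0..1})" by (simp add: o_def)
  from has_vector_derivative_compose_deriv[OF this T_inv_deriv]
  have D: "((\<lambda>\<tau>. \<phi> (iv (\<gamma> t) \<odot> chart_inv ?c (snd ?c (\<gamma> \<tau>)))) has_vector_derivative u) (at t within {0..1})"
    by (simp add: T_inv_T)
  have "\<forall>\<^sub>F q in nhds (\<gamma> t). q \<in> fst ?c" using chart(1)[OF c(1)] c(2) by (rule eventually_nhds_in_open)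
  from eventually_curve[OF \<gamma> t this]
  have "\<forall>\<^sub>F \<tau> in at t within {0..1}. \<phi> (iv (\<gamma> t) \<odot> chart_inv ?c (snd ?c (\<gamma> \<tau>))) = \<phi> (iv (\<gamma> t) \<odot> \<gamma> \<tau>)"
    by eventually_elim (simp add: chart(5)[OF c(1)])
  from has_vector_derivative_cong_nhds[OF D t this] chart(5)[OF c] show ?thesis unfolding left_vel_def by simp
qed

lemma velocity_if_left_vel:
  assumes \<gamma>: "continuous_on {0..1} \<gamma>" and t: "t \<in> {0..1}" and u: "left_vel \<gamma> t u"
  shows "curve_differentiable A \<gamma> t" "velocity A \<gamma> t = T (\<gamma> t) u"
proof -
  let ?c = "chart_at A (\<gamma> t)"
  have "((\<lambda>x. snd ?c (\<gamma> t \<odot> \<iota> x)) has_derivative T (\<gamma> t)) (at (\<phi> (iv (\<gamma> t) \<odot> \<gamma> t)))"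
    using T_deriv by simp
  from has_vector_derivative_compose_deriv[OF u[unfolded left_vel_def] this]
  have D: "((\<lambda>\<tau>. snd ?c (\<gamma> t \<odot> \<iota> (\<phi> (iv (\<gamma> t) \<odot> \<gamma> \<tau>)))) has_vector_derivative T (\<gamma> t) u) (at t within {0..1})" .
  have "\<forall>\<^sub>F q in nhds (\<gamma> t). snd ?c (\<gamma> t \<odot> \<iota> (\<phi> (iv (\<gamma> t) \<odot> q))) = snd ?c q"
    using eventually_translate[OF eventually_True, of "\<gamma> t"] by (auto elim: eventually_mono)
  from has_vector_derivative_cong_nhds[OF D t eventually_curve[OF \<gamma> t this]]
  have D: "((snd ?c \<circ> \<gamma>) has_vector_derivative T (\<gamma> t) u) (at t within {0..1})"
    by (simp add: o_def \<iota>_x0)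
  then show "curve_differentiable A \<gamma> t" unfolding curve_differentiable_def
    by (rule differentiableI_vector)
  show "velocity A \<gamma> t = T (\<gamma> t) u" unfolding velocity_def
    using vector_derivative_within_cbox[of 0 1 t] t D by simp
qed

text \<open>The left velocity of a product is the one of the second factor plus the one of the first factor
  conjugated past the second factor.\<close>

lemma left_vel_mul:
  assumes \<gamma>: "continuous_on {0..1} \<gamma>" "left_vel \<gamma> t u" and \<eta>: "continuous_on {0..1} \<eta>" "left_vel \<eta> t w"
    and t: "t \<in> {0..1}"
  shows "left_vel (\<lambda>\<tau>. \<gamma> \<tau> \<odot> \<eta> \<tau>) t (Ad (iv (\<eta> t)) u + w)"
proof -
  let ?x = "\<lambda>\<tau>. \<phi> (iv (\<gamma> t) \<odot> \<gamma> \<tau>)" and ?y = "\<lambda>\<tau>. \<phi> (iv (\<eta> t) \<odot> \<eta> \<tau>)"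
  let ?k = "conj_rep (iv (\<eta> t))"
  have "(?k has_derivative Ad (iv (\<eta> t))) (at (?x t))" using Ad_deriv by simp
  note K = has_vector_derivative_compose_deriv[OF \<gamma>(2)[unfolded left_vel_def] this]
  have "((\<lambda>\<tau>. (?k (?x \<tau>), ?y \<tau>)) has_vector_derivative (Ad (iv (\<eta> t)) u, w)) (at t within {0..1})"
    using has_vector_derivative_Pair[OF K \<eta>(2)[unfolded left_vel_def]] .
  moreover have "(m has_derivative deriv1 m (x0, x0)) (at (?k (?x t), ?y t))"
    using m_deriv(1)[OF in_doms(1)[OF x0_in]] by simp
  ultimately have "((\<lambda>\<tau>. m (?k (?x \<tau>), ?y \<tau>)) has_vector_derivative deriv1 m (x0, x0) (Ad (iv (\<eta> t)) u, w)) (at t within {0..1})"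
    by (rule has_vector_derivative_compose_deriv)
  then have D: "((\<lambda>\<tau>. m (?k (?x \<tau>), ?y \<tau>)) has_vector_derivative (Ad (iv (\<eta> t)) u + w)) (at t within {0..1})"
    unfolding m_deriv_x0 .
  have "\<forall>\<^sub>F \<tau> in at t within {0..1}. m (?k (?x \<tau>), ?y \<tau>) = \<phi> (iv (\<gamma> t \<odot> \<eta> t) \<odot> (\<gamma> \<tau> \<odot> \<eta> \<tau>))"
    using eventually_curve[OF \<gamma>(1) t eventually_translate[OF \<iota>_conj_rep[of "iv (\<eta> t)"]]]
      eventually_curve[OF \<eta>(1) t eventually_translate[OF eventually_True]]
  proof eventually_elim
    case (elim \<tau>)
    have "\<iota> (?k (?x \<tau>)) = iv (\<eta> t) \<odot> (iv (\<gamma> t) \<odot> \<gamma> \<tau>) \<odot> \<eta> t" using elim(1) by (simp add: \<iota>_\<phi>)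
    moreover have "\<iota> (?y \<tau>) = iv (\<eta> t) \<odot> \<eta> \<tau>" using elim(2) by (simp add: \<iota>_\<phi>)
    moreover have "\<eta> t \<odot> (iv (\<eta> t) \<odot> \<eta> \<tau>) = \<eta> \<tau>" by simp
    ultimately show ?case unfolding mul_rep_def fst_conv snd_conv by (simp add: iv_mul grp.assoc)
  qed
  from has_vector_derivative_cong_nhds[OF D t this] show ?thesis unfolding left_vel_def
    by (simp add: mul_rep_def \<iota>_x0)
qed

lemma left_deriv_along:
  assumes \<gamma>: "continuous_on {0..1} \<gamma>" "left_vel \<gamma> t u" and t: "t \<in> {0..1}" and D: "left_deriv \<psi> (\<gamma> t) D"
  shows "((\<lambda>\<tau>. \<psi> (\<gamma> \<tau>)) has_vector_derivative D u) (at t within {0..1})"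
proof -
  have "((\<lambda>x. \<psi> (\<gamma> t \<odot> \<iota> x)) has_derivative D) (at (\<phi> (iv (\<gamma> t) \<odot> \<gamma> t)))"
    using D by (simp add: left_deriv_def)
  from has_vector_derivative_compose_deriv[OF \<gamma>(2)[unfolded left_vel_def] this]
  have D: "((\<lambda>\<tau>. \<psi> (\<gamma> t \<odot> \<iota> (\<phi> (iv (\<gamma> t) \<odot> \<gamma> \<tau>)))) has_vector_derivative D u) (at t within {0..1})" .
  have "\<forall>\<^sub>F q in nhds (\<gamma> t). \<psi> (\<gamma> t \<odot> \<iota> (\<phi> (iv (\<gamma> t) \<odot> q))) = \<psi> q"
    using eventually_translate[OF eventually_True, of "\<gamma> t"] by (auto elim: eventually_mono)
  from has_vector_derivative_cong_nhds[OF D t eventually_curve[OF \<gamma>(1) t this]] show ?thesis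
    by (simp add: \<iota>_x0)
qed

text \<open>The field \<open>left_inv_field A mul e v\<close> has the coordinate expression \<open>\<lambda>x. M x v\<close>.\<close>

lemma lie_bracket_eq_B: "lie_bracket A mul e v w = B v w"
proof -
  have coord: "field_coord A (chart_at A e) (left_inv_field A mul e v) x = M x v" if x: "x \<in> O0" for x v
  proof -
    define q where "q = \<iota> x"
    note c = chart_at(1)[of q] chart_at(2)[of q]
    have qU: "q \<in> U0" using x \<iota>_in by (simp add: q_def)
    have "(\<lambda>y. \<phi> (e \<odot> chart_inv (chart_at A q) y)) differentiable (at (snd (chart_at A q) q))"
      by (rule left_translation_differentiable[OF c(1) chart_at(1) c(2)]) (use qU in simp)
    then have "((\<phi> \<circ> chart_inv (chart_at A q)) has_derivative deriv1 (\<phi> \<circ> chart_inv (chart_at A q)) (snd (chart_at A q) q))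
        (at (snd (chart_at A q) q))"
      by (simp add: o_def frechet_derivative_works)
    then have "((\<phi> \<circ> chart_inv (chart_at A q)) has_derivative deriv1 (\<phi> \<circ> chart_inv (chart_at A q)) (snd (chart_at A q) q))
        (at (snd (chart_at A q) (q \<odot> \<iota> x0)))" by (simp add: \<iota>_x0)
    note D = has_derivative_compose[OF T_deriv this]
    have "\<forall>\<^sub>F y in nhds x0. y \<in> O0 \<and> q \<odot> \<iota> y \<in> fst (chart_at A q)"
      by (rule eventually_near_x0) (use c chart(1)[OF c(1)] in \<open>auto intro!: continuous_intros\<close>)
    then have "\<forall>\<^sub>F y in nhds x0. (\<phi> \<circ> chart_inv (chart_at A q)) (snd (chart_at A q) (q \<odot> \<iota> y)) = m (x, y)"
      by eventually_elim (simp add: mul_rep_def q_def[symmetric] chart(5)[OF c(1)])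
    from fun_cong[OF has_derivative_unique_nhds[OF D m_snd_deriv[OF in_doms(1)[OF x]] this], of v]
    show ?thesis unfolding field_coord_def left_inv_field_def Let_def M_def T_def[symmetric] q_def[symmetric] .
  qed
  have deriv: "deriv1 (field_coord A (chart_at A e) (left_inv_field A mul e v)) x0 h = M' x0 h v" for v h
  proof -
    have "(field_coord A (chart_at A e) (left_inv_field A mul e v) has_derivative (\<lambda>h. M' x0 h v)) (at x0)"
      by (rule has_derivative_cong_nhds[OF M_deriv[OF x0_in]])
        (use eventually_nhds_in_open[OF open_O0 x0_in] in \<open>eventually_elim, simp add: coord\<close>)
    from frechet_derivative_at[OF this] show ?thesis by metis
  qed
  show ?thesis
    unfolding lie_bracket_def field_bracket_def Let_def deriv coord[OF x0_in] M_x0 B_def ..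
qed

section \<open>A primitive of the sum of the left- and right-invariant forms\<close>

lemma chart_nbhd:
  assumes "open V" "V \<subseteq> O0"
  shows "open ((\<lambda>x. p \<odot> \<iota> x) ` V)"
    and "q \<in> (\<lambda>x. p \<odot> \<iota> x) ` V \<longleftrightarrow> iv p \<odot> q \<in> U0 \<and> \<phi> (iv p \<odot> q) \<in> V"
    and "continuous_on V (\<lambda>x. p \<odot> \<iota> x)"
proof -
  show iff: "q \<in> (\<lambda>x. p \<odot> \<iota> x) ` V \<longleftrightarrow> iv p \<odot> q \<in> U0 \<and> \<phi> (iv p \<odot> q) \<in> V" for q
  proof
    assume "q \<in> (\<lambda>x. p \<odot> \<iota> x) ` V"
    then obtain x where x: "x \<in> V" "q = p \<odot> \<iota> x" by blast
    then have "x \<in> O0" using assms by blast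
    then show "iv p \<odot> q \<in> U0 \<and> \<phi> (iv p \<odot> q) \<in> V" using x \<iota>_in[of x] \<phi>_\<iota>[of x] by simp
  next
    assume "iv p \<odot> q \<in> U0 \<and> \<phi> (iv p \<odot> q) \<in> V"
    then show "q \<in> (\<lambda>x. p \<odot> \<iota> x) ` V"
      by (intro image_eqI[of _ _ "\<phi> (iv p \<odot> q)"]) (simp_all add: \<iota>_\<phi>)
  qed
  have "open (U0 \<inter> \<phi> -` V)"
    by (rule continuous_open_preimage[OF chart(3)[OF chart_at(1)] open_U0 assms(1)])
  then have "open ((\<lambda>q. iv p \<odot> q) -` (U0 \<inter> \<phi> -` V))"
    by (rule open_vimage) (intro continuous_intros)
  moreover have "(\<lambda>q. iv p \<odot> q) -` (U0 \<inter> \<phi> -` V) = (\<lambda>x. p \<odot> \<iota> x) ` V"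
    using iff by (intro set_eqI) (simp only: vimage_eq Int_iff)
  ultimately show "open ((\<lambda>x. p \<odot> \<iota> x) ` V)" by simp
  have "continuous_on V \<iota>" by (rule continuous_on_subset[OF chart(4)[OF chart_at(1)] assms(2)])
  then show "continuous_on V (\<lambda>x. p \<odot> \<iota> x)" by (intro continuous_intros)
qed

lemma small_ball:
  fixes W :: "'g set"
  assumes "open W" "p \<in> W"
  obtains r where "r > 0" "ball x0 r \<subseteq> idom" "(\<lambda>x. p \<odot> \<iota> x) ` ball x0 r \<subseteq> W"
proof -
  have "\<forall>\<^sub>F x in nhds x0. x \<in> O0 \<and> p \<odot> \<iota> x \<in> W"
    by (rule eventually_near_x0) (use assms in \<open>auto intro!: continuous_intros\<close>)
  with eventually_nhds_in_open[OF i_deriv(4) in_doms(3)]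
  have "\<forall>\<^sub>F x in nhds x0. x \<in> idom \<and> p \<odot> \<iota> x \<in> W" by eventually_elim blast
  then obtain r where r: "r > 0" "\<And>x. dist x x0 < r \<Longrightarrow> x \<in> idom \<and> p \<odot> \<iota> x \<in> W"
    unfolding eventually_nhds_metric by blast
  show thesis
    by (rule that[OF r(1)]) (use r(2) in \<open>auto simp: dist_commute\<close>)
qed

lemma locally_path_connected_group:
  fixes W :: "'g set"
  assumes "open W" "p \<in> W"
  shows "\<exists>V. open V \<and> p \<in> V \<and> V \<subseteq> W \<and> path_connected V"
proof -
  obtain r where r: "r > 0" "ball x0 r \<subseteq> idom" "(\<lambda>x. p \<odot> \<iota> x) ` ball x0 r \<subseteq> W"
    using small_ball[OF assms] by blast
  have O: "ball x0 r \<subseteq> O0" using r(2) in_doms(6) by blast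
  have "p \<in> (\<lambda>x. p \<odot> \<iota> x) ` ball x0 r" using r(1) by (intro image_eqI[of _ _ x0]) (simp_all add: \<iota>_x0)
  moreover have "path_connected ((\<lambda>x. p \<odot> \<iota> x) ` ball x0 r)"
    by (rule path_connected_continuous_image[OF chart_nbhd(3)[OF open_ball O]]) (simp add: convex_imp_path_connected)
  ultimately show ?thesis using chart_nbhd(1)[OF open_ball O] r(3) by blast
qed

end

locale two_step_group = lie_group_in_charts A mul e iv
  for A :: "('g::{t2_space,second_countable_topology}, 'a::euclidean_space) chart set"
    and mul :: "'g \<Rightarrow> 'g \<Rightarrow> 'g" and e :: 'g and iv :: "'g \<Rightarrow> 'g" +
  assumes simply_connected: "simply_connected (UNIV :: 'g set)"
    and two_step: "two_step_nilpotent A mul e"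
begin

abbreviation "derived_algebra \<equiv> bracket_space A mul e UNIV UNIV"

lemma B_in_derived: "B v w \<in> derived_algebra"
  unfolding bracket_space_def lie_bracket_eq_B by (rule span_base) blast

lemma B_derived: assumes "z \<in> derived_algebra" shows "B v z = 0" "B z v = 0"
proof -
  have "B v z \<in> bracket_space A mul e UNIV derived_algebra"
    unfolding bracket_space_def[of _ _ _ UNIV derived_algebra] lie_bracket_eq_B
    by (rule span_base) (use assms in blast)
  then show "B v z = 0" using two_step by (simp add: two_step_nilpotent_def)
  then show "B z v = 0" using B_skew[of z v] by simp
qed

text \<open>The left derivative of \<open>\<lambda>p. Ad p z\<close> consists of brackets with \<open>z\<close>, which vanish in a two-step
  nilpotent algebra; so the function is constant on the connected group.\<close>

lemma Ad_derived: assumes z: "z \<in> derived_algebra" shows "Ad p z = z"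
proof -
  have "left_deriv (\<lambda>p. Ad p z) p (\<lambda>_. 0)" for p
    using Ad_left_deriv[of z p] unfolding B_derived(1)[OF z] linear_0[OF Ad_linear] .
  then have "\<forall>\<^sub>F q in nhds p. Ad q z = Ad p z" for p
    by (rule left_deriv_zero_locally_constant[OF open_UNIV UNIV_I])
  then have "\<forall>\<^sub>F q in at p within UNIV. Ad p z = Ad q z" for p
    unfolding eventually_at_filter by (rule eventually_mono) simp
  then have "\<forall>p\<in>UNIV. \<forall>\<^sub>F q in at p within UNIV. Ad p z = Ad q z" by blast
  from connected_local_const[OF simply_connected_UNIV_connected[OF simply_connected] UNIV_I UNIV_I this, of p e]
  show ?thesis by (simp add: Ad_e)
qed

lemma Ad_left_deriv2: "left_deriv (\<lambda>p. Ad p v) p (\<lambda>h. B h v)"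
  using Ad_left_deriv[of v p] unfolding Ad_derived[OF B_in_derived] .

lemma Ad_continuous: "continuous_on UNIV (\<lambda>p. Ad p v)"
  using left_deriv_continuous[OF Ad_left_deriv2] tendsto_at_iff_tendsto_nhds[of "\<lambda>p. Ad p v"]
  by (simp add: continuous_on_def)

text \<open>The sum of the left-invariant and the right-invariant one-form with the value \<open>\<lambda>u. u \<bullet> \<zeta>\<close> at the
  identity, evaluated on the left-invariant fields. The exterior derivatives of the two summands are
  \<open>\<mp> [u, v] \<bullet> \<zeta>\<close>, because \<open>Ad\<close> fixes brackets.\<close>

definition \<Omega> :: "'a \<Rightarrow> 'g \<Rightarrow> 'a \<Rightarrow> real" where "\<Omega> \<zeta> p u = u \<bullet> \<zeta> + Ad p u \<bullet> \<zeta>"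

lemma \<Omega>_linear: "linear (\<Omega> \<zeta> p)"
  unfolding \<Omega>_def[abs_def]
  by (intro linearI) (simp_all add: inner_add_left linear_add[OF Ad_linear] linear_scale[OF Ad_linear] algebra_simps)

text \<open>In the coordinates \<open>\<lambda>x. p \<odot> \<iota> x\<close> the form is \<open>\<alpha> x w = \<Omega> \<zeta> (p \<odot> \<iota> x) (K x w)\<close>. With \<open>b = B (K x h) (K x w)\<close>,
  the Maurer--Cartan equation contributes \<open>- b - Ad b = - 2 b\<close> to the skew part of its derivative, and
  the derivative of \<open>Ad\<close> contributes \<open>2 b\<close>; hence the form is closed.\<close>

lemma local_primitive:
  obtains U f where "open U" "p \<in> U" "\<And>q. q \<in> U \<Longrightarrow> left_deriv f q (\<Omega> \<zeta> q)"
proof -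
  obtain r where r: "r > 0" "ball x0 r \<subseteq> idom" "(\<lambda>x. p \<odot> \<iota> x) ` ball x0 r \<subseteq> UNIV"
    by (rule small_ball[OF open_UNIV UNIV_I])
  have O: "ball x0 r \<subseteq> O0" using r(2) in_doms(6) by blast
  define \<alpha> where "\<alpha> x w = \<Omega> \<zeta> (p \<odot> \<iota> x) (K x w)" for x w
  define \<alpha>' where "\<alpha>' x h w = K' x h w \<bullet> \<zeta> + (B (K x h) (K x w) + Ad (p \<odot> \<iota> x) (K' x h w)) \<bullet> \<zeta>" for x h w
  have Ad': "((\<lambda>x. Ad (p \<odot> \<iota> x) v) has_derivative (\<lambda>h. B (K x h) v)) (at x)" if "x \<in> idom" for x v
    by (rule left_deriv_chart[OF that Ad_left_deriv2])
  have AdK: "((\<lambda>x. Ad (p \<odot> \<iota> x) (K x w)) has_derivative (\<lambda>h. B (K x h) (K x w) + Ad (p \<odot> \<iota> x) (K' x h w))) (at x)"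
    if "x \<in> idom" for x w
    by (rule has_derivative_apply_linear[where A="\<lambda>x. Ad (p \<odot> \<iota> x)" and A'="\<lambda>v h. B (K x h) v",
          OF Ad'[OF that] Ad_linear i_deriv(4) that K_deriv[OF that]])
  obtain f where f: "\<And>x. x \<in> ball x0 r \<Longrightarrow> (f has_derivative \<alpha> x) (at x)"
  proof (rule Poincare_ball[of x0 r \<alpha> \<alpha>'])
    fix x assume "x \<in> ball x0 r"
    then have x: "x \<in> idom" using r by blast
    show "linear (\<alpha> x)"
      unfolding \<alpha>_def[abs_def] using linear_compose[OF K_linear[OF x] \<Omega>_linear] by (simp add: o_def)
    show "((\<lambda>x. \<alpha> x w) has_derivative (\<lambda>h. \<alpha>' x h w)) (at x)" for w
      unfolding \<alpha>_def \<Omega>_def \<alpha>'_def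
      by (intro has_derivative_add has_derivative_inner_left K_deriv[OF x] AdK[OF x])
    show "\<alpha>' x h w = \<alpha>' x w h" for h w
    proof -
      define b where "b = B (K x h) (K x w)"
      have "K' x h w = K' x w h - b" using Maurer_Cartan[OF x, of h w] by (simp add: b_def algebra_simps)
      moreover have "Ad (p \<odot> \<iota> x) b = b" unfolding b_def by (rule Ad_derived[OF B_in_derived])
      moreover have "B (K x w) (K x h) = - b" unfolding b_def by (rule B_skew)
      ultimately show ?thesis
        unfolding \<alpha>'_def b_def[symmetric]
        by (simp add: inner_add_left inner_diff_left linear_diff[OF Ad_linear])
    qed
  next
    have bb: "bounded_bilinear B" using bilinear_B by (simp add: bilinear_conv_bounded_bilinear)
    have Kc: "continuous_on (ball x0 r) (\<lambda>x. K x v)" for v by (rule continuous_on_subset[OF K_continuous r(2)])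
    have K'c: "continuous_on (ball x0 r) (\<lambda>x. K' x h v)" for h v by (rule continuous_on_subset[OF K'_continuous r(2)])
    have "continuous_on (ball x0 r) (\<lambda>x. Ad (p \<odot> \<iota> x) v)" for v
      by (rule continuous_on_compose2[OF Ad_continuous chart_nbhd(3)[OF open_ball O]]) simp
    then show "continuous_on (ball x0 r) (\<lambda>x. \<alpha>' x h w)" for h w
      unfolding \<alpha>'_def
      by (intro continuous_intros K'c bounded_bilinear.continuous_on[OF bb Kc Kc]
          continuous_on_apply_linear[where A="\<lambda>x. Ad (p \<odot> \<iota> x)", OF _ Ad_linear K'c])
  qed blast
  show thesis
  proof (rule that[of "(\<lambda>x. p \<odot> \<iota> x) ` ball x0 r" "\<lambda>q. f (\<phi> (iv p \<odot> q))"])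
    show "open ((\<lambda>x. p \<odot> \<iota> x) ` ball x0 r)" by (rule chart_nbhd(1)[OF open_ball O])
    show "p \<in> (\<lambda>x. p \<odot> \<iota> x) ` ball x0 r" using r(1) by (intro image_eqI[of _ _ x0]) (simp_all add: \<iota>_x0)
    fix q assume "q \<in> (\<lambda>x. p \<odot> \<iota> x) ` ball x0 r"
    then obtain x where x: "x \<in> ball x0 r" "q = p \<odot> \<iota> x" by blast
    then have xi: "x \<in> idom" using r by blast
    have "(f has_derivative \<alpha> x) (at (m (x, x0)))" using f[OF x(1)] m_x0(1)[OF in_doms(6)[OF xi]] by simp
    note D = has_derivative_compose[OF m_snd_deriv[OF in_doms(1)[OF in_doms(6)[OF xi]]] this]
    have "((\<lambda>y. f (m (x, y))) has_derivative \<Omega> \<zeta> q) (at x0)"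
      using D unfolding M_def[symmetric] \<alpha>_def K_M[OF xi] x(2) .
    then show "left_deriv (\<lambda>q. f (\<phi> (iv p \<odot> q))) q (\<Omega> \<zeta> q)"
      unfolding left_deriv_def x(2) mul_rep_def fst_conv snd_conv grp.assoc mul_cancel(1) .
  qed
qed

theorem primitive_of_\<Omega>:
  obtains \<psi> where "\<And>q. left_deriv \<psi> q (\<Omega> \<zeta> q)"
proof -
  define F where "F = {(U, f). open U \<and> (\<forall>q\<in>U. left_deriv f q (\<Omega> \<zeta> q))}"
  interpret compatible_primitives F
  proof
    show "open U" if "(U, f) \<in> F" for U f using that by (simp add: F_def)
    show "\<exists>U f. (U, f) \<in> F \<and> x \<in> U" for x
    proof -
      obtain U f where "open U" "x \<in> U" "\<And>q. q \<in> U \<Longrightarrow> left_deriv f q (\<Omega> \<zeta> q)" by (rule local_primitive[of x \<zeta>]) blast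
      then show ?thesis unfolding F_def by blast
    qed
    fix U f U' f' x assume *: "(U, f) \<in> F" "(U', f') \<in> F" "x \<in> U" "x \<in> U'"
    have "left_deriv (\<lambda>q. f q - f' q) q (\<lambda>_. 0)" if "q \<in> U \<inter> U'" for q
    proof -
      have "left_deriv f q (\<Omega> \<zeta> q)" "left_deriv f' q (\<Omega> \<zeta> q)" using * that by (auto simp: F_def)
      from has_derivative_diff[OF this[unfolded left_deriv_def]] show ?thesis by (simp add: left_deriv_def)
    qed
    moreover have "open (U \<inter> U')" "x \<in> U \<inter> U'" using * by (auto simp: F_def)
    ultimately show "\<forall>\<^sub>F y in nhds x. f y - f' y = f x - f' x"
      by (intro left_deriv_zero_locally_constant[of "U \<inter> U'"])
  qed
  obtain \<psi> where \<psi>: "\<And>U f x. (U, f) \<in> F \<Longrightarrow> x \<in> U \<Longrightarrow> \<forall>\<^sub>F y in nhds x. \<psi> y - f y = \<psi> x - f x"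
    using global_primitive[OF simply_connected locally_path_connected_group] by blast
  have "left_deriv \<psi> q (\<Omega> \<zeta> q)" for q
  proof -
    obtain U f where U: "open U" "q \<in> U" "\<And>q. q \<in> U \<Longrightarrow> left_deriv f q (\<Omega> \<zeta> q)"
      using local_primitive[of q \<zeta>] by blast
    then have "(U, f) \<in> F" by (simp add: F_def)
    from \<psi>[OF this U(2)] have ev: "\<forall>\<^sub>F y in nhds q. \<psi> y - f y = \<psi> q - f q" .
    have D: "((\<lambda>x. f (q \<odot> \<iota> x) + (\<psi> q - f q)) has_derivative \<Omega> \<zeta> q) (at x0)"
      using has_derivative_add[OF U(3)[OF U(2), unfolded left_deriv_def] has_derivative_const, of "\<psi> q - f q"] by simp
    obtain W where W: "open W" "q \<in> W" "\<And>y. y \<in> W \<Longrightarrow> \<psi> y - f y = \<psi> q - f q"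
      using ev unfolding eventually_nhds by blast
    have "\<forall>\<^sub>F x in nhds x0. x \<in> O0 \<and> q \<odot> \<iota> x \<in> W"
      by (rule eventually_near_x0) (use W in \<open>auto intro!: continuous_intros\<close>)
    then have "\<forall>\<^sub>F x in nhds x0. f (q \<odot> \<iota> x) + (\<psi> q - f q) = \<psi> (q \<odot> \<iota> x)"
    proof eventually_elim
      case (elim x)
      then show ?case using W(3)[of "q \<odot> \<iota> x"] by simp
    qed
    from has_derivative_cong_nhds[OF D this] show ?thesis by (simp add: left_deriv_def)
  qed
  with that show thesis by blast
qed

end

text \<open>Expand in the basis: each summand is a continuous function times an integrable one.\<close>

lemma absolutely_integrable_apply_linear:
  fixes A :: "real \<Rightarrow> 'a::euclidean_space \<Rightarrow> 'b::euclidean_space"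
  assumes A: "\<And>v. continuous_on {u..v'} (\<lambda>t. A t v)" and lin: "\<And>t. t \<in> {u..v'} \<Longrightarrow> linear (A t)"
    and w: "w absolutely_integrable_on {u..v'}"
  shows "(\<lambda>t. A t (w t)) absolutely_integrable_on {u..v'}"
proof -
  have "(\<lambda>t. (w t \<bullet> b) *\<^sub>R A t b) absolutely_integrable_on {u..v'}" if "b \<in> Basis" for b
  proof (rule absolutely_integrable_bounded_measurable_product[where h="\<lambda>x s. s *\<^sub>R x"])
    show "bilinear (\<lambda>(x::'b) s. s *\<^sub>R x)"
      by (auto simp: bilinear_def algebra_simps intro!: linearI)
    show "(\<lambda>t. A t b) \<in> borel_measurable (lebesgue_on {u..v'})"
      using A by (intro continuous_imp_measurable_on_sets_lebesgue) auto
    show "bounded ((\<lambda>t. A t b) ` {u..v'})"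
      by (intro compact_imp_bounded compact_continuous_image A compact_Icc)
    show "(\<lambda>t. w t \<bullet> b) absolutely_integrable_on {u..v'}"
      using w by (rule absolutely_integrable_component)
  qed simp
  then have "(\<lambda>t. \<Sum>b\<in>Basis. (w t \<bullet> b) *\<^sub>R A t b) absolutely_integrable_on {u..v'}"
    by (intro absolutely_integrable_sum) auto
  then show ?thesis
    by (rule absolutely_integrable_spike[OF _ negligible_empty]) (use linear_eq_sum_Basis[OF lin] in auto)
qed

context lie_group_in_charts
begin

section \<open>Left velocities of absolutely continuous curves\<close>

definition C1_left :: "('g \<Rightarrow> 'b::real_normed_vector) \<Rightarrow> ('g \<Rightarrow> 'a \<Rightarrow> 'b) \<Rightarrow> bool" where
  "C1_left \<psi> D \<longleftrightarrow> (\<forall>q. left_deriv \<psi> q (D q)) \<and> (\<forall>v. continuous_on UNIV (\<lambda>q. D q v))"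

lemma translated_chart_lipschitz:
  obtains L r where "r > 0" "cball (snd (chart_at A p) p) r \<subseteq> snd (chart_at A p) ` fst (chart_at A p)"
    "\<And>y. y \<in> cball (snd (chart_at A p) p) r \<Longrightarrow> iv p \<odot> chart_inv (chart_at A p) y \<in> U0"
    "L-lipschitz_on (cball (snd (chart_at A p) p) r) (\<lambda>y. \<phi> (iv p \<odot> chart_inv (chart_at A p) y))"
proof -
  let ?a = "chart_at A (iv p)" and ?c = "chart_at A p" and ?e = "chart_at A e"
  note a = chart_at(1)[of "iv p"] chart_at(2)[of "iv p"] and c = chart_at(1)[of p] chart_at(2)[of p]
  define S where "S = {y. (snd ?a (iv p), y) \<in> mul_dom ?a ?c ?e}"
  have a_inv: "chart_inv ?a (snd ?a (iv p)) = iv p" by (rule chart(5)[OF a])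
  have S_iff: "y \<in> S \<longleftrightarrow> y \<in> snd ?c ` fst ?c \<and> iv p \<odot> chart_inv ?c y \<in> U0" for y
    using a(2) by (simp add: S_def mul_dom_def a_inv)
  have "open (Pair (snd ?a (iv p)) -` mul_dom ?a ?c ?e)"
    by (rule open_vimage[OF mul_rep_smooth(1)[OF a(1) c(1) chart_at(1)]]) (intro continuous_intros)
  then have S: "open S" by (simp add: S_def vimage_def)
  have pS: "snd ?c p \<in> S" using c chart(5)[OF c] e_in by (simp add: S_iff)
  have sm: "smooth_on (mul_dom ?a ?c ?e) (mul_rep ?a ?c ?e)" by (rule mul_rep_smooth(2)[OF a(1) c(1) chart_at(1)])
  let ?f' = "\<lambda>y v. deriv1 (mul_rep ?a ?c ?e) (snd ?a (iv p), y) (0, v)"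
  have "((\<lambda>y. mul_rep ?a ?c ?e (snd ?a (iv p), y)) has_derivative ?f' y) (at y)" if "y \<in> S" for y
    by (rule has_derivative_compose[OF has_derivative_Pair_const(1) smooth_on_deriv(1)[OF sm]])
      (use that in \<open>simp add: S_def\<close>)
  then have f': "((\<lambda>y. \<phi> (iv p \<odot> chart_inv ?c y)) has_derivative ?f' y) (at y)" if "y \<in> S" for y
    using that unfolding mul_rep_def fst_conv snd_conv a_inv .
  have "continuous_on S (\<lambda>y. ?f' y v)" for v
    by (rule continuous_on_compose2[OF smooth_on_continuous_deriv(2)[OF sm]])
      (auto simp: S_def intro!: continuous_intros)
  then have cont: "continuous (at (snd ?c p)) (\<lambda>y. ?f' y v)" for v
    using S pS by (simp add: continuous_on_eq_continuous_at)
  obtain L r where "r > 0" "cball (snd ?c p) r \<subseteq> S" "L-lipschitz_on (cball (snd ?c p) r) (\<lambda>y. \<phi> (iv p \<odot> chart_inv ?c y))"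
    by (rule locally_lipschitz_if_C1[OF S pS f' cont])
  then show thesis using S_iff by (intro that[of r L]) auto
qed

text \<open>Near \<open>p\<close>, the function is a Lipschitz function of \<open>\<phi> (iv p \<odot> q)\<close>, which is a Lipschitz function of the
  coordinates of \<open>q\<close> in the selected chart.\<close>

lemma C1_left_lipschitz:
  assumes \<psi>: "C1_left \<psi> D"
  obtains L r where "r > 0" "cball (snd (chart_at A p) p) r \<subseteq> snd (chart_at A p) ` fst (chart_at A p)"
    "L-lipschitz_on (cball (snd (chart_at A p) p) r) (\<lambda>y. \<psi> (chart_inv (chart_at A p) y))"
proof -
  let ?c = "chart_at A p"
  define g where "g y = \<phi> (iv p \<odot> chart_inv ?c y)" for y
  obtain L1 r1 where 1: "r1 > 0" "cball (snd ?c p) r1 \<subseteq> snd ?c ` fst ?c"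
      "\<And>y. y \<in> cball (snd ?c p) r1 \<Longrightarrow> iv p \<odot> chart_inv ?c y \<in> U0" "L1-lipschitz_on (cball (snd ?c p) r1) g"
    unfolding g_def by (rule translated_chart_lipschitz[of p]) blast
  have L1: "L1 \<ge> 0" using 1(4) by (rule lipschitz_on_nonneg)
  have D: "left_deriv \<psi> q (D q)" "continuous_on UNIV (\<lambda>q. D q v)" for q v using \<psi> by (auto simp: C1_left_def)
  have D_lin: "linear (D q)" for q using D(1)[of q] unfolding left_deriv_def by (rule has_derivative_linear)
  have "continuous_on idom \<iota>"
    by (rule continuous_on_subset[OF chart(4)[OF chart_at(1)]]) (use in_doms(6) in blast)
  then have "continuous_on idom (\<lambda>x. p \<odot> \<iota> x)" by (intro continuous_intros)
  then have "continuous_on idom (\<lambda>x. D (p \<odot> \<iota> x) v)" for v by (rule continuous_on_compose2[OF D(2)]) simp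
  then have "continuous_on idom (\<lambda>x. D (p \<odot> \<iota> x) (K x v))" for v
    by (rule continuous_on_apply_linear[where A="\<lambda>x. D (p \<odot> \<iota> x)", OF _ D_lin K_continuous])
  then have cont: "continuous (at x0) (\<lambda>x. D (p \<odot> \<iota> x) (K x v))" for v
    using i_deriv(4) in_doms(3) by (simp add: continuous_on_eq_continuous_at)
  obtain L2 r2 where 2: "r2 > 0" "cball x0 r2 \<subseteq> idom" "L2-lipschitz_on (cball x0 r2) (\<lambda>x. \<psi> (p \<odot> \<iota> x))"
    by (rule locally_lipschitz_if_C1[OF i_deriv(4) in_doms(3) left_deriv_chart[OF _ D(1)] cont])
  define r where "r = min r1 (r2 / (L1 + 1))"
  have r: "r > 0" "r \<le> r1" "L1 * r \<le> r2"
  proof -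
    show "r > 0" "r \<le> r1" using 1(1) 2(1) L1 by (auto simp: r_def)
    have "L1 * r \<le> L1 * (r2 / (L1 + 1))" using L1 by (intro mult_left_mono) (auto simp: r_def)
    also have "\<dots> \<le> r2" using L1 2(1) by (simp add: field_simps)
    finally show "L1 * r \<le> r2" .
  qed
  have sub: "cball (snd ?c p) r \<subseteq> cball (snd ?c p) r1" using r(2) by auto
  have gp: "g (snd ?c p) = x0" using chart(5)[OF chart_at(1) chart_at(2), of p] by (simp add: g_def)
  have g_in: "g ` cball (snd ?c p) r \<subseteq> cball x0 r2"
  proof (clarify)
    fix y assume y: "y \<in> cball (snd ?c p) r"
    have "dist (g (snd ?c p)) (g y) \<le> L1 * dist (snd ?c p) y"
      using 1(1) y sub by (intro lipschitz_onD[OF 1(4)]) auto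
    also have "\<dots> \<le> L1 * r" using y L1 by (intro mult_left_mono) auto
    finally show "g y \<in> cball x0 r2" using r(3) by (simp add: gp)
  qed
  have "(L2 * L1)-lipschitz_on (cball (snd ?c p) r) (\<lambda>y. \<psi> (p \<odot> \<iota> (g y)))"
    using lipschitz_on_compose2[OF lipschitz_on_subset[OF 1(4) sub] lipschitz_on_subset[OF 2(3) g_in]] .
  then have "(L2 * L1)-lipschitz_on (cball (snd ?c p) r) (\<lambda>y. \<psi> (chart_inv ?c y))"
  proof (rule lipschitz_on_transform)
    fix y assume "y \<in> cball (snd ?c p) r"
    then show "\<psi> (chart_inv ?c y) = \<psi> (p \<odot> \<iota> (g y))" using 1(3)[of y] sub by (auto simp: g_def \<iota>_\<phi>)
  qed
  moreover have "cball (snd ?c p) r \<subseteq> snd ?c ` fst ?c" using sub 1(2) by blast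
  ultimately show thesis using that r(1) by blast
qed

lemma curve_near:
  fixes \<gamma> :: "real \<Rightarrow> 'c::topological_space"
  assumes \<gamma>: "continuous_on {0..1} \<gamma>" and t: "t \<in> {0..1}" and W: "open W" "\<gamma> t \<in> W"
  obtains d where "d > 0" "\<And>u v. 0 \<le> u \<Longrightarrow> u \<le> t \<Longrightarrow> t \<le> v \<Longrightarrow> v \<le> 1 \<Longrightarrow> v - u < d \<Longrightarrow> \<gamma> ` {u..v} \<subseteq> W"
proof -
  have "\<forall>\<^sub>F \<tau> in at t within {0..1}. \<gamma> \<tau> \<in> W"
    using topological_tendstoD[of \<gamma> "\<gamma> t" "at t within {0..1}" W] \<gamma> t W by (auto simp: continuous_on_def)
  then obtain d where d: "d > 0" "\<And>\<tau>. \<tau> \<in> {0..1} \<Longrightarrow> \<tau> \<noteq> t \<Longrightarrow> dist \<tau> t < d \<Longrightarrow> \<gamma> \<tau> \<in> W"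
    unfolding eventually_at by blast
  show thesis
  proof (rule that[OF d(1)])
    fix u v assume uv: "0 \<le> u" "u \<le> t" "t \<le> v" "v \<le> 1" "v - u < d"
    show "\<gamma> ` {u..v} \<subseteq> W"
    proof (clarify)
      fix \<tau> assume "\<tau> \<in> {u..v}"
      then show "\<gamma> \<tau> \<in> W" using d(2)[of \<tau>] uv W(2) by (cases "\<tau> = t") (auto simp: dist_real_def)
    qed
  qed
qed

lemma abs_continuous_curve_local:
  assumes \<gamma>: "abs_continuous_curve A \<gamma>" and t: "t \<in> {0..1}" and r: "r > 0"
  obtains d where "d > 0"
    "\<And>u v. 0 \<le> u \<Longrightarrow> u \<le> t \<Longrightarrow> t \<le> v \<Longrightarrow> v \<le> 1 \<Longrightarrow> v - u < d \<Longrightarrow> \<gamma> ` {u..v} \<subseteq> fst (chart_at A (\<gamma> t))"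
    "\<And>u v. 0 \<le> u \<Longrightarrow> u \<le> t \<Longrightarrow> t \<le> v \<Longrightarrow> v \<le> 1 \<Longrightarrow> v - u < d \<Longrightarrow>
      (\<lambda>\<tau>. snd (chart_at A (\<gamma> t)) (\<gamma> \<tau>)) ` {u..v} \<subseteq> cball (snd (chart_at A (\<gamma> t)) (\<gamma> t)) r"
    "\<And>u v. 0 \<le> u \<Longrightarrow> u \<le> t \<Longrightarrow> t \<le> v \<Longrightarrow> v \<le> 1 \<Longrightarrow> v - u < d \<Longrightarrow>
      abs_continuous_on u v (\<lambda>\<tau>. snd (chart_at A (\<gamma> t)) (\<gamma> \<tau>))"
proof -
  let ?c = "chart_at A (\<gamma> t)"
  note c = chart_at(1)[of "\<gamma> t"] chart_at(2)[of "\<gamma> t"]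
  define W where "W = fst ?c \<inter> snd ?c -` ball (snd ?c (\<gamma> t)) r"
  have W: "open W" unfolding W_def by (rule continuous_open_preimage[OF chart(3,1)[OF c(1)] open_ball])
  have tW: "\<gamma> t \<in> W" using c r by (simp add: W_def)
  have \<gamma>c: "continuous_on {0..1} \<gamma>" using \<gamma> by (simp add: abs_continuous_curve_def)
  obtain d where d: "d > 0" "\<And>u v. 0 \<le> u \<Longrightarrow> u \<le> t \<Longrightarrow> t \<le> v \<Longrightarrow> v \<le> 1 \<Longrightarrow> v - u < d \<Longrightarrow> \<gamma> ` {u..v} \<subseteq> W"
    by (rule curve_near[OF \<gamma>c t W tW]) blast
  show thesis
  proof (rule that[OF d(1)])
    fix u v assume uv: "0 \<le> u" "u \<le> t" "t \<le> v" "v \<le> 1" "v - u < d"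
    have sub: "\<gamma> ` {u..v} \<subseteq> W" using d(2)[OF uv] .
    then show "\<gamma> ` {u..v} \<subseteq> fst ?c" by (auto simp: W_def)
    show "(\<lambda>\<tau>. snd ?c (\<gamma> \<tau>)) ` {u..v} \<subseteq> cball (snd ?c (\<gamma> t)) r"
    proof (clarify)
      fix \<tau> assume "\<tau> \<in> {u..v}"
      then have "\<gamma> \<tau> \<in> W" using sub by blast
      then show "snd ?c (\<gamma> \<tau>) \<in> cball (snd ?c (\<gamma> t)) r" by (simp add: W_def)
    qed
    have "abs_continuous_on u v (snd ?c \<circ> \<gamma>)"
      using \<gamma> c(1) uv sub unfolding abs_continuous_curve_def by (auto simp: W_def)
    then show "abs_continuous_on u v (\<lambda>\<tau>. snd ?c (\<gamma> \<tau>))" by (simp add: o_def)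
  qed
qed

lemma C1_left_abs_continuous:
  assumes \<gamma>: "abs_continuous_curve A \<gamma>" and \<psi>: "C1_left \<psi> D"
  shows "abs_continuous_on 0 1 (\<lambda>t. \<psi> (\<gamma> t))"
proof (rule abs_continuous_on_local_to_global)
  fix t :: real assume t: "0 \<le> t" "t \<le> 1"
  then have t01: "t \<in> {0..1}" by simp
  let ?c = "chart_at A (\<gamma> t)"
  obtain L r where Lr: "r > 0" "cball (snd ?c (\<gamma> t)) r \<subseteq> snd ?c ` fst ?c"
      "L-lipschitz_on (cball (snd ?c (\<gamma> t)) r) (\<lambda>y. \<psi> (chart_inv ?c y))"
    by (rule C1_left_lipschitz[OF \<psi>, of "\<gamma> t"]) blast
  obtain d where d: "d > 0"
    "\<And>u v. 0 \<le> u \<Longrightarrow> u \<le> t \<Longrightarrow> t \<le> v \<Longrightarrow> v \<le> 1 \<Longrightarrow> v - u < d \<Longrightarrow> \<gamma> ` {u..v} \<subseteq> fst ?c"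
    "\<And>u v. 0 \<le> u \<Longrightarrow> u \<le> t \<Longrightarrow> t \<le> v \<Longrightarrow> v \<le> 1 \<Longrightarrow> v - u < d \<Longrightarrow> (\<lambda>\<tau>. snd ?c (\<gamma> \<tau>)) ` {u..v} \<subseteq> cball (snd ?c (\<gamma> t)) r"
    "\<And>u v. 0 \<le> u \<Longrightarrow> u \<le> t \<Longrightarrow> t \<le> v \<Longrightarrow> v \<le> 1 \<Longrightarrow> v - u < d \<Longrightarrow> abs_continuous_on u v (\<lambda>\<tau>. snd ?c (\<gamma> \<tau>))"
    by (rule abs_continuous_curve_local[OF \<gamma> t01 Lr(1)]) blast
  show "\<exists>d>0. \<forall>u v. 0 \<le> u \<and> u \<le> t \<and> t \<le> v \<and> v \<le> 1 \<and> v - u < d \<longrightarrow> abs_continuous_on u v (\<lambda>t. \<psi> (\<gamma> t))"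
  proof (intro exI[of _ d] conjI allI impI d(1))
    fix u v assume "0 \<le> u \<and> u \<le> t \<and> t \<le> v \<and> v \<le> 1 \<and> v - u < d"
    then have uv: "0 \<le> u" "u \<le> t" "t \<le> v" "v \<le> 1" "v - u < d" by auto
    have "abs_continuous_on u v ((\<lambda>y. \<psi> (chart_inv ?c y)) \<circ> (\<lambda>\<tau>. snd ?c (\<gamma> \<tau>)))"
      by (rule abs_continuous_on_lipschitz_compose[OF d(4)[OF uv] Lr(3) d(3)[OF uv]])
    then show "abs_continuous_on u v (\<lambda>t. \<psi> (\<gamma> t))"
    proof (rule abs_continuous_on_cong)
      fix \<tau> assume "\<tau> \<in> {u..v}"
      then have "\<gamma> \<tau> \<in> fst ?c" using d(2)[OF uv] by blast
      then show "\<psi> (\<gamma> \<tau>) = ((\<lambda>y. \<psi> (chart_inv ?c y)) \<circ> (\<lambda>\<tau>. snd ?c (\<gamma> \<tau>))) \<tau>"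
        by (simp add: chart(5)[OF chart_at(1)])
    qed
  qed
qed simp

text \<open>The fundamental theorem of calculus along absolutely continuous curves.\<close>

theorem left_deriv_has_integral:
  fixes \<psi> :: "'g \<Rightarrow> 'b::euclidean_space"
  assumes \<gamma>: "abs_continuous_curve A \<gamma>" and N: "negligible N"
    and u: "\<And>t. t \<in> {0..1} - N \<Longrightarrow> left_vel \<gamma> t (u t)"
    and \<psi>: "C1_left \<psi> D" and ab: "0 \<le> a" "a \<le> b" "b \<le> 1"
  shows "((\<lambda>t. D (\<gamma> t) (u t)) has_integral \<psi> (\<gamma> b) - \<psi> (\<gamma> a)) {a..b}"
proof (rule abs_continuous_on_has_integral[OF _ ab(2) N])
  show "abs_continuous_on a b (\<lambda>t. \<psi> (\<gamma> t))"
    using C1_left_abs_continuous[OF \<gamma> \<psi>] ab abs_continuous_on_subinterval by blast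
  fix t assume t: "t \<in> {a..b} - N"
  then have t01: "t \<in> {0..1}" "t \<in> {0..1} - N" using ab by auto
  have "continuous_on {0..1} \<gamma>" using \<gamma> by (simp add: abs_continuous_curve_def)
  moreover have "left_deriv \<psi> (\<gamma> t) (D (\<gamma> t))" using \<psi> by (simp add: C1_left_def)
  ultimately have "((\<lambda>\<tau>. \<psi> (\<gamma> \<tau>)) has_vector_derivative D (\<gamma> t) (u t)) (at t within {0..1})"
    using left_deriv_along u[OF t01(2)] t01(1) by blast
  then show "((\<lambda>\<tau>. \<psi> (\<gamma> \<tau>)) has_vector_derivative D (\<gamma> t) (u t)) (at t within {a..b})"
    by (rule has_vector_derivative_within_subset) (use ab in auto)
qed

text \<open>Near a time \<open>t\<close>, the curve \<open>x \<tau> = \<phi> (iv (\<gamma> t) \<odot> \<gamma> \<tau>)\<close> in the chart is absolutely continuous, hence its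
  derivative \<open>M (x \<tau>) (u \<tau>)\<close> is absolutely integrable; applying the continuous family \<open>K (x \<tau>)\<close>
  recovers \<open>u\<close>.\<close>

theorem left_vel_absolutely_integrable:
  assumes \<gamma>: "abs_continuous_curve A \<gamma>" and N: "negligible N"
    and u: "\<And>t. t \<in> {0..1} - N \<Longrightarrow> left_vel \<gamma> t (u t)"
  shows "u absolutely_integrable_on {0..1}"
proof (rule interval_local_to_global[where a=0 and b=1])
  have \<gamma>c: "continuous_on {0..1} \<gamma>" using \<gamma> by (simp add: abs_continuous_curve_def)
  fix t :: real assume t: "0 \<le> t" "t \<le> 1"
  then have t01: "t \<in> {0..1}" by simp
  let ?c = "chart_at A (\<gamma> t)"
  define p where "p = \<gamma> t"
  define x where "x \<tau> = \<phi> (iv p \<odot> \<gamma> \<tau>)" for \<tau>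
  obtain L r where Lr: "r > 0" "cball (snd ?c (\<gamma> t)) r \<subseteq> snd ?c ` fst ?c"
      "\<And>y. y \<in> cball (snd ?c (\<gamma> t)) r \<Longrightarrow> iv (\<gamma> t) \<odot> chart_inv ?c y \<in> U0"
      "L-lipschitz_on (cball (snd ?c (\<gamma> t)) r) (\<lambda>y. \<phi> (iv (\<gamma> t) \<odot> chart_inv ?c y))"
    by (rule translated_chart_lipschitz[of "\<gamma> t"]) blast
  obtain d1 where d1: "d1 > 0"
    "\<And>u v. 0 \<le> u \<Longrightarrow> u \<le> t \<Longrightarrow> t \<le> v \<Longrightarrow> v \<le> 1 \<Longrightarrow> v - u < d1 \<Longrightarrow> \<gamma> ` {u..v} \<subseteq> fst ?c"
    "\<And>u v. 0 \<le> u \<Longrightarrow> u \<le> t \<Longrightarrow> t \<le> v \<Longrightarrow> v \<le> 1 \<Longrightarrow> v - u < d1 \<Longrightarrow> (\<lambda>\<tau>. snd ?c (\<gamma> \<tau>)) ` {u..v} \<subseteq> cball (snd ?c (\<gamma> t)) r"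
    "\<And>u v. 0 \<le> u \<Longrightarrow> u \<le> t \<Longrightarrow> t \<le> v \<Longrightarrow> v \<le> 1 \<Longrightarrow> v - u < d1 \<Longrightarrow> abs_continuous_on u v (\<lambda>\<tau>. snd ?c (\<gamma> \<tau>))"
    by (rule abs_continuous_curve_local[OF \<gamma> t01 Lr(1)]) blast
  define W where "W = (\<lambda>q. iv p \<odot> q) -` (U0 \<inter> \<phi> -` idom)"
  have "open (U0 \<inter> \<phi> -` idom)" by (rule continuous_open_preimage[OF chart(3)[OF chart_at(1)] open_U0 i_deriv(4)])
  then have W: "open W" unfolding W_def by (rule open_vimage) (intro continuous_intros)
  have tW: "\<gamma> t \<in> W" using e_in in_doms(3) by (simp add: W_def p_def)
  obtain d2 where d2: "d2 > 0" "\<And>u v. 0 \<le> u \<Longrightarrow> u \<le> t \<Longrightarrow> t \<le> v \<Longrightarrow> v \<le> 1 \<Longrightarrow> v - u < d2 \<Longrightarrow> \<gamma> ` {u..v} \<subseteq> W"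
    by (rule curve_near[OF \<gamma>c t01 W tW]) blast
  show "\<exists>d>0. \<forall>a b. 0 \<le> a \<and> a \<le> t \<and> t \<le> b \<and> b \<le> 1 \<and> b - a < d \<longrightarrow> u absolutely_integrable_on {a..b}"
  proof (intro exI[of _ "min d1 d2"] conjI allI impI)
    fix a b assume "0 \<le> a \<and> a \<le> t \<and> t \<le> b \<and> b \<le> 1 \<and> b - a < min d1 d2"
    then have ab: "0 \<le> a" "a \<le> t" "t \<le> b" "b \<le> 1" "b - a < d1" "b - a < d2" by auto
    have sub: "{a..b} \<subseteq> {0..1}" using ab by auto
    have inW: "iv p \<odot> \<gamma> \<tau> \<in> U0" "x \<tau> \<in> idom" if "\<tau> \<in> {a..b}" for \<tau>
    proof -
      have "\<gamma> \<tau> \<in> W" using d2(2)[OF ab(1-4,6)] that by blast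
      then show "iv p \<odot> \<gamma> \<tau> \<in> U0" "x \<tau> \<in> idom" by (simp_all add: W_def x_def)
    qed
    have "abs_continuous_on a b ((\<lambda>y. \<phi> (iv (\<gamma> t) \<odot> chart_inv ?c y)) \<circ> (\<lambda>\<tau>. snd ?c (\<gamma> \<tau>)))"
      by (rule abs_continuous_on_lipschitz_compose[OF d1(4)[OF ab(1-5)] Lr(4) d1(3)[OF ab(1-5)]])
    then have x_ac: "abs_continuous_on a b x"
    proof (rule abs_continuous_on_cong)
      fix \<tau> assume "\<tau> \<in> {a..b}"
      then have "\<gamma> \<tau> \<in> fst ?c" using d1(2)[OF ab(1-5)] by blast
      then show "x \<tau> = ((\<lambda>y. \<phi> (iv (\<gamma> t) \<odot> chart_inv ?c y)) \<circ> (\<lambda>\<tau>. snd ?c (\<gamma> \<tau>))) \<tau>"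
        by (simp add: chart(5)[OF chart_at(1)] x_def p_def)
    qed
    have x': "(x has_vector_derivative M (x \<tau>) (u \<tau>)) (at \<tau> within {a..b})" if \<tau>: "\<tau> \<in> {a..b} - N" for \<tau>
    proof -
      have \<tau>1: "\<tau> \<in> {0..1}" "\<tau> \<in> {0..1} - N" "\<tau> \<in> {a..b}" using \<tau> sub by auto
      have xO: "x \<tau> \<in> O0" using inW(2)[OF \<tau>1(3)] by (rule in_doms(6))
      have \<iota>x: "\<iota> (x \<tau>) = iv p \<odot> \<gamma> \<tau>" using inW(1)[OF \<tau>1(3)] by (simp add: x_def \<iota>_\<phi>)
      have "((\<lambda>y. m (x \<tau>, y)) has_derivative M (x \<tau>)) (at x0)"
        using m_snd_deriv[OF in_doms(1)[OF xO]] unfolding M_def[symmetric] .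
      then have "left_deriv (\<lambda>q. \<phi> (iv p \<odot> q)) (\<gamma> \<tau>) (M (x \<tau>))"
        unfolding left_deriv_def mul_rep_def fst_conv snd_conv \<iota>x grp.assoc .
      from left_deriv_along[OF \<gamma>c u[OF \<tau>1(2)] \<tau>1(1) this]
      have "(x has_vector_derivative M (x \<tau>) (u \<tau>)) (at \<tau> within {0..1})" unfolding x_def .
      then show ?thesis using sub by (rule has_vector_derivative_within_subset)
    qed
    have g: "(\<lambda>\<tau>. M (x \<tau>) (u \<tau>)) absolutely_integrable_on {a..b}"
      by (rule abs_continuous_on_derivative_absolutely_integrable[OF x_ac _ N x']) (use ab in auto)
    have "continuous_on {a..b} \<gamma>" using \<gamma>c sub by (rule continuous_on_subset)
    then have "continuous_on {a..b} (\<lambda>\<tau>. iv p \<odot> \<gamma> \<tau>)" by (intro continuous_intros)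
    then have xc: "continuous_on {a..b} x" unfolding x_def
      by (rule continuous_on_compose2[OF chart(3)[OF chart_at(1)]]) (use inW(1) in auto)
    have "continuous_on {a..b} (\<lambda>\<tau>. K (x \<tau>) v)" for v
      by (rule continuous_on_compose2[OF K_continuous xc]) (use inW(2) in auto)
    from absolutely_integrable_apply_linear[where A="\<lambda>\<tau>. K (x \<tau>)", OF this K_linear[OF inW(2)] g]
    have "(\<lambda>\<tau>. K (x \<tau>) (M (x \<tau>) (u \<tau>))) absolutely_integrable_on {a..b}" .
    then show "u absolutely_integrable_on {a..b}"
      by (rule absolutely_integrable_spike[OF _ negligible_empty]) (use K_M inW(2) in simp)
  qed (use d1 d2 in simp)
qed (auto intro: absolutely_integrable_on_combine)

section \<open>Operations on curves\<close>

lemma abs_continuous_curve_clamp: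
  assumes \<gamma>: "abs_continuous_curve A \<gamma>" and st: "0 \<le> s" "s \<le> t" "t \<le> 1"
  shows "abs_continuous_curve A (\<lambda>\<tau>. \<gamma> (max s (min t \<tau>)))"
  unfolding abs_continuous_curve_def
proof (intro conjI ballI allI impI)
  have \<gamma>c: "continuous_on {0..1} \<gamma>" using \<gamma> by (simp add: abs_continuous_curve_def)
  show "continuous_on {0..1} (\<lambda>\<tau>. \<gamma> (max s (min t \<tau>)))"
    by (rule continuous_on_compose2[OF \<gamma>c]) (use st in \<open>auto intro!: continuous_intros\<close>)
  fix c a b assume c: "c \<in> A" and ab: "0 \<le> a \<and> a \<le> b \<and> b \<le> 1 \<and> (\<lambda>\<tau>. \<gamma> (max s (min t \<tau>))) ` {a..b} \<subseteq> fst c"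
  define a' b' where "a' = max s (min t a)" and "b' = max s (min t b)"
  have ab': "0 \<le> a'" "a' \<le> b'" "b' \<le> 1" using ab st by (auto simp: a'_def b'_def)
  have "\<gamma> \<tau> \<in> fst c" if \<tau>: "\<tau> \<in> {a'..b'}" for \<tau>
  proof (cases "\<tau> = a' \<or> \<tau> = b'")
    case True
    then show ?thesis using ab by (auto simp: a'_def b'_def)
  next
    case False
    then have "max s (min t \<tau>) = \<tau>" "\<tau> \<in> {a..b}" using \<tau> st by (auto simp: a'_def b'_def max_def min_def split: if_splits)
    then show ?thesis using ab by (metis image_subset_iff)
  qed
  then have "abs_continuous_on a' b' (snd c \<circ> \<gamma>)"
    using \<gamma> c ab' unfolding abs_continuous_curve_def by blast
  from abs_continuous_on_clamp[OF this ab'(2), of a b]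
  show "abs_continuous_on a b (snd c \<circ> (\<lambda>\<tau>. \<gamma> (max s (min t \<tau>))))"
    by (rule abs_continuous_on_cong) (use ab st in \<open>auto simp: a'_def b'_def max_def min_def\<close>)
qed

lemma left_vel_clamp:
  assumes \<gamma>: "\<tau> \<in> {s<..<t} \<Longrightarrow> left_vel \<gamma> \<tau> u" and \<tau>: "\<tau> \<in> {0..1}" "\<tau> \<noteq> s" "\<tau> \<noteq> t" and st: "s \<le> t"
  shows "left_vel (\<lambda>\<tau>. \<gamma> (max s (min t \<tau>))) \<tau> (if \<tau> \<in> {s<..<t} then u else 0)"
proof (cases "\<tau> \<in> {s<..<t}")
  case True
  have ev: "\<forall>\<^sub>F z in at \<tau> within {0..1}. z \<in> {s<..<t}"
    unfolding eventually_at_topological by (rule exI[of _ "{s<..<t}"]) (use True in simp)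
  have "((\<lambda>z. \<phi> (iv (\<gamma> \<tau>) \<odot> \<gamma> z)) has_vector_derivative u) (at \<tau> within {0..1})"
    using \<gamma>[OF True] by (simp add: left_vel_def)
  then have "((\<lambda>z. \<phi> (iv (\<gamma> \<tau>) \<odot> \<gamma> (max s (min t z)))) has_vector_derivative u) (at \<tau> within {0..1})"
    by (rule has_vector_derivative_cong_nhds[OF _ \<tau>(1)]) (use ev True in \<open>auto elim!: eventually_mono\<close>)
  moreover have "max s (min t \<tau>) = \<tau>" using True by simp
  ultimately show ?thesis using True by (simp add: left_vel_def)
next
  case False
  define z0 where "z0 = max s (min t \<tau>)"
  have "\<exists>S. open S \<and> \<tau> \<in> S \<and> (\<forall>z\<in>S. max s (min t z) = z0)"
  proof (cases "\<tau> < s")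
    case True then show ?thesis using st by (intro exI[of _ "{..<s}"]) (auto simp: z0_def)
  next
    case F: False
    then have "\<tau> > t" using False \<tau> by auto
    then show ?thesis using st by (intro exI[of _ "{t<..}"]) (auto simp: z0_def)
  qed
  then obtain S where S: "open S" "\<tau> \<in> S" "\<And>z. z \<in> S \<Longrightarrow> max s (min t z) = z0" by blast
  have ev: "\<forall>\<^sub>F z in at \<tau> within {0..1}. z \<in> S"
    using S(1,2) by (auto simp: eventually_at_topological)
  have "((\<lambda>z. \<phi> (iv (\<gamma> z0) \<odot> \<gamma> z0)) has_vector_derivative 0) (at \<tau> within {0..1})"
    by (rule has_vector_derivative_const)
  then have "((\<lambda>z. \<phi> (iv (\<gamma> z0) \<odot> \<gamma> (max s (min t z)))) has_vector_derivative 0) (at \<tau> within {0..1})"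
  proof (rule has_vector_derivative_cong_nhds[OF _ \<tau>(1)])
    show "\<forall>\<^sub>F z in at \<tau> within {0..1}. \<phi> (iv (\<gamma> z0) \<odot> \<gamma> z0) = \<phi> (iv (\<gamma> z0) \<odot> \<gamma> (max s (min t z)))"
      using ev by eventually_elim (simp only: S(3))
  qed (simp only: S(3)[OF S(2)])
  then show ?thesis unfolding left_vel_def if_not_P[OF False] z0_def .
qed

text \<open>In charts the product is a locally Lipschitz function of the pair of the two factors.\<close>

lemma abs_continuous_curve_mul:
  assumes \<gamma>: "abs_continuous_curve A \<gamma>" and \<kappa>: "continuous_on {0..1} \<kappa>" "abs_continuous_on 0 1 \<kappa>"
    and in_O0: "\<And>t. t \<in> {0..1} \<Longrightarrow> \<kappa> t \<in> O0"
  shows "abs_continuous_curve A (\<lambda>t. \<gamma> t \<odot> \<iota> (\<kappa> t))"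
  unfolding abs_continuous_curve_def
proof (intro conjI ballI allI impI)
  have \<gamma>c: "continuous_on {0..1} \<gamma>" using \<gamma> by (simp add: abs_continuous_curve_def)
  have "continuous_on {0..1} (\<lambda>t. \<iota> (\<kappa> t))"
    by (rule continuous_on_compose2[OF chart(4)[OF chart_at(1)] \<kappa>(1)]) (use in_O0 in auto)
  with \<gamma>c show "continuous_on {0..1} (\<lambda>t. \<gamma> t \<odot> \<iota> (\<kappa> t))" by (rule continuous_on_mul)
  fix c a b assume c: "c \<in> A" and "0 \<le> a \<and> a \<le> b \<and> b \<le> 1 \<and> (\<lambda>t. \<gamma> t \<odot> \<iota> (\<kappa> t)) ` {a..b} \<subseteq> fst c"
  then have ab: "0 \<le> a" "a \<le> b" "b \<le> 1" and sub: "\<And>t. t \<in> {a..b} \<Longrightarrow> \<gamma> t \<odot> \<iota> (\<kappa> t) \<in> fst c" by auto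
  show "abs_continuous_on a b (snd c \<circ> (\<lambda>t. \<gamma> t \<odot> \<iota> (\<kappa> t)))"
  proof (rule abs_continuous_on_local_to_global[OF ab(2)])
    fix t assume t: "a \<le> t" "t \<le> b"
    then have t01: "t \<in> {0..1}" "t \<in> {a..b}" using ab by auto
    let ?c = "chart_at A (\<gamma> t)" and ?e = "chart_at A e"
    note c1 = chart_at(1)[of "\<gamma> t"] chart_at(2)[of "\<gamma> t"]
    let ?z = "(snd ?c (\<gamma> t), \<kappa> t)"
    note sm = mul_rep_smooth[OF c1(1) chart_at(1)[of e] c]
    have z: "?z \<in> mul_dom ?c ?e c"
      using c1(2) in_O0[OF t01(1)] sub[OF t01(2)] chart(5)[OF c1] by (simp add: mul_dom_def)
    have "continuous (at ?z) (\<lambda>y. deriv1 (mul_rep ?c ?e c) y v)" for v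
      using smooth_on_continuous_deriv(2)[OF sm(2)] sm(1) z by (simp add: continuous_on_eq_continuous_at)
    note cont = this
    obtain L r where Lr: "r > 0" "cball ?z r \<subseteq> mul_dom ?c ?e c" "L-lipschitz_on (cball ?z r) (mul_rep ?c ?e c)"
      by (rule locally_lipschitz_if_C1[OF sm(1) z smooth_on_deriv(1)[OF sm(2)] cont])
    obtain d1 where d1: "d1 > 0"
      "\<And>u v. 0 \<le> u \<Longrightarrow> u \<le> t \<Longrightarrow> t \<le> v \<Longrightarrow> v \<le> 1 \<Longrightarrow> v - u < d1 \<Longrightarrow> \<gamma> ` {u..v} \<subseteq> fst ?c"
      "\<And>u v. 0 \<le> u \<Longrightarrow> u \<le> t \<Longrightarrow> t \<le> v \<Longrightarrow> v \<le> 1 \<Longrightarrow> v - u < d1 \<Longrightarrow> (\<lambda>\<tau>. snd ?c (\<gamma> \<tau>)) ` {u..v} \<subseteq> cball (snd ?c (\<gamma> t)) (r / 2)"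
      "\<And>u v. 0 \<le> u \<Longrightarrow> u \<le> t \<Longrightarrow> t \<le> v \<Longrightarrow> v \<le> 1 \<Longrightarrow> v - u < d1 \<Longrightarrow> abs_continuous_on u v (\<lambda>\<tau>. snd ?c (\<gamma> \<tau>))"
      by (rule abs_continuous_curve_local[OF \<gamma> t01(1) half_gt_zero[OF Lr(1)]]) blast
    have \<kappa>_ball: "\<kappa> t \<in> ball (\<kappa> t) (r / 2)" using Lr(1) by simp
    obtain d2 where d2: "d2 > 0" "\<And>u v. 0 \<le> u \<Longrightarrow> u \<le> t \<Longrightarrow> t \<le> v \<Longrightarrow> v \<le> 1 \<Longrightarrow> v - u < d2 \<Longrightarrow> \<kappa> ` {u..v} \<subseteq> ball (\<kappa> t) (r / 2)"
      by (rule curve_near[OF \<kappa>(1) t01(1) open_ball \<kappa>_ball]) blast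
    show "\<exists>d>0. \<forall>u v. a \<le> u \<and> u \<le> t \<and> t \<le> v \<and> v \<le> b \<and> v - u < d \<longrightarrow>
        abs_continuous_on u v (snd c \<circ> (\<lambda>t. \<gamma> t \<odot> \<iota> (\<kappa> t)))"
    proof (intro exI[of _ "min d1 d2"] conjI allI impI)
      fix u v assume "a \<le> u \<and> u \<le> t \<and> t \<le> v \<and> v \<le> b \<and> v - u < min d1 d2"
      then have uv: "0 \<le> u" "u \<le> t" "t \<le> v" "v \<le> 1" "v - u < d1" "v - u < d2" using ab by auto
      have "abs_continuous_on u v \<kappa>" by (rule abs_continuous_on_subinterval[OF \<kappa>(2)]) (use uv in auto)
      from abs_continuous_on_Pair[OF d1(4)[OF uv(1-5)] this]
      have P: "abs_continuous_on u v (\<lambda>\<tau>. (snd ?c (\<gamma> \<tau>), \<kappa> \<tau>))" .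
      have "(\<lambda>\<tau>. (snd ?c (\<gamma> \<tau>), \<kappa> \<tau>)) ` {u..v} \<subseteq> cball ?z r"
      proof (clarify)
        fix \<tau> assume \<tau>: "\<tau> \<in> {u..v}"
        have "snd ?c (\<gamma> \<tau>) \<in> cball (snd ?c (\<gamma> t)) (r / 2)"
          by (rule image_subset_iff[THEN iffD1, OF d1(3)[OF uv(1-5)], rule_format, OF \<tau>])
        then have c_near: "dist (snd ?c (\<gamma> t)) (snd ?c (\<gamma> \<tau>)) \<le> r / 2" unfolding mem_cball .
        have "\<kappa> \<tau> \<in> ball (\<kappa> t) (r / 2)"
          by (rule image_subset_iff[THEN iffD1, OF d2(2)[OF uv(1-4,6)], rule_format, OF \<tau>])
        then have "dist (\<kappa> t) (\<kappa> \<tau>) \<le> r / 2" by simp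
        moreover have "dist ?z (snd ?c (\<gamma> \<tau>), \<kappa> \<tau>) \<le> dist (snd ?c (\<gamma> t)) (snd ?c (\<gamma> \<tau>)) + dist (\<kappa> t) (\<kappa> \<tau>)"
          unfolding dist_Pair_Pair by (rule sqrt_sum_squares_le_sum) auto
        ultimately show "(snd ?c (\<gamma> \<tau>), \<kappa> \<tau>) \<in> cball ?z r" using c_near unfolding mem_cball by linarith
      qed
      from abs_continuous_on_lipschitz_compose[OF P Lr(3) this]
      show "abs_continuous_on u v (snd c \<circ> (\<lambda>t. \<gamma> t \<odot> \<iota> (\<kappa> t)))"
      proof (rule abs_continuous_on_cong)
        fix \<tau> assume "\<tau> \<in> {u..v}"
        then have "\<gamma> \<tau> \<in> fst ?c" using d1(2)[OF uv(1-5)] by blast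
        then show "(snd c \<circ> (\<lambda>t. \<gamma> t \<odot> \<iota> (\<kappa> t))) \<tau> = (mul_rep ?c ?e c \<circ> (\<lambda>\<tau>. (snd ?c (\<gamma> \<tau>), \<kappa> \<tau>))) \<tau>"
          using chart(5)[OF c1(1)] by (simp add: mul_rep_def)
      qed
    qed (use d1 d2 in simp)
  qed
qed

end

section \<open>Horizontal curves and their lengths\<close>

text \<open>Composing with a linear projection onto \<open>S\<close> extends the inner product to a bilinear form on the
  whole space; the seminorm it defines is continuous, and comparable to the Euclidean norm on \<open>S\<close> by
  compactness of the unit sphere of \<open>S\<close>.\<close>

lemma inner_product_on_norm:
  fixes r :: "'a::euclidean_space \<Rightarrow> 'a \<Rightarrow> real"
  assumes S: "subspace S" and r: "inner_product_on S r"
  obtains C f where "C > 0" "continuous_on UNIV f" "\<And>v. v \<in> S \<Longrightarrow> f v = sqrt (r v v)"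
    "\<And>v. 0 \<le> f v" "\<And>v. f v \<le> C * norm v" "\<And>v. v \<in> S \<Longrightarrow> norm v \<le> C * f v"
proof -
  obtain P where P: "range P \<subseteq> S" "linear P" "\<And>v. v \<in> S \<Longrightarrow> P v = v"
    using linear_exists_left_inverse_on[of "\<lambda>x. x" S] S linear_id[unfolded id_def] by (auto simp: inj_on_def)
  have PS: "P v \<in> S" for v using P(1) by blast
  have r_sym: "r v w = r w v" if "v \<in> S" "w \<in> S" for v w
    using r that unfolding inner_product_on_def by blast
  have r_add: "r (u + v) w = r u w + r v w" if "u \<in> S" "v \<in> S" "w \<in> S" for u v w
    using r that unfolding inner_product_on_def by blast
  have r_scale: "r (a *\<^sub>R v) w = a * r v w" if "v \<in> S" "w \<in> S" for a v w
    using r that unfolding inner_product_on_def by blast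
  have r_pos: "r v v > 0" if "v \<in> S" "v \<noteq> 0" for v
    using r that unfolding inner_product_on_def by blast
  define b where "b v w = r (P v) (P w)" for v w
  have b_sym: "b v w = b w v" for v w unfolding b_def using r_sym PS by blast
  have lin: "linear (\<lambda>v. b v w)" for w
    by (rule linearI) (simp_all add: b_def linear_add[OF P(2)] linear_scale[OF P(2)] r_add r_scale PS)
  have flip: "(\<lambda>w. b w v) = b v" for v using b_sym by (intro ext)
  have lin2: "linear (b v)" for v using lin[of v] unfolding flip .
  have bil: "bilinear b" unfolding bilinear_def using lin lin2 by blast
  then have bb: "bounded_bilinear b" by (simp add: bilinear_conv_bounded_bilinear)
  have b_nonneg: "b v v \<ge> 0" for v
  proof (cases "P v = 0")
    case True
    have "r (0 *\<^sub>R P v) (P v) = 0 * r (P v) (P v)" using r_scale PS by blast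
    then show ?thesis using True by (simp add: b_def)
  next
    case False
    then show ?thesis using r_pos[OF PS] by (simp add: b_def less_imp_le)
  qed
  define f where "f v = sqrt (b v v)" for v
  have f_cont: "continuous_on UNIV f"
    unfolding f_def by (intro continuous_intros bounded_bilinear.continuous_on[OF bb])
  have f_scale: "f (a *\<^sub>R v) = \<bar>a\<bar> * f v" for a v
  proof -
    have "b (a *\<^sub>R v) (a *\<^sub>R v) = a\<^sup>2 * b v v"
      using bil by (simp add: bilinear_lmul bilinear_rmul power2_eq_square)
    then show ?thesis by (simp add: f_def real_sqrt_mult)
  qed
  obtain K where K: "K > 0" "\<And>v w. norm (b v w) \<le> norm v * norm w * K" using bounded_bilinear.pos_bounded[OF bb] by blast
  have f_le: "f v \<le> sqrt K * norm v" for v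
  proof -
    have "b v v \<le> K * (norm v)\<^sup>2" using K(2)[of v v] by (simp add: power2_eq_square mult.commute)
    then have "f v \<le> sqrt (K * (norm v)\<^sup>2)" unfolding f_def by simp
    then show ?thesis by (simp add: real_sqrt_mult)
  qed
  have f_pos: "f v > 0" if "v \<in> S" "v \<noteq> 0" for v
    using r_pos[OF that] P(3)[OF that(1)] by (simp add: f_def b_def)
  obtain c where c: "c > 0" "\<And>v. v \<in> S \<Longrightarrow> c * norm v \<le> f v"
  proof (cases "S = {0}")
    case True
    then show thesis using that[of 1] f_scale[of 0 0] by simp
  next
    case False
    then obtain w where w: "w \<in> S" "w \<noteq> 0" using subspace_0[OF S] by blast
    define Q where "Q = S \<inter> sphere 0 1"
    have "compact Q" unfolding Q_def using closed_subspace[OF S] by (simp add: closed_Int_compact)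
    moreover have "(1 / norm w) *\<^sub>R w \<in> Q" using w subspace_scale[OF S] by (simp add: Q_def)
    ultimately obtain v0 where v0: "v0 \<in> Q" "\<And>v. v \<in> Q \<Longrightarrow> f v0 \<le> f v"
      using continuous_attains_inf[of Q f] continuous_on_subset[OF f_cont] by blast
    show thesis
    proof (rule that[of "f v0"])
      show "f v0 > 0" using v0(1) by (intro f_pos) (auto simp: Q_def)
      fix v assume v: "v \<in> S"
      show "f v0 * norm v \<le> f v"
      proof (cases "v = 0")
        case False
        then have "(1 / norm v) *\<^sub>R v \<in> Q" using v subspace_scale[OF S] by (simp add: Q_def)
        then have "f v0 \<le> f ((1 / norm v) *\<^sub>R v)" by (rule v0(2))
        also have "\<dots> = f v / norm v" by (simp add: f_scale)
        finally show ?thesis using False by (simp add: field_simps)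
      qed (use f_scale[of 0 0] in simp)
    qed
  qed
  show thesis
  proof (rule that[of "max (sqrt K) (1 / c)" f])
    show "f v = sqrt (r v v)" if "v \<in> S" for v using P(3)[OF that] by (simp add: f_def b_def)
    show f0: "0 \<le> f v" for v using b_nonneg by (simp add: f_def)
    show "f v \<le> max (sqrt K) (1 / c) * norm v" for v
      using f_le[of v] mult_right_mono[of "sqrt K" "max (sqrt K) (1 / c)" "norm v"] by simp
    show "norm v \<le> max (sqrt K) (1 / c) * f v" if "v \<in> S" for v
    proof -
      have "norm v \<le> 1 / c * f v" using c(2)[OF that] c(1) by (simp add: field_simps)
      also have "\<dots> \<le> max (sqrt K) (1 / c) * f v" using f0 by (intro mult_right_mono) auto
      finally show ?thesis .
    qed
    show "max (sqrt K) (1 / c) > 0" using c(1) by (simp add: less_max_iff_disj)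
  qed (rule f_cont)
qed

lemma absolutely_integrable_continuous_compose:
  fixes u :: "real \<Rightarrow> 'a::euclidean_space" and f :: "'a \<Rightarrow> real"
  assumes u: "u absolutely_integrable_on {a..b}" and f: "continuous_on UNIV f" "\<And>v. \<bar>f v\<bar> \<le> C * norm v"
  shows "(\<lambda>t. f (u t)) absolutely_integrable_on {a..b}"
proof (rule measurable_bounded_by_integrable_imp_absolutely_integrable)
  have "u \<in> borel_measurable (lebesgue_on {a..b})" using u by (simp add: absolutely_integrable_measurable)
  then show "(\<lambda>t. f (u t)) \<in> borel_measurable (lebesgue_on {a..b})"
    using borel_measurable_continuous_onI[OF f(1)] by (rule measurable_compose)
  show "(\<lambda>t. C * norm (u t)) integrable_on {a..b}"
    using u by (intro integrable_on_mult_right) (simp add: absolutely_integrable_on_def)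
qed (use f(2) in auto)

locale sub_riemannian_two_step = two_step_group A mul e iv
  for A :: "('g::{t2_space,second_countable_topology}, 'a::euclidean_space) chart set"
    and mul :: "'g \<Rightarrow> 'g \<Rightarrow> 'g" and e :: 'g and iv :: "'g \<Rightarrow> 'g" +
  fixes \<Delta> :: "'g \<Rightarrow> 'a set" and \<rho> :: "'g \<Rightarrow> 'a \<Rightarrow> 'a \<Rightarrow> real"
  assumes sub_riemannian: "sub_riemannian_structure A mul e \<Delta> \<rho>"
begin

text \<open>The fibre of the asymptotic distribution at the identity.\<close>

definition V :: "'a set" where "V = {v \<in> \<Delta> e. \<forall>w \<in> \<Delta> e \<inter> derived_algebra. \<rho> e v w = 0}"

abbreviation \<nu> :: "'a \<Rightarrow> real" where "\<nu> u \<equiv> sqrt (\<rho> e u u)"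

lemma subspace_\<Delta>: "subspace (\<Delta> p)"
  and inner_product_\<Delta>: "inner_product_on (\<Delta> p) (\<rho> p)"
  and \<Delta>_eq: "\<Delta> p = T p ` \<Delta> e"
  and \<rho>_T: "v \<in> \<Delta> e \<Longrightarrow> w \<in> \<Delta> e \<Longrightarrow> \<rho> p (T p v) (T p w) = \<rho> e v w"
proof -
  note sr = sub_riemannian[unfolded sub_riemannian_structure_def]
  show "subspace (\<Delta> p)" by (rule sr[THEN conjunct1, rule_format])
  show "inner_product_on (\<Delta> p) (\<rho> p)"
    by (rule sr[THEN conjunct2, THEN conjunct2, THEN conjunct2, THEN conjunct1, rule_format])
  have "tangent_map A (mul p) e ` \<Delta> e = \<Delta> (p \<odot> e)"
    by (rule sr[THEN conjunct2, THEN conjunct1, rule_format])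
  then show "\<Delta> p = T p ` \<Delta> e" by (simp add: T_def)
  have "v \<in> \<Delta> e \<Longrightarrow> w \<in> \<Delta> e \<Longrightarrow>
      \<rho> (p \<odot> e) (tangent_map A (mul p) e v) (tangent_map A (mul p) e w) = \<rho> e v w"
    by (rule sr[THEN conjunct2, THEN conjunct2, THEN conjunct2, THEN conjunct2, rule_format])
  then show "v \<in> \<Delta> e \<Longrightarrow> w \<in> \<Delta> e \<Longrightarrow> \<rho> p (T p v) (T p w) = \<rho> e v w" by (simp add: T_def)
qed

lemma \<rho>_sym: "v \<in> \<Delta> e \<Longrightarrow> w \<in> \<Delta> e \<Longrightarrow> \<rho> e v w = \<rho> e w v"
  and \<rho>_add: "u \<in> \<Delta> e \<Longrightarrow> v \<in> \<Delta> e \<Longrightarrow> w \<in> \<Delta> e \<Longrightarrow> \<rho> e (u + v) w = \<rho> e u w + \<rho> e v w"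
  and \<rho>_scale: "v \<in> \<Delta> e \<Longrightarrow> w \<in> \<Delta> e \<Longrightarrow> \<rho> e (a *\<^sub>R v) w = a * \<rho> e v w"
  and \<rho>_pos: "v \<in> \<Delta> e \<Longrightarrow> v \<noteq> 0 \<Longrightarrow> \<rho> e v v > 0"
  using inner_product_\<Delta>[of e] unfolding inner_product_on_def by blast+

lemma zero_in_\<Delta>: "0 \<in> \<Delta> e" by (rule subspace_0[OF subspace_\<Delta>])

lemma \<rho>_zero: "w \<in> \<Delta> e \<Longrightarrow> \<rho> e 0 w = 0"
  using \<rho>_scale[OF zero_in_\<Delta>, of w 0] by simp

lemma V_sub: "V \<subseteq> \<Delta> e" and zero_in_V: "0 \<in> V"
  using zero_in_\<Delta> \<rho>_zero by (auto simp: V_def)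

lemma asymptotic_distribution_eq: "asymptotic_distribution A mul e \<Delta> \<rho> p = T p ` V"
  by (simp add: asymptotic_distribution_def T_def V_def)

text \<open>The exceptional set is negligible, so \<open>u\<close> may be changed there; this makes it possible to keep
  \<open>u\<close> in a given subspace at all times.\<close>

definition develops :: "(real \<Rightarrow> 'g) \<Rightarrow> (real \<Rightarrow> 'a) \<Rightarrow> bool" where
  "develops \<gamma> u \<longleftrightarrow> abs_continuous_curve A \<gamma> \<and> (\<exists>N. negligible N \<and> (\<forall>t\<in>{0..1} - N. left_vel \<gamma> t (u t)))"

lemma develops_integrable: "develops \<gamma> u \<Longrightarrow> u absolutely_integrable_on {0..1}"
  unfolding develops_def using left_vel_absolutely_integrable by blast

lemma develops_continuous: "develops \<gamma> u \<Longrightarrow> continuous_on {0..1} \<gamma>"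
  unfolding develops_def abs_continuous_curve_def by blast

lemma develops_has_integral:
  fixes \<psi> :: "'g \<Rightarrow> 'b::euclidean_space"
  assumes "develops \<gamma> u" "C1_left \<psi> D" "0 \<le> a" "a \<le> b" "b \<le> 1"
  shows "((\<lambda>t. D (\<gamma> t) (u t)) has_integral \<psi> (\<gamma> b) - \<psi> (\<gamma> a)) {a..b}"
  using assms left_deriv_has_integral unfolding develops_def by blast

lemma \<nu>_integrable:
  fixes u :: "real \<Rightarrow> 'a"
  assumes u: "u absolutely_integrable_on {a..b}" "\<And>t. u t \<in> \<Delta> e"
  shows "(\<lambda>t. \<nu> (u t)) absolutely_integrable_on {a..b}"
proof -
  obtain C f where f: "continuous_on UNIV f" "\<And>v. v \<in> \<Delta> e \<Longrightarrow> f v = \<nu> v" "\<And>v. 0 \<le> f v" "\<And>v. f v \<le> C * norm v"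
    by (rule inner_product_on_norm[OF subspace_\<Delta>[of e] inner_product_\<Delta>[of e]]) blast
  have "(\<lambda>t. f (u t)) absolutely_integrable_on {a..b}"
    by (rule absolutely_integrable_continuous_compose[OF u(1) f(1)]) (use f(3,4) in simp)
  then show ?thesis using f(2)[OF u(2)] by simp
qed

definition lengths :: "'a set \<Rightarrow> 'g \<Rightarrow> real set" where
  "lengths S p = {integral {0..1} (\<lambda>t. \<nu> (u t)) | \<gamma> u.
     develops \<gamma> u \<and> (\<forall>t. u t \<in> S) \<and> e \<in> \<gamma> ` {0..1} \<and> p \<in> \<gamma> ` {0..1}}"

lemma curve_length_eq:
  assumes \<gamma>: "develops \<gamma> u" and u: "\<And>t. u t \<in> \<Delta> e"
  shows "curve_length A \<rho> \<gamma> = integral {0..1} (\<lambda>t. \<nu> (u t))"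
proof -
  obtain N where N: "negligible N" "\<And>t. t \<in> {0..1} - N \<Longrightarrow> left_vel \<gamma> t (u t)"
    using \<gamma> unfolding develops_def by blast
  let ?f = "\<lambda>t. sqrt (\<rho> (\<gamma> t) (velocity A \<gamma> t) (velocity A \<gamma> t))"
  have eq: "?f t = \<nu> (u t)" if "t \<in> {0..1} - N" for t
    using velocity_if_left_vel(2)[OF develops_continuous[OF \<gamma>] _ N(2)[OF that]] that \<rho>_T[OF u u] by simp
  have "(\<lambda>t. \<nu> (u t)) absolutely_integrable_on {0..1}"
    by (rule \<nu>_integrable[OF develops_integrable[OF \<gamma>]]) (rule u)
  then have "?f absolutely_integrable_on {0..1}"
    by (rule absolutely_integrable_spike[OF _ N(1)]) (rule eq)
  then have "curve_length A \<rho> \<gamma> = integral {0..1} ?f"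
    unfolding curve_length_def by (rule set_lebesgue_integral_eq_integral(2))
  also have "\<dots> = integral {0..1} (\<lambda>t. \<nu> (u t))"
    by (rule integral_spike[OF N(1)]) (use eq in simp)
  finally show ?thesis .
qed

text \<open>By left invariance, horizontality and length depend on the left velocity only.\<close>

lemma sr_dist_eq_Inf_lengths:
  assumes D: "\<And>p. D p = T p ` S" and S: "S \<subseteq> \<Delta> e" "0 \<in> S"
  shows "sr_dist A D \<rho> e p = Inf (lengths S p)"
proof -
  have hor: "horizontal A D \<gamma> \<longleftrightarrow> (\<exists>u. develops \<gamma> u \<and> (\<forall>t. u t \<in> S))" for \<gamma>
  proof
    assume h: "horizontal A D \<gamma>"
    then have \<gamma>: "abs_continuous_curve A \<gamma>" "continuous_on {0..1} \<gamma>"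
      by (auto simp: horizontal_def abs_continuous_curve_def)
    have "AE t in lebesgue. t \<in> {0..1} \<longrightarrow> curve_differentiable A \<gamma> t \<and> velocity A \<gamma> t \<in> D (\<gamma> t)"
      using h by (simp add: horizontal_def)
    then obtain N where N: "{t \<in> space lebesgue. \<not> (t \<in> {0..1} \<longrightarrow> curve_differentiable A \<gamma> t \<and> velocity A \<gamma> t \<in> D (\<gamma> t))} \<subseteq> N"
        "emeasure lebesgue N = 0" "N \<in> sets lebesgue"
      by (rule AE_E)
    have N0: "N \<in> null_sets lebesgue" by (rule null_setsI[OF N(2,3)])
    have good: "curve_differentiable A \<gamma> t \<and> (\<exists>v\<in>S. velocity A \<gamma> t = T (\<gamma> t) v)" if "t \<in> {0..1} - N" for t
      using N(1) that D by fastforce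
    \<comment> \<open>On the exceptional set the value \<open>0\<close>, which belongs to \<open>S\<close>, is used.\<close>
    define u where "u t = (if t \<in> {0..1} - N then SOME v. v \<in> S \<and> velocity A \<gamma> t = T (\<gamma> t) v else 0)" for t
    have u: "u t \<in> S \<and> velocity A \<gamma> t = T (\<gamma> t) (u t)" if "t \<in> {0..1} - N" for t
    proof -
      have "\<exists>v. v \<in> S \<and> velocity A \<gamma> t = T (\<gamma> t) v" using good[OF that] by blast
      from someI_ex[OF this] show ?thesis unfolding u_def using that by (simp only: if_True)
    qed
    have uS: "u t \<in> S" for t
    proof (cases "t \<in> {0..1} - N")
      case False
      then show ?thesis using S(2) unfolding u_def by (simp only: if_False)
    qed (use u in blast)
    have "left_vel \<gamma> t (u t)" if "t \<in> {0..1} - N" for t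
      using left_vel_if_velocity[OF \<gamma>(2)] good[OF that] u[OF that] that by blast
    moreover have "negligible N" using N0 by (simp add: negligible_iff_null_sets)
    ultimately show "\<exists>u. develops \<gamma> u \<and> (\<forall>t. u t \<in> S)"
      using \<gamma>(1) uS unfolding develops_def by blast
  next
    assume "\<exists>u. develops \<gamma> u \<and> (\<forall>t. u t \<in> S)"
    then obtain u N where u: "develops \<gamma> u" "\<And>t. u t \<in> S" "negligible N" "\<And>t. t \<in> {0..1} - N \<Longrightarrow> left_vel \<gamma> t (u t)"
      unfolding develops_def by blast
    have "AE t in lebesgue. t \<in> {0..1} \<longrightarrow> curve_differentiable A \<gamma> t \<and> velocity A \<gamma> t \<in> D (\<gamma> t)"
    proof (rule AE_I')
      show "N \<in> null_sets lebesgue" using u(3) by (simp add: negligible_iff_null_sets)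
      show "{t \<in> space lebesgue. \<not> (t \<in> {0..1} \<longrightarrow> curve_differentiable A \<gamma> t \<and> velocity A \<gamma> t \<in> D (\<gamma> t))} \<subseteq> N"
      proof (clarify, rule ccontr)
        fix t :: real assume t: "t \<in> {0..1}" "t \<notin> N" and no: "\<not> (curve_differentiable A \<gamma> t \<and> velocity A \<gamma> t \<in> D (\<gamma> t))"
        have "left_vel \<gamma> t (u t)" using u(4) t by blast
        from velocity_if_left_vel[OF develops_continuous[OF u(1)] t(1) this] no u(2) D show False by blast
      qed
    qed
    then show "horizontal A D \<gamma>" using u(1) by (simp add: horizontal_def develops_def)
  qed
  have "{curve_length A \<rho> \<gamma> | \<gamma>. horizontal A D \<gamma> \<and> e \<in> \<gamma> ` {0..1} \<and> p \<in> \<gamma> ` {0..1}} = lengths S p"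
  proof (intro equalityI subsetI)
    fix l assume "l \<in> {curve_length A \<rho> \<gamma> | \<gamma>. horizontal A D \<gamma> \<and> e \<in> \<gamma> ` {0..1} \<and> p \<in> \<gamma> ` {0..1}}"
    then obtain \<gamma> u where "l = curve_length A \<rho> \<gamma>" "develops \<gamma> u" "\<And>t. u t \<in> S" "e \<in> \<gamma> ` {0..1}" "p \<in> \<gamma> ` {0..1}"
      unfolding hor by blast
    moreover from this have "l = integral {0..1} (\<lambda>t. \<nu> (u t))" using curve_length_eq S(1) by blast
    ultimately show "l \<in> lengths S p" unfolding lengths_def by blast
  next
    fix l assume "l \<in> lengths S p"
    then obtain \<gamma> u where g: "l = integral {0..1} (\<lambda>t. \<nu> (u t))" "develops \<gamma> u" "\<And>t. u t \<in> S" "e \<in> \<gamma> ` {0..1}" "p \<in> \<gamma> ` {0..1}"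
      unfolding lengths_def by blast
    then have "l = curve_length A \<rho> \<gamma>" using curve_length_eq S(1) by (metis subsetD)
    then show "l \<in> {curve_length A \<rho> \<gamma> | \<gamma>. horizontal A D \<gamma> \<and> e \<in> \<gamma> ` {0..1} \<and> p \<in> \<gamma> ` {0..1}}"
      using g hor by blast
  qed
  then show ?thesis by (simp add: sr_dist_def)
qed

lemma \<nu>_nonneg: "u \<in> \<Delta> e \<Longrightarrow> 0 \<le> \<nu> u"
  using \<rho>_pos[of u] \<rho>_zero[OF zero_in_\<Delta>] by (cases "u = 0") auto

lemma lengths_nonneg: "S \<subseteq> \<Delta> e \<Longrightarrow> l \<in> lengths S p \<Longrightarrow> 0 \<le> l"
  unfolding lengths_def using \<nu>_nonneg \<nu>_integrable[OF develops_integrable]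
  by (auto intro!: integral_nonneg simp: absolutely_integrable_on_def subset_iff)

section \<open>The growth of the primitive along horizontal curves\<close>

text \<open>Along a curve the derivative of \<open>Ad\<close> is the bracket with the left velocity, so that \<open>Ad\<close> moves away
  from the identity at most linearly in the length.\<close>

lemma Ad_along_curve:
  assumes \<gamma>: "develops \<gamma> u" and a: "a \<in> {0..1}" "\<gamma> a = e" and t: "t \<in> {0..1}"
    and C: "\<And>v w. norm (B v w) \<le> norm v * norm w * C"
  shows "norm (Ad (\<gamma> t) w - w) \<le> C * norm w * integral {0..1} (\<lambda>t. norm (u t))"
proof -
  have C1: "C1_left (\<lambda>p. Ad p w) (\<lambda>p h. B h w)" by (simp add: C1_left_def Ad_left_deriv2)
  have un: "(\<lambda>t. norm (u t)) integrable_on {0..1}"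
    using develops_integrable[OF \<gamma>] by (simp add: absolutely_integrable_on_def)
  have bnd: "norm (Ad (\<gamma> t2) w - Ad (\<gamma> t1) w) \<le> C * norm w * integral {0..1} (\<lambda>t. norm (u t))"
    if "0 \<le> t1" "t1 \<le> t2" "t2 \<le> 1" for t1 t2
  proof -
    have C0: "C * norm w * norm v \<ge> 0" for v :: 'a using C[of v w] by (metis mult.commute mult.assoc norm_ge_zero order_trans)
    have int: "((\<lambda>\<tau>. B (u \<tau>) w) has_integral Ad (\<gamma> t2) w - Ad (\<gamma> t1) w) {t1..t2}"
      using develops_has_integral[OF \<gamma> C1 that] .
    have sub: "{t1..t2} \<subseteq> {0..1}" using that by auto
    have un': "(\<lambda>t. C * norm w * norm (u t)) integrable_on {0..1}" by (rule integrable_on_mult_right[OF un])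
    have un2: "(\<lambda>t. C * norm w * norm (u t)) integrable_on {t1..t2}"
      by (rule integrable_on_subinterval[OF un' sub])
    have "norm (Ad (\<gamma> t2) w - Ad (\<gamma> t1) w) = norm (integral {t1..t2} (\<lambda>\<tau>. B (u \<tau>) w))"
      using integral_unique[OF int] by simp
    also have "\<dots> \<le> integral {t1..t2} (\<lambda>t. C * norm w * norm (u t))"
    proof (rule integral_norm_bound_integral)
      show "(\<lambda>\<tau>. B (u \<tau>) w) integrable_on {t1..t2}" using int by blast
      show "norm (B (u \<tau>) w) \<le> C * norm w * norm (u \<tau>)" for \<tau> using C[of "u \<tau>" w] by (simp add: mult_ac)
    qed (rule un2)
    also have "\<dots> \<le> integral {0..1} (\<lambda>t. C * norm w * norm (u t))"
      using sub un2 un' C0 by (intro integral_subset_le) auto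
    finally show ?thesis by simp
  qed
  show ?thesis
  proof (cases "a \<le> t")
    case True
    then show ?thesis using bnd[of a t] a t by (simp add: Ad_e)
  next
    case False
    then show ?thesis using bnd[of t a] a t by (simp add: Ad_e norm_minus_commute)
  qed
qed

text \<open>The derivative of \<open>\<psi>\<close> along the curve is \<open>u \<bullet> \<zeta> + Ad (\<gamma> t) u \<bullet> \<zeta>\<close>. The first summand contributes a term
  linear in the length; in the second one \<open>Ad (\<gamma> t)\<close> itself grows linearly, whence the square.\<close>

lemma primitive_growth:
  assumes \<psi>: "\<And>q. left_deriv \<psi> q (\<Omega> \<zeta> q)"
  obtains C where "C > 0" "\<And>p l. l \<in> lengths (\<Delta> e) p \<Longrightarrow> \<bar>\<psi> p - \<psi> e\<bar> \<le> C * (l + l\<^sup>2)"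
proof -
  have "bounded_bilinear B" using bilinear_B by (simp add: bilinear_conv_bounded_bilinear)
  then obtain CB where CB: "CB > 0" "\<And>v w. norm (B v w) \<le> norm v * norm w * CB"
    using bounded_bilinear.pos_bounded by blast
  obtain Cn f where f: "Cn > 0" "\<And>v. v \<in> \<Delta> e \<Longrightarrow> f v = \<nu> v" "\<And>v. v \<in> \<Delta> e \<Longrightarrow> norm v \<le> Cn * f v"
    by (rule inner_product_on_norm[OF subspace_\<Delta>[of e] inner_product_\<Delta>[of e]]) blast
  have "continuous_on UNIV (\<lambda>q. \<Omega> \<zeta> q v)" for v
    unfolding \<Omega>_def by (intro continuous_intros Ad_continuous)
  then have C1: "C1_left \<psi> (\<Omega> \<zeta>)" using \<psi> by (simp add: C1_left_def)
  \<comment> \<open>The summand \<open>1\<close> keeps \<open>C\<close> positive if \<open>\<zeta> = 0\<close>.\<close>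
  define C where "C = norm \<zeta> * (2 * Cn + CB * Cn\<^sup>2) + 1"
  have growth: "\<bar>\<psi> p - \<psi> e\<bar> \<le> C * (l + l\<^sup>2)" if l: "l \<in> lengths (\<Delta> e) p" for p l
  proof -
    obtain \<gamma> u a b where \<gamma>: "develops \<gamma> u" "\<And>t. u t \<in> \<Delta> e" "a \<in> {0..1}" "b \<in> {0..1}" "\<gamma> a = e" "\<gamma> b = p"
        and l_eq: "l = integral {0..1} (\<lambda>t. \<nu> (u t))"
      using l unfolding lengths_def by blast
    have l0: "l \<ge> 0" using lengths_nonneg[OF order_refl l] .
    have ui: "u absolutely_integrable_on {0..1}" by (rule develops_integrable[OF \<gamma>(1)])
    then have un: "(\<lambda>t. norm (u t)) integrable_on {0..1}" by (simp add: absolutely_integrable_on_def)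
    define L where "L = integral {0..1} (\<lambda>t. norm (u t))"
    have L0: "L \<ge> 0" unfolding L_def by (rule integral_nonneg[OF un]) simp
    have Ll: "L \<le> Cn * l"
    proof -
      have "(\<lambda>t. \<nu> (u t)) integrable_on {0..1}"
        using \<nu>_integrable[OF ui \<gamma>(2)] by (simp add: absolutely_integrable_on_def)
      then have "L \<le> integral {0..1} (\<lambda>t. Cn * \<nu> (u t))"
        unfolding L_def using f(2,3) \<gamma>(2) by (intro integral_le un integrable_on_mult_right) fastforce+
      then show ?thesis by (simp add: l_eq)
    qed
    define k where "k = norm \<zeta> * (2 + CB * L)"
    have k0: "k \<ge> 0" using CB(1) L0 by (simp add: k_def)
    have pt: "norm (\<Omega> \<zeta> (\<gamma> t) (u t)) \<le> k * norm (u t)" if t: "t \<in> {0..1}" for t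
    proof -
      have "norm (Ad (\<gamma> t) (u t)) \<le> norm (u t) + norm (Ad (\<gamma> t) (u t) - u t)" by (rule norm_triangle_sub)
      also have "\<dots> \<le> norm (u t) + CB * norm (u t) * L"
        using Ad_along_curve[OF \<gamma>(1,3,5) t CB(2), of "u t"] by (simp add: L_def)
      finally have 1: "norm (Ad (\<gamma> t) (u t)) \<le> norm (u t) * (1 + CB * L)" by (simp add: algebra_simps)
      have "norm (\<Omega> \<zeta> (\<gamma> t) (u t)) \<le> norm (u t) * norm \<zeta> + norm (Ad (\<gamma> t) (u t)) * norm \<zeta>"
        unfolding \<Omega>_def real_norm_def
        using Cauchy_Schwarz_ineq2[of "u t" \<zeta>] Cauchy_Schwarz_ineq2[of "Ad (\<gamma> t) (u t)" \<zeta>] by linarith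
      also have "\<dots> \<le> norm (u t) * norm \<zeta> + norm (u t) * (1 + CB * L) * norm \<zeta>"
        using 1 by (intro add_mono mult_right_mono) auto
      also have "\<dots> = k * norm (u t)" by (simp add: k_def algebra_simps)
      finally show ?thesis .
    qed
    have bnd: "\<bar>\<psi> (\<gamma> t2) - \<psi> (\<gamma> t1)\<bar> \<le> k * L" if "0 \<le> t1" "t1 \<le> t2" "t2 \<le> 1" for t1 t2
    proof -
      have int: "((\<lambda>\<tau>. \<Omega> \<zeta> (\<gamma> \<tau>) (u \<tau>)) has_integral \<psi> (\<gamma> t2) - \<psi> (\<gamma> t1)) {t1..t2}"
        using develops_has_integral[OF \<gamma>(1) C1 that] .
      have sub: "{t1..t2} \<subseteq> {0..1}" using that by auto
      have un': "(\<lambda>t. k * norm (u t)) integrable_on {0..1}" by (rule integrable_on_mult_right[OF un])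
      have un2: "(\<lambda>t. k * norm (u t)) integrable_on {t1..t2}" by (rule integrable_on_subinterval[OF un' sub])
      have "norm (\<psi> (\<gamma> t2) - \<psi> (\<gamma> t1)) = norm (integral {t1..t2} (\<lambda>\<tau>. \<Omega> \<zeta> (\<gamma> \<tau>) (u \<tau>)))"
        using integral_unique[OF int] by simp
      also have "\<dots> \<le> integral {t1..t2} (\<lambda>t. k * norm (u t))"
        by (rule integral_norm_bound_integral[OF has_integral_integrable[OF int] un2]) (use pt sub in auto)
      also have "\<dots> \<le> integral {0..1} (\<lambda>t. k * norm (u t))"
        using sub un2 un' k0 by (intro integral_subset_le) auto
      finally show ?thesis by (simp add: L_def)
    qed
    have "\<bar>\<psi> p - \<psi> e\<bar> \<le> k * L"
    proof (cases "a \<le> b")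
      case True then show ?thesis using bnd[of a b] \<gamma>(3-6) by simp
    next
      case False then show ?thesis using bnd[of b a] \<gamma>(3-6) by (simp add: abs_minus_commute)
    qed
    also have "\<dots> = norm \<zeta> * (2 * L + CB * L\<^sup>2)" by (simp add: k_def power2_eq_square algebra_simps)
    also have "\<dots> \<le> norm \<zeta> * (2 * (Cn * l) + CB * (Cn * l)\<^sup>2)"
      using Ll L0 CB(1) by (intro mult_left_mono add_mono power_mono) auto
    also have "\<dots> = norm \<zeta> * (2 * Cn) * l + norm \<zeta> * (CB * Cn\<^sup>2) * l\<^sup>2"
      by (simp add: power_mult_distrib algebra_simps)
    also have "\<dots> \<le> C * l + C * l\<^sup>2"
      using l0 f(1) CB(1) unfolding C_def
      by (intro add_mono mult_right_mono) (auto simp: algebra_simps add_nonneg_nonneg)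
    finally show ?thesis by (simp add: algebra_simps)
  qed
  have "C > 0" unfolding C_def using CB(1) f(1) by (intro add_nonneg_pos mult_nonneg_nonneg) auto
  with growth that show thesis by blast
qed

section \<open>Central one-parameter curves\<close>

text \<open>A piece of the one-parameter subgroup of \<open>\<zeta>\<close>. Short times suffice, because the points far away will
  be powers of a single element.\<close>

lemma short_integral_curve:
  obtains \<epsilon> \<delta> L where "\<delta> > 0" "\<epsilon> 0 = x0" "\<And>s. s \<in> {-\<delta>..\<delta>} \<Longrightarrow> \<epsilon> s \<in> idom"
    "L-lipschitz_on {-\<delta>..\<delta>} \<epsilon>"
    "\<And>s. s \<in> {-\<delta><..<\<delta>} \<Longrightarrow> (\<epsilon> has_vector_derivative M (\<epsilon> s) \<zeta>) (at s)"
proof -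
  have sub: "idom \<subseteq> O0" using in_doms(6) by blast
  have f': "((\<lambda>x. M x \<zeta>) has_derivative (\<lambda>h. M' x h \<zeta>)) (at x)" if "x \<in> idom" for x
    by (rule M_deriv[OF in_doms(6)[OF that]])
  have "continuous_on idom (\<lambda>x. M' x h \<zeta>)" for h
    unfolding M'_def
    by (rule continuous_on_compose2[OF m_deriv(5)]) (use in_doms(1,6) in \<open>auto intro!: continuous_intros\<close>)
  then have cont: "continuous (at x0) (\<lambda>x. M' x h \<zeta>)" for h
    using i_deriv(4) in_doms(3) by (simp add: continuous_on_eq_continuous_at)
  obtain L r where Lr: "r > 0" "cball x0 r \<subseteq> idom" "L-lipschitz_on (cball x0 r) (\<lambda>x. M x \<zeta>)"
    by (rule locally_lipschitz_if_C1[OF i_deriv(4) in_doms(3) f' cont])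
  obtain \<epsilon> \<delta> where e: "\<delta> > 0" "\<epsilon> 0 = x0" "\<And>s. s \<in> {-\<delta>..\<delta>} \<Longrightarrow> \<epsilon> s \<in> cball x0 r"
      "\<And>s. s \<in> {-\<delta>..\<delta>} \<Longrightarrow> (\<epsilon> has_vector_derivative M (\<epsilon> s) \<zeta>) (at s within {-\<delta>..\<delta>})"
    by (rule local_integral_curve[OF Lr(3,1)]) blast
  have cont\<epsilon>: "continuous_on {-\<delta>..\<delta>} \<epsilon>"
    using e(4) has_vector_derivative_continuous continuous_on_eq_continuous_within by blast
  have "continuous_on (cball x0 r) (\<lambda>x. M x \<zeta>)" by (rule lipschitz_on_continuous_on[OF Lr(3)])
  then have "continuous_on {-\<delta>..\<delta>} (\<lambda>s. M (\<epsilon> s) \<zeta>)"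
    by (rule continuous_on_compose2[OF _ cont\<epsilon>]) (use e(3) in auto)
  then have "bounded ((\<lambda>s. M (\<epsilon> s) \<zeta>) ` {-\<delta>..\<delta>})"
    by (intro compact_imp_bounded compact_continuous_image compact_Icc)
  then obtain C where C: "C > 0" "\<And>s. s \<in> {-\<delta>..\<delta>} \<Longrightarrow> norm (M (\<epsilon> s) \<zeta>) \<le> C"
    unfolding bounded_pos by auto
  have lip: "C-lipschitz_on {-\<delta>..\<delta>} \<epsilon>"
  proof (rule lipschitz_onI)
    fix s t assume st: "s \<in> {-\<delta>..\<delta>}" "t \<in> {-\<delta>..\<delta>}"
    have "norm (\<epsilon> s - \<epsilon> t) \<le> C * norm (s - t)"
    proof (rule differentiable_bound[OF _ _ _ st])
      show "(\<epsilon> has_derivative (\<lambda>h. h *\<^sub>R M (\<epsilon> u) \<zeta>)) (at u within {-\<delta>..\<delta>})" if "u \<in> {-\<delta>..\<delta>}" for u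
        using e(4)[OF that] by (simp add: has_vector_derivative_def)
      show "onorm (\<lambda>h. h *\<^sub>R M (\<epsilon> u) \<zeta>) \<le> C" if "u \<in> {-\<delta>..\<delta>}" for u
        using C(1) C(2)[OF that] by (intro onorm_bound) (auto simp: mult.commute[of C] intro!: mult_left_mono)
    qed simp
    then show "dist (\<epsilon> s) (\<epsilon> t) \<le> C * dist s t" by (simp add: dist_norm)
  qed (use C(1) in simp)
  show thesis
  proof (rule that[OF e(1,2) _ lip])
    show "\<epsilon> s \<in> idom" if "s \<in> {-\<delta>..\<delta>}" for s using e(3)[OF that] Lr(2) by blast
    fix s assume s: "s \<in> {-\<delta><..<\<delta>}"
    then have "s \<in> interior {-\<delta>..\<delta>}" by simp
    from at_within_interior[OF this] show "(\<epsilon> has_vector_derivative M (\<epsilon> s) \<zeta>) (at s)"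
      using e(4)[of s] s by auto
  qed
qed

text \<open>The adjoint action of the points \<open>\<iota> (\<epsilon> s)\<close> is trivial, so that by \<open>left_vel_mul\<close> the left velocities
  of the two factors add up.\<close>

lemma develops_mul_central:
  assumes \<gamma>: "develops \<gamma> u"
    and \<epsilon>: "\<And>s. s \<in> {-\<delta>..\<delta>} \<Longrightarrow> \<epsilon> s \<in> idom" "L-lipschitz_on {-\<delta>..\<delta>} \<epsilon>"
      "\<And>s. s \<in> {-\<delta><..<\<delta>} \<Longrightarrow> (\<epsilon> has_vector_derivative M (\<epsilon> s) \<zeta>) (at s)"
    and Ad_id: "\<And>s v. s \<in> {-\<delta><..<\<delta>} \<Longrightarrow> Ad (\<iota> (\<epsilon> s)) v = v"
    and \<theta>: "continuous_on {0..1} \<theta>" "abs_continuous_on 0 1 \<theta>" "\<And>t. t \<in> {0..1} \<Longrightarrow> \<theta> t \<in> {-\<delta><..<\<delta>}"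
    and N: "negligible N" "\<And>t. t \<in> {0..1} - N \<Longrightarrow> (\<theta> has_vector_derivative \<theta>' t) (at t within {0..1})"
  shows "develops (\<lambda>t. \<gamma> t \<odot> \<iota> (\<epsilon> (\<theta> t))) (\<lambda>t. u t + \<theta>' t *\<^sub>R \<zeta>)"
proof -
  have \<theta>_in: "\<theta> ` {0..1} \<subseteq> {-\<delta>..\<delta>}" using \<theta>(3) by force
  have c: "continuous_on {0..1} (\<lambda>t. \<epsilon> (\<theta> t))"
    by (rule continuous_on_compose2[OF lipschitz_on_continuous_on[OF \<epsilon>(2)] \<theta>(1) \<theta>_in])
  have ac: "abs_continuous_on 0 1 (\<lambda>t. \<epsilon> (\<theta> t))"
    using abs_continuous_on_lipschitz_compose[OF \<theta>(2) \<epsilon>(2) \<theta>_in] by (simp add: o_def)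
  have dom: "\<epsilon> (\<theta> t) \<in> idom" if "t \<in> {0..1}" for t using \<epsilon>(1) \<theta>_in that by blast
  have AC: "abs_continuous_curve A (\<lambda>t. \<gamma> t \<odot> \<iota> (\<epsilon> (\<theta> t)))"
    by (rule abs_continuous_curve_mul[OF _ c ac]) (use \<gamma> dom in_doms(6) in \<open>auto simp: develops_def\<close>)
  have \<eta>c: "continuous_on {0..1} (\<lambda>t. \<iota> (\<epsilon> (\<theta> t)))"
    by (rule continuous_on_compose2[OF chart(4)[OF chart_at(1)] c]) (use dom in_doms(6) in blast)
  have \<eta>: "left_vel (\<lambda>t. \<iota> (\<epsilon> (\<theta> t))) t (\<theta>' t *\<^sub>R \<zeta>)" if t: "t \<in> {0..1} - N" for t
  proof -
    have t01: "t \<in> {0..1}" using t by blast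
    note d = dom[OF t01]
    have "(\<epsilon> has_derivative (\<lambda>h. h *\<^sub>R M (\<epsilon> (\<theta> t)) \<zeta>)) (at (\<theta> t))"
      using \<epsilon>(3)[OF \<theta>(3)[OF t01]] by (simp add: has_vector_derivative_def)
    from has_vector_derivative_compose_deriv[OF N(2)[OF t] this]
    have "((\<lambda>\<tau>. \<epsilon> (\<theta> \<tau>)) has_vector_derivative \<theta>' t *\<^sub>R M (\<epsilon> (\<theta> t)) \<zeta>) (at t within {0..1})" .
    from has_vector_derivative_compose_deriv[OF this n_deriv[OF d]]
    have D: "((\<lambda>\<tau>. n (\<epsilon> (\<theta> t)) (\<epsilon> (\<theta> \<tau>))) has_vector_derivative \<theta>' t *\<^sub>R \<zeta>) (at t within {0..1})"
      by (simp add: linear_scale[OF K_linear[OF d]] K_M[OF d])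
    have eq: "n (\<epsilon> (\<theta> t)) (\<epsilon> (\<theta> \<tau>)) = \<phi> (iv (\<iota> (\<epsilon> (\<theta> t))) \<odot> \<iota> (\<epsilon> (\<theta> \<tau>)))" for \<tau>
      by (simp add: n_def mul_rep_def \<iota>_i[OF d])
    show ?thesis unfolding left_vel_def using D unfolding eq .
  qed
  obtain N1 where N1: "negligible N1" "\<And>t. t \<in> {0..1} - N1 \<Longrightarrow> left_vel \<gamma> t (u t)"
    using \<gamma> unfolding develops_def by blast
  have "left_vel (\<lambda>t. \<gamma> t \<odot> \<iota> (\<epsilon> (\<theta> t))) t (u t + \<theta>' t *\<^sub>R \<zeta>)" if t: "t \<in> {0..1} - (N \<union> N1)" for t
  proof -
    have t': "t \<in> {0..1}" "t \<in> {0..1} - N" "t \<in> {0..1} - N1" using t by auto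
    have "Ad (iv (\<iota> (\<epsilon> (\<theta> t)))) (u t) = u t"
    proof -
      have "Ad (iv (\<iota> (\<epsilon> (\<theta> t)))) (Ad (\<iota> (\<epsilon> (\<theta> t))) (u t)) = u t"
        unfolding Ad_mul[symmetric] mul_cancel(7) Ad_e ..
      then show ?thesis unfolding Ad_id[OF \<theta>(3)[OF t'(1)]] .
    qed
    then show ?thesis
      using left_vel_mul[OF develops_continuous[OF \<gamma>] N1(2)[OF t'(3)] \<eta>c \<eta>[OF t'(2)] t'(1)] by simp
  qed
  then show ?thesis using AC negligible_Un[OF N(1) N1(1)] unfolding develops_def by blast
qed

lemma develops_clamp:
  assumes \<gamma>: "develops \<gamma> u" and st: "0 \<le> s" "s \<le> t" "t \<le> 1"
  shows "develops (\<lambda>\<tau>. \<gamma> (max s (min t \<tau>))) (\<lambda>\<tau>. if \<tau> \<in> {s<..<t} then u \<tau> else 0)"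
proof -
  obtain N where N: "negligible N" "\<And>t. t \<in> {0..1} - N \<Longrightarrow> left_vel \<gamma> t (u t)"
    using \<gamma> unfolding develops_def by blast
  have "left_vel (\<lambda>\<tau>. \<gamma> (max s (min t \<tau>))) \<tau> (if \<tau> \<in> {s<..<t} then u \<tau> else 0)"
    if "\<tau> \<in> {0..1} - (N \<union> {s, t})" for \<tau>
    by (rule left_vel_clamp) (use N(2)[of \<tau>] that st in auto)
  moreover have "negligible (N \<union> {s, t})" using N(1) by (intro negligible_Un) auto
  moreover have "abs_continuous_curve A \<gamma>" using \<gamma> by (simp add: develops_def)
  ultimately show ?thesis unfolding develops_def using abs_continuous_curve_clamp[OF _ st] by blast
qed

text \<open>The distance is defined by curves that pass through the two points at some times \<open>a\<close> and \<open>b\<close>, in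
  either order. Freezing the curve outside the interval between them does not make it longer.\<close>

lemma lengths_restrict:
  assumes l: "l \<in> lengths S p" and S: "S \<subseteq> \<Delta> e" "0 \<in> S"
  obtains \<gamma> u a b where "develops \<gamma> u" "\<And>t. u t \<in> S" "a \<in> {0..1}" "b \<in> {0..1}" "\<gamma> a = e" "\<gamma> b = p"
    "\<And>t. t \<notin> {min a b..max a b} \<Longrightarrow> u t = 0" "integral {0..1} (\<lambda>t. \<nu> (u t)) \<le> l"
proof -
  obtain \<gamma> u a b where \<gamma>: "develops \<gamma> u" "\<And>t. u t \<in> S" "a \<in> {0..1}" "b \<in> {0..1}" "\<gamma> a = e" "\<gamma> b = p"
      and l_eq: "l = integral {0..1} (\<lambda>t. \<nu> (u t))"
    using l unfolding lengths_def by blast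
  define s t where "s = min a b" and "t = max a b"
  have st: "0 \<le> s" "s \<le> t" "t \<le> 1" using \<gamma>(3,4) by (auto simp: s_def t_def)
  define u1 where "u1 \<tau> = (if \<tau> \<in> {s<..<t} then u \<tau> else 0)" for \<tau>
  have d1: "develops (\<lambda>\<tau>. \<gamma> (max s (min t \<tau>))) u1"
    unfolding u1_def by (rule develops_clamp[OF \<gamma>(1) st])
  have int: "(\<lambda>t. \<nu> (v t)) integrable_on {0..1}" if "develops \<eta> v" "\<And>t. v t \<in> S" for \<eta> v
    using \<nu>_integrable[OF develops_integrable[OF that(1)]] that(2) S(1)
    by (auto simp: absolutely_integrable_on_def subset_iff)
  have u1S: "u1 t \<in> S" for t using \<gamma>(2) S(2) by (simp add: u1_def)
  show thesis
  proof (rule that[OF d1 u1S \<gamma>(3,4)])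
    show "\<gamma> (max s (min t a)) = e" "\<gamma> (max s (min t b)) = p" using \<gamma>(5,6) by (auto simp: s_def t_def max_def min_def)
    show "u1 \<tau> = 0" if "\<tau> \<notin> {min a b..max a b}" for \<tau> using that by (auto simp: u1_def s_def t_def)
    show "integral {0..1} (\<lambda>t. \<nu> (u1 t)) \<le> l"
      unfolding l_eq
    proof (rule integral_le[OF int[OF d1 u1S] int[OF \<gamma>(1,2)]])
      fix \<tau> :: real
      have "0 \<le> \<nu> (u \<tau>)" using \<nu>_nonneg \<gamma>(2) S(1) by blast
      then show "\<nu> (u1 \<tau>) \<le> \<nu> (u \<tau>)" using \<rho>_zero[OF zero_in_\<Delta>] by (simp add: u1_def)
    qed
  qed
qed

text \<open>Spread the central displacement along the curve proportionally to arc length. As the central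
  component of the velocity is orthogonal to \<open>V\<close>, the new length is the hypotenuse.\<close>

lemma lengths_mul_central:
  assumes \<epsilon>: "\<epsilon> 0 = x0" "\<And>s. s \<in> {-\<delta>..\<delta>} \<Longrightarrow> \<epsilon> s \<in> idom" "L-lipschitz_on {-\<delta>..\<delta>} \<epsilon>"
      "\<And>s. s \<in> {-\<delta><..<\<delta>} \<Longrightarrow> (\<epsilon> has_vector_derivative M (\<epsilon> s) \<zeta>) (at s)"
    and Ad_id: "\<And>s v. s \<in> {-\<delta><..<\<delta>} \<Longrightarrow> Ad (\<iota> (\<epsilon> s)) v = v"
    and \<zeta>: "\<zeta> \<in> \<Delta> e \<inter> derived_algebra" and t: "0 < t" "t < \<delta>"
    and l: "l \<in> lengths V p" and pos: "\<And>l. l \<in> lengths V p \<Longrightarrow> l \<noteq> 0"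
  shows "\<exists>l'\<in>lengths (\<Delta> e) (p \<odot> \<iota> (\<epsilon> t)). l'\<^sup>2 \<le> l\<^sup>2 + t\<^sup>2 * \<rho> e \<zeta> \<zeta>"
proof -
  obtain \<gamma> u a b where \<gamma>: "develops \<gamma> u" "\<And>t. u t \<in> V" "a \<in> {0..1}" "b \<in> {0..1}" "\<gamma> a = e" "\<gamma> b = p"
      and supp: "\<And>t. t \<notin> {min a b..max a b} \<Longrightarrow> u t = 0" and le: "integral {0..1} (\<lambda>t. \<nu> (u t)) \<le> l"
    by (rule lengths_restrict[OF l V_sub zero_in_V]) blast
  define w where "w \<tau> = \<nu> (u \<tau>)" for \<tau>
  have u\<Delta>: "u \<tau> \<in> \<Delta> e" for \<tau> using \<gamma>(2) V_sub by blast
  have w0: "0 \<le> w \<tau>" for \<tau> unfolding w_def using u\<Delta> by (rule \<nu>_nonneg)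
  have w_int: "w integrable_on {0..1}"
    unfolding w_def using \<nu>_integrable[OF develops_integrable[OF \<gamma>(1)] u\<Delta>] by (simp add: absolutely_integrable_on_def)
  have w_int': "w integrable_on {c..d}" if "0 \<le> c" "d \<le> 1" for c d
    by (rule integrable_on_subinterval[OF w_int]) (use that in auto)
  define l1 where "l1 = integral {0..1} w"
  have "l1 \<in> lengths V p" unfolding lengths_def l1_def w_def using \<gamma> by blast
  then have "l1 \<noteq> 0" "l1 \<ge> 0" using pos lengths_nonneg[OF V_sub] by blast+
  moreover have "l1 \<le> l" using le unfolding l1_def w_def[abs_def] .
  ultimately have l1: "l1 > 0" "l1 \<le> l" by auto
  define \<sigma> where "\<sigma> \<tau> = integral {0..\<tau>} w" for \<tau>
  have \<sigma>_diff: "\<sigma> d - \<sigma> c = integral {c..d} w" if "0 \<le> c" "c \<le> d" "d \<le> 1" for c d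
    using Henstock_Kurzweil_Integration.integral_combine[OF that(1,2) w_int'[of 0 d]] that by (simp add: \<sigma>_def)
  have \<sigma>_mono: "\<sigma> c \<le> \<sigma> d" if "0 \<le> c" "c \<le> d" "d \<le> 1" for c d
    using \<sigma>_diff[OF that] integral_nonneg[OF w_int'[of c d]] w0 that by simp
  have zero: "integral {c..d} w = 0" if "\<And>\<tau>. c < \<tau> \<Longrightarrow> \<tau> < d \<Longrightarrow> \<tau> \<notin> {min a b..max a b}" for c d
  proof -
    have "integral {c..d} w = integral {c..d} (\<lambda>_. 0)"
    proof (rule integral_spike[of "{c, d}"])
      fix \<tau> assume "\<tau> \<in> {c..d} - {c, d}"
      then have "u \<tau> = 0" using that[of \<tau>] supp by auto
      then show "0 = w \<tau>" using \<rho>_zero[OF zero_in_\<Delta>] by (simp add: w_def)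
    qed simp
    then show ?thesis by simp
  qed
  have \<sigma>_lo: "\<sigma> \<tau> = 0" if "0 \<le> \<tau>" "\<tau> \<le> min a b" for \<tau>
    unfolding \<sigma>_def by (rule zero) (use that in auto)
  have \<sigma>_hi: "\<sigma> \<tau> = l1" if "max a b \<le> \<tau>" "\<tau> \<le> 1" for \<tau>
  proof -
    have "integral {\<tau>..1} w = 0" by (rule zero) (use that in auto)
    moreover have "0 \<le> \<tau>" using that \<gamma>(3) by auto
    ultimately show ?thesis using \<sigma>_diff[of \<tau> 1] that by (simp add: l1_def \<sigma>_def)
  qed
  \<comment> \<open>\<open>\<sigma>\<close> is the arc length. Its increment \<open>D\<close> is negative if the curve meets \<open>p\<close> before \<open>e\<close>.\<close>
  define D where "D = \<sigma> b - \<sigma> a"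
  have D: "\<bar>D\<bar> = l1" "D \<noteq> 0"
  proof -
    show "\<bar>D\<bar> = l1"
    proof (cases "a \<le> b")
      case True
      then show ?thesis using \<sigma>_lo[of a] \<sigma>_hi[of b] \<gamma>(3,4) l1(1) by (simp add: D_def)
    next
      case False
      then show ?thesis using \<sigma>_lo[of b] \<sigma>_hi[of a] \<gamma>(3,4) l1(1) by (simp add: D_def)
    qed
    then show "D \<noteq> 0" using l1(1) by auto
  qed
  define k where "k = t / D"
  define \<theta> where "\<theta> \<tau> = k * (\<sigma> \<tau> - \<sigma> a)" for \<tau>
  have \<theta>_ab: "\<theta> a = 0" "\<theta> b = t" using D(2) by (auto simp: \<theta>_def k_def D_def[symmetric])
  have \<theta>_in: "\<theta> \<tau> \<in> {-\<delta><..<\<delta>}" if \<tau>: "\<tau> \<in> {0..1}" for \<tau>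
  proof -
    have s: "0 \<le> \<sigma> c \<and> \<sigma> c \<le> l1" if "c \<in> {0..1}" for c
      using \<sigma>_mono[of 0 c] \<sigma>_mono[of c 1] that by (auto simp: \<sigma>_def l1_def)
    have "\<bar>\<sigma> \<tau> - \<sigma> a\<bar> \<le> l1" using s[OF \<tau>] s[OF \<gamma>(3)] by (simp add: abs_le_iff)
    then have "\<bar>\<theta> \<tau>\<bar> \<le> \<bar>k\<bar> * l1" unfolding \<theta>_def abs_mult by (rule mult_left_mono) simp
    also have "\<dots> = t" using D t(1) l1(1) by (simp add: k_def)
    finally show ?thesis using t(2) by (simp add: abs_le_iff)
  qed
  have \<sigma>_ac: "abs_continuous_on 0 1 \<sigma>"
    unfolding \<sigma>_def by (rule abs_continuous_on_indefinite_integral[OF w_int w0])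
  have \<theta>_ac: "abs_continuous_on 0 1 \<theta>"
    by (rule abs_continuous_on_dominated[OF \<sigma>_ac, where C="\<bar>k\<bar>"])
      (simp add: \<theta>_def right_diff_distrib[symmetric] abs_mult)
  have "continuous_on {0..1} \<sigma>" unfolding \<sigma>_def by (rule indefinite_integral_continuous_1[OF w_int])
  then have \<theta>_c: "continuous_on {0..1} \<theta>" unfolding \<theta>_def by (intro continuous_intros)
  obtain N where N: "negligible N" "\<And>\<tau>. \<tau> \<in> {0..1} - N \<Longrightarrow> (\<sigma> has_vector_derivative w \<tau>) (at \<tau> within {0..1})"
    using has_vector_derivative_indefinite_integral_AE[OF w_int] unfolding \<sigma>_def by blast
  have \<theta>': "(\<theta> has_vector_derivative k * w \<tau>) (at \<tau> within {0..1})" if "\<tau> \<in> {0..1} - N" for \<tau>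
    unfolding \<theta>_def using N(2)[OF that] by (auto intro!: derivative_eq_intros simp: has_real_derivative_iff_has_vector_derivative[symmetric])
  have dev: "develops (\<lambda>\<tau>. \<gamma> \<tau> \<odot> \<iota> (\<epsilon> (\<theta> \<tau>))) (\<lambda>\<tau>. u \<tau> + (k * w \<tau>) *\<^sub>R \<zeta>)"
    by (rule develops_mul_central[OF \<gamma>(1) \<epsilon>(2-4) Ad_id \<theta>_c \<theta>_ac \<theta>_in N(1) \<theta>'])
  have \<zeta>\<Delta>: "\<zeta> \<in> \<Delta> e" using \<zeta> by blast
  have scale\<Delta>: "c *\<^sub>R \<zeta> \<in> \<Delta> e" for c by (rule subspace_scale[OF subspace_\<Delta> \<zeta>\<Delta>])
  have in\<Delta>: "u \<tau> + (k * w \<tau>) *\<^sub>R \<zeta> \<in> \<Delta> e" for \<tau>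
    by (rule subspace_add[OF subspace_\<Delta> u\<Delta> scale\<Delta>])
  define c where "c = sqrt (1 + k\<^sup>2 * \<rho> e \<zeta> \<zeta>)"
  have \<zeta>0: "0 \<le> \<rho> e \<zeta> \<zeta>" using \<nu>_nonneg[OF \<zeta>\<Delta>] by simp
  have \<nu>_eq: "\<nu> (u \<tau> + (k * w \<tau>) *\<^sub>R \<zeta>) = c * w \<tau>" for \<tau>
  proof -
    let ?s = "k * w \<tau>"
    have orth: "\<rho> e (u \<tau>) \<zeta> = 0" using \<gamma>(2)[of \<tau>] \<zeta> by (simp add: V_def)
    have "\<rho> e (u \<tau> + ?s *\<^sub>R \<zeta>) (u \<tau> + ?s *\<^sub>R \<zeta>)
        = \<rho> e (u \<tau>) (u \<tau> + ?s *\<^sub>R \<zeta>) + ?s * \<rho> e \<zeta> (u \<tau> + ?s *\<^sub>R \<zeta>)"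
      using \<rho>_add[OF u\<Delta> scale\<Delta> in\<Delta>] \<rho>_scale[OF \<zeta>\<Delta> in\<Delta>] by simp
    also have "\<rho> e (u \<tau>) (u \<tau> + ?s *\<^sub>R \<zeta>) = \<rho> e (u \<tau>) (u \<tau>)"
      using \<rho>_sym[OF u\<Delta> in\<Delta>] \<rho>_add[OF u\<Delta> scale\<Delta> u\<Delta>] \<rho>_scale[OF \<zeta>\<Delta> u\<Delta>] \<rho>_sym[OF \<zeta>\<Delta> u\<Delta>] orth by simp
    also have "\<rho> e \<zeta> (u \<tau> + ?s *\<^sub>R \<zeta>) = ?s * \<rho> e \<zeta> \<zeta>"
      using \<rho>_sym[OF \<zeta>\<Delta> in\<Delta>] \<rho>_add[OF u\<Delta> scale\<Delta> \<zeta>\<Delta>] \<rho>_scale[OF \<zeta>\<Delta> \<zeta>\<Delta>] orth by simp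
    also have "\<rho> e (u \<tau>) (u \<tau>) = (w \<tau>)\<^sup>2"
      using \<nu>_nonneg[OF u\<Delta>] by (simp add: w_def)
    finally have "\<rho> e (u \<tau> + ?s *\<^sub>R \<zeta>) (u \<tau> + ?s *\<^sub>R \<zeta>) = (1 + k\<^sup>2 * \<rho> e \<zeta> \<zeta>) * (w \<tau>)\<^sup>2"
      by (simp add: power2_eq_square algebra_simps)
    then show ?thesis using w0 by (simp add: c_def real_sqrt_mult)
  qed
  have len: "c * l1 = integral {0..1} (\<lambda>\<tau>. \<nu> (u \<tau> + (k * w \<tau>) *\<^sub>R \<zeta>))" by (simp add: \<nu>_eq l1_def)
  have start: "e \<in> (\<lambda>\<tau>. \<gamma> \<tau> \<odot> \<iota> (\<epsilon> (\<theta> \<tau>))) ` {0..1}"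
    by (rule image_eqI[OF _ \<gamma>(3)]) (simp only: \<theta>_ab \<epsilon>(1) \<iota>_x0 \<gamma>(5) mul_cancel)
  have fin: "p \<odot> \<iota> (\<epsilon> t) \<in> (\<lambda>\<tau>. \<gamma> \<tau> \<odot> \<iota> (\<epsilon> (\<theta> \<tau>))) ` {0..1}"
    by (rule image_eqI[OF _ \<gamma>(4)]) (simp only: \<theta>_ab \<gamma>(6))
  have "c * l1 \<in> lengths (\<Delta> e) (p \<odot> \<iota> (\<epsilon> t))"
    unfolding lengths_def
    by (intro CollectI exI[of _ "\<lambda>\<tau>. \<gamma> \<tau> \<odot> \<iota> (\<epsilon> (\<theta> \<tau>))"] exI[of _ "\<lambda>\<tau>. u \<tau> + (k * w \<tau>) *\<^sub>R \<zeta>"] conjI allI)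
      (rule len dev in\<Delta> start fin)+
  moreover have "(c * l1)\<^sup>2 \<le> l\<^sup>2 + t\<^sup>2 * \<rho> e \<zeta> \<zeta>"
  proof -
    have "c\<^sup>2 = 1 + k\<^sup>2 * \<rho> e \<zeta> \<zeta>" using \<zeta>0 by (simp add: c_def)
    moreover have "k\<^sup>2 * l1\<^sup>2 = t\<^sup>2"
    proof -
      have "l1\<^sup>2 = D\<^sup>2" using D(1) by (metis power2_abs)
      then show ?thesis using D(2) by (simp add: k_def power_divide)
    qed
    ultimately have "(c * l1)\<^sup>2 = l1\<^sup>2 + t\<^sup>2 * \<rho> e \<zeta> \<zeta>"
      by (simp add: power_mult_distrib algebra_simps)
    moreover have "l1\<^sup>2 \<le> l\<^sup>2" using l1 by (intro power_mono) auto
    ultimately show ?thesis by simp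
  qed
  ultimately show ?thesis by blast
qed


text \<open>The derivative of \<open>Ad\<close> in the central direction \<open>\<zeta>\<close> vanishes.\<close>

lemma Ad_along_integral_curve:
  assumes \<zeta>: "\<zeta> \<in> derived_algebra" and \<epsilon>: "\<epsilon> 0 = x0" "\<And>s. s \<in> {-\<delta>..\<delta>} \<Longrightarrow> \<epsilon> s \<in> idom"
      "\<And>s. s \<in> {-\<delta><..<\<delta>} \<Longrightarrow> (\<epsilon> has_vector_derivative M (\<epsilon> s) \<zeta>) (at s)"
    and s: "s \<in> {-\<delta><..<\<delta>}"
  shows "Ad (\<iota> (\<epsilon> s)) v = v"
proof -
  have "((\<lambda>s. Ad (\<iota> (\<epsilon> s)) v) has_derivative (\<lambda>h. 0)) (at t within {-\<delta><..<\<delta>})" if t: "t \<in> {-\<delta><..<\<delta>}" for t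
  proof -
    have d: "\<epsilon> t \<in> idom" using \<epsilon>(2) t by auto
    have "((\<lambda>y. Ad (e \<odot> \<iota> y) v) has_derivative (\<lambda>h. B (K (\<epsilon> t) h) v)) (at (\<epsilon> t))"
      by (rule left_deriv_chart[OF d Ad_left_deriv2])
    from has_vector_derivative_compose_deriv[OF \<epsilon>(3)[OF t] this]
    have "((\<lambda>s. Ad (\<iota> (\<epsilon> s)) v) has_vector_derivative 0) (at t)"
      by (simp add: K_M[OF d] B_derived(2)[OF \<zeta>])
    then show ?thesis unfolding has_vector_derivative_def by (simp add: has_derivative_at_withinI)
  qed
  from has_derivative_zero_unique[OF _ this, of s 0] s
  have "Ad (\<iota> (\<epsilon> s)) v = Ad (\<iota> (\<epsilon> 0)) v" by force
  then show ?thesis by (simp only: \<epsilon>(1) \<iota>_x0 Ad_e)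
qed

text \<open>On \<open>\<zeta>\<close> both summands of \<open>\<Omega> \<zeta>\<close> have the value \<open>\<zeta> \<bullet> \<zeta>\<close>, as \<open>Ad\<close> fixes \<open>\<zeta>\<close>.\<close>

lemma primitive_along_integral_curve:
  assumes \<psi>: "\<And>q. left_deriv \<psi> q (\<Omega> \<zeta> q)"
    and \<zeta>: "\<zeta> \<in> derived_algebra" and \<epsilon>: "\<epsilon> 0 = x0" "\<And>s. s \<in> {-\<delta>..\<delta>} \<Longrightarrow> \<epsilon> s \<in> idom"
      "\<And>s. s \<in> {-\<delta><..<\<delta>} \<Longrightarrow> (\<epsilon> has_vector_derivative M (\<epsilon> s) \<zeta>) (at s)"
    and s: "s \<in> {-\<delta><..<\<delta>}"
  shows "\<psi> (p \<odot> \<iota> (\<epsilon> s)) = \<psi> p + 2 * s * (\<zeta> \<bullet> \<zeta>)"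
proof -
  let ?f = "\<lambda>s. \<psi> (p \<odot> \<iota> (\<epsilon> s)) - 2 * s * (\<zeta> \<bullet> \<zeta>)"
  have "(?f has_derivative (\<lambda>h. 0)) (at t within {-\<delta><..<\<delta>})" if t: "t \<in> {-\<delta><..<\<delta>}" for t
  proof -
    have d: "\<epsilon> t \<in> idom" using \<epsilon>(2) t by auto
    have "\<Omega> \<zeta> (p \<odot> \<iota> (\<epsilon> t)) \<zeta> = 2 * (\<zeta> \<bullet> \<zeta>)" unfolding \<Omega>_def Ad_derived[OF \<zeta>] by simp
    moreover have "((\<lambda>y. \<psi> (p \<odot> \<iota> y)) has_derivative (\<lambda>h. \<Omega> \<zeta> (p \<odot> \<iota> (\<epsilon> t)) (K (\<epsilon> t) h))) (at (\<epsilon> t))"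
      by (rule left_deriv_chart[OF d \<psi>])
    from has_vector_derivative_compose_deriv[OF \<epsilon>(3)[OF t] this]
    have "((\<lambda>s. \<psi> (p \<odot> \<iota> (\<epsilon> s))) has_vector_derivative \<Omega> \<zeta> (p \<odot> \<iota> (\<epsilon> t)) \<zeta>) (at t)"
      by (simp only: K_M[OF d])
    moreover have "((\<lambda>s. 2 * s * (\<zeta> \<bullet> \<zeta>)) has_vector_derivative 2 * (\<zeta> \<bullet> \<zeta>)) (at t)"
      by (auto intro!: derivative_eq_intros simp: has_real_derivative_iff_has_vector_derivative[symmetric])
    ultimately have "(?f has_vector_derivative 2 * (\<zeta> \<bullet> \<zeta>) - 2 * (\<zeta> \<bullet> \<zeta>)) (at t)"
      by (intro has_vector_derivative_diff) simp_all
    then show ?thesis unfolding has_vector_derivative_def by (simp add: has_derivative_at_withinI)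
  qed
  from has_derivative_zero_unique[OF _ this, of s 0] s
  have "?f s = ?f 0" by force
  then show ?thesis by (simp add: \<epsilon>(1) \<iota>_x0)
qed

text \<open>The powers are reached by moving in the direction \<open>\<zeta>\<close>, which is horizontal for \<open>\<Delta>\<close>.\<close>

lemma lengths_powers_nonempty:
  assumes \<epsilon>: "\<epsilon> 0 = x0" "\<And>s. s \<in> {-\<delta>..\<delta>} \<Longrightarrow> \<epsilon> s \<in> idom" "L-lipschitz_on {-\<delta>..\<delta>} \<epsilon>"
      "\<And>s. s \<in> {-\<delta><..<\<delta>} \<Longrightarrow> (\<epsilon> has_vector_derivative M (\<epsilon> s) \<zeta>) (at s)"
    and Ad_id: "\<And>s v. s \<in> {-\<delta><..<\<delta>} \<Longrightarrow> Ad (\<iota> (\<epsilon> s)) v = v"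
    and \<zeta>: "\<zeta> \<in> \<Delta> e" and t: "0 < t" "t < \<delta>"
  shows "lengths (\<Delta> e) (((\<lambda>p. p \<odot> \<iota> (\<epsilon> t)) ^^ j) e) \<noteq> {}"
proof -
  define R where "R p \<longleftrightarrow> (\<exists>\<gamma> u. develops \<gamma> u \<and> (\<forall>t. u t \<in> \<Delta> e) \<and> \<gamma> 0 = e \<and> \<gamma> 1 = p)" for p
  have "R (((\<lambda>p. p \<odot> \<iota> (\<epsilon> t)) ^^ j) e)"
  proof (induction j)
    case 0
    have "left_vel (\<lambda>_. e) t 0" for t unfolding left_vel_def by (rule has_vector_derivative_const)
    moreover have "abs_continuous_curve A (\<lambda>_. e)"
      unfolding abs_continuous_curve_def o_def by (auto intro: abs_continuous_on_const)
    ultimately have "develops (\<lambda>_. e) (\<lambda>_. 0)"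
      unfolding develops_def using negligible_empty by blast
    then show ?case using zero_in_\<Delta> by (auto simp: R_def)
  next
    case (Suc j)
    then obtain \<gamma> u where \<gamma>: "develops \<gamma> u" "\<And>t. u t \<in> \<Delta> e" "\<gamma> 0 = e" "\<gamma> 1 = ((\<lambda>p. p \<odot> \<iota> (\<epsilon> t)) ^^ j) e"
      unfolding R_def by blast
    have "abs_continuous_on 0 1 (\<lambda>\<tau>. integral {0..\<tau>} (\<lambda>_. 1 :: real))"
      by (rule abs_continuous_on_indefinite_integral) (simp_all add: integrable_on_const)
    then have ac: "abs_continuous_on 0 1 (\<lambda>\<tau>. t * \<tau>)"
      by (rule abs_continuous_on_dominated[where C=t]) (use t in \<open>auto simp: right_diff_distrib[symmetric] abs_mult\<close>)
    have "t * \<tau> \<in> {-\<delta><..<\<delta>}" if "\<tau> \<in> {0..1}" for \<tau>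
    proof -
      have "0 \<le> t * \<tau>" "t * \<tau> \<le> t * 1" using t that by (auto intro!: mult_left_mono simp del: mult_1_right)
      then show ?thesis using t unfolding greaterThanLessThan_iff by linarith
    qed
    then have "develops (\<lambda>\<tau>. \<gamma> \<tau> \<odot> \<iota> (\<epsilon> (t * \<tau>))) (\<lambda>\<tau>. u \<tau> + t *\<^sub>R \<zeta>)"
      by (intro develops_mul_central[OF \<gamma>(1) \<epsilon>(2-4) Ad_id _ ac _ negligible_empty])
        (auto intro!: continuous_intros derivative_eq_intros simp: has_real_derivative_iff_has_vector_derivative[symmetric])
    moreover have "u \<tau> + t *\<^sub>R \<zeta> \<in> \<Delta> e" for \<tau>
      by (rule subspace_add[OF subspace_\<Delta> \<gamma>(2) subspace_scale[OF subspace_\<Delta> \<zeta>]])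
    moreover have "\<gamma> 0 \<odot> \<iota> (\<epsilon> (t * 0)) = e" by (simp only: mult_zero_right \<epsilon>(1) \<iota>_x0 \<gamma>(3) mul_cancel)
    moreover have "\<gamma> 1 \<odot> \<iota> (\<epsilon> (t * 1)) = ((\<lambda>p. p \<odot> \<iota> (\<epsilon> t)) ^^ Suc j) e" using \<gamma>(4) by simp
    ultimately show ?case unfolding R_def by blast
  qed
  then obtain \<gamma> u where "develops \<gamma> u" "\<And>t. u t \<in> \<Delta> e" "\<gamma> 0 = e" "\<gamma> 1 = ((\<lambda>p. p \<odot> \<iota> (\<epsilon> t)) ^^ j) e"
    unfolding R_def by blast
  then have "integral {0..1} (\<lambda>t. \<nu> (u t)) \<in> lengths (\<Delta> e) (((\<lambda>p. p \<odot> \<iota> (\<epsilon> t)) ^^ j) e)"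
    unfolding lengths_def by (intro CollectI exI[of _ \<gamma>] exI[of _ u] conjI allI image_eqI[of _ _ 0] image_eqI[of _ _ 1]) auto
  then show ?thesis by blast
qed

section \<open>Conclusion\<close>

text \<open>Otherwise take the powers \<open>g n\<close> of a short central element in the direction of \<open>\<zeta>\<close>. By
  \<open>lengths_mul_central\<close> and the hypothesis, the square of \<open>d\<^sub>\<infinity>(e, g n)\<close> eventually grows by at most
  \<open>t\<^sup>2 (k + 1)\<close> in each step, whereas \<open>primitive_growth\<close> forces growth proportional to \<open>t\<close>.\<close>

theorem \<Delta>_meets_derived_trivially:
  assumes lim: "((\<lambda>(p, q). \<bar>(asymptotic_dist A mul e \<Delta> \<rho> p q)\<^sup>2 - (sr_dist A \<Delta> \<rho> p q)\<^sup>2\<bar>) \<longlongrightarrow> 0)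
      (filtercomap (\<lambda>(p, q). sr_dist A \<Delta> \<rho> p q) at_top)"
  shows "\<Delta> e \<inter> derived_algebra \<subseteq> {0}"
proof (rule ccontr)
  assume "\<not> \<Delta> e \<inter> derived_algebra \<subseteq> {0}"
  then obtain \<zeta> where \<zeta>: "\<zeta> \<in> \<Delta> e \<inter> derived_algebra" "\<zeta> \<noteq> 0" by blast
  then have \<zeta>\<Delta>: "\<zeta> \<in> \<Delta> e" and \<zeta>D: "\<zeta> \<in> derived_algebra" by auto
  define d where "d p = Inf (lengths (\<Delta> e) p)" for p
  \<comment> \<open>\<open>dV\<close> is the asymptotic distance from the identity.\<close>
  define dV where "dV p = Inf (lengths V p)" for p
  have d: "sr_dist A \<Delta> \<rho> e p = d p" for p
    unfolding d_def by (rule sr_dist_eq_Inf_lengths[OF \<Delta>_eq order_refl zero_in_\<Delta>])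
  have dV: "asymptotic_dist A mul e \<Delta> \<rho> e p = dV p" for p
    unfolding dV_def asymptotic_dist_def
    by (rule sr_dist_eq_Inf_lengths[OF asymptotic_distribution_eq V_sub zero_in_V])
  obtain \<psi> where \<psi>: "\<And>q. left_deriv \<psi> q (\<Omega> \<zeta> q)" by (rule primitive_of_\<Omega>[of \<zeta>]) blast
  obtain C where C: "C > 0" "\<And>p l. l \<in> lengths (\<Delta> e) p \<Longrightarrow> \<bar>\<psi> p - \<psi> e\<bar> \<le> C * (l + l\<^sup>2)"
    by (rule primitive_growth[OF \<psi>]) blast
  obtain \<epsilon> \<delta> L where \<epsilon>: "\<delta> > 0" "\<epsilon> 0 = x0" "\<And>s. s \<in> {-\<delta>..\<delta>} \<Longrightarrow> \<epsilon> s \<in> idom" "L-lipschitz_on {-\<delta>..\<delta>} \<epsilon>"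
      "\<And>s. s \<in> {-\<delta><..<\<delta>} \<Longrightarrow> (\<epsilon> has_vector_derivative M (\<epsilon> s) \<zeta>) (at s)"
    by (rule short_integral_curve[of \<zeta>]) blast
  have Ad_id: "Ad (\<iota> (\<epsilon> s)) v = v" if "s \<in> {-\<delta><..<\<delta>}" for s v
    by (rule Ad_along_integral_curve[OF \<zeta>D \<epsilon>(2,3,5) that])
  define \<mu> where "\<mu> = \<zeta> \<bullet> \<zeta>"
  define k where "k = \<rho> e \<zeta> \<zeta>"
  have \<mu>: "\<mu> > 0" using \<zeta>(2) by (simp add: \<mu>_def)
  have k: "k > 0" using \<rho>_pos[OF \<zeta>\<Delta> \<zeta>(2)] by (simp add: k_def)
  \<comment> \<open>For small \<open>t\<close> the cost \<open>t\<^sup>2 (k + 1)\<close> of a step is smaller than the growth \<open>t \<mu> / C\<close> that \<open>\<psi>\<close> enforces.\<close>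
  define t where "t = min (\<delta> / 2) (\<mu> / (2 * C * (k + 1)))"
  have t: "0 < t" "t < \<delta>" "t * (k + 1) < \<mu> / C"
  proof -
    show "0 < t" "t < \<delta>" using \<epsilon>(1) \<mu> C(1) k by (auto simp: t_def)
    have "t * (k + 1) \<le> \<mu> / (2 * C * (k + 1)) * (k + 1)" using k by (intro mult_right_mono) (auto simp: t_def)
    also have "\<dots> = \<mu> / (2 * C)" using k by simp
    also have "\<dots> < \<mu> / C" using \<mu> C(1) by (simp add: field_simps)
    finally show "t * (k + 1) < \<mu> / C" .
  qed
  have t\<delta>: "t \<in> {-\<delta><..<\<delta>}" using t by auto
  define g where "g n = ((\<lambda>p. p \<odot> \<iota> (\<epsilon> t)) ^^ n) e" for n
  have g_Suc: "g (Suc n) = g n \<odot> \<iota> (\<epsilon> t)" for n by (simp add: g_def)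
  have \<psi>g: "\<psi> (g n) - \<psi> e = 2 * real n * t * \<mu>" for n
  proof (induction n)
    case (Suc n)
    then show ?case
      using primitive_along_integral_curve[OF \<psi> \<zeta>D \<epsilon>(2,3,5) t\<delta>, of "g n"]
      unfolding g_Suc \<mu>_def[symmetric] by (simp add: algebra_simps)
  qed (simp add: g_def)
  have ne: "lengths (\<Delta> e) (g n) \<noteq> {}" for n
    unfolding g_def by (rule lengths_powers_nonempty[OF \<epsilon>(2-5) Ad_id \<zeta>\<Delta> t(1,2)])
  have bdd: "bdd_below (lengths S p)" if "S \<subseteq> \<Delta> e" for S p
    using lengths_nonneg[OF that] by (meson bdd_belowI)
  \<comment> \<open>A curve to \<open>g n\<close> of length less than \<open>1\<close> would bound \<open>n\<close>; for the others \<open>l + l\<^sup>2 \<le> 2 l\<^sup>2\<close>.\<close>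
  have lower: "real n * (t * \<mu> / C) \<le> l\<^sup>2" if l: "l \<in> lengths (\<Delta> e) (g n)" and n: "C < real n * (t * \<mu>)" for l n
  proof -
    have l0: "0 \<le> l" using lengths_nonneg[OF order_refl l] .
    have "2 * (real n * (t * \<mu>)) \<le> C * (l + l\<^sup>2)" using C(2)[OF l] \<psi>g[of n] by simp
    moreover have "l \<ge> 1"
    proof (rule ccontr)
      assume "\<not> l \<ge> 1"
      then have "l + l\<^sup>2 \<le> 1 + 1" using l0 by (intro add_mono) (auto intro: power_le_one)
      then have "C * (l + l\<^sup>2) \<le> C * 2" using C(1) by (intro mult_left_mono) auto
      then show False using n calculation by simp
    qed
    then have "l \<le> l\<^sup>2" by (simp add: power2_eq_square)
    then have "C * (l + l\<^sup>2) \<le> C * (2 * l\<^sup>2)" using C(1) by (intro mult_left_mono) auto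
    ultimately have "real n * (t * \<mu>) \<le> C * l\<^sup>2" by simp
    then show ?thesis using C(1) by (simp add: field_simps)
  qed
  have d_lower: "real n * (t * \<mu> / C) \<le> (d (g n))\<^sup>2" if n: "C < real n * (t * \<mu>)" for n
  proof -
    have "sqrt (real n * (t * \<mu> / C)) \<le> d (g n)"
      unfolding d_def using lower[OF _ n] lengths_nonneg[OF order_refl]
      by (intro cInf_greatest ne) (simp add: real_le_lsqrt)
    moreover have "0 \<le> real n * (t * \<mu> / C)" using t(1) \<mu> C(1) by simp
    ultimately show ?thesis by (metis real_sqrt_ge_0_iff real_sqrt_pow2 power_mono)
  qed
  have d0: "0 \<le> d p" if "lengths (\<Delta> e) p \<noteq> {}" for p
    unfolding d_def using that lengths_nonneg[OF order_refl] by (intro cInf_greatest) auto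
  have "\<forall>\<^sub>F z in filtercomap (\<lambda>(p, q). sr_dist A \<Delta> \<rho> p q) at_top.
      dist (case z of (p, q) \<Rightarrow> \<bar>(asymptotic_dist A mul e \<Delta> \<rho> p q)\<^sup>2 - (sr_dist A \<Delta> \<rho> p q)\<^sup>2\<bar>) 0 < t\<^sup>2"
    by (rule tendstoD[OF lim]) (use t(1) in simp)
  then obtain R where R: "\<And>p q. R \<le> sr_dist A \<Delta> \<rho> p q \<Longrightarrow>
      \<bar>(asymptotic_dist A mul e \<Delta> \<rho> p q)\<^sup>2 - (sr_dist A \<Delta> \<rho> p q)\<^sup>2\<bar> < t\<^sup>2"
    unfolding eventually_filtercomap_at_top_linorder by auto
  define \<kappa> where "\<kappa> = (Inf {} :: real)"
  \<comment> \<open>The three summands serve the three claims about the \<open>n \<ge> n0\<close> below.\<close>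
  obtain n0 :: nat where n0: "(C + (\<bar>R\<bar> + 1)\<^sup>2 * C + (\<kappa>\<^sup>2 + t\<^sup>2) * C) / (t * \<mu>) < real n0"
    using reals_Archimedean2 by blast
  have big: "C < real n * (t * \<mu>)" "R \<le> d (g n)" "\<kappa>\<^sup>2 + t\<^sup>2 < real n * (t * \<mu> / C)" if n: "n \<ge> n0" for n
  proof -
    have pos: "0 < t * \<mu>" using t(1) \<mu> by simp
    have "(C + (\<bar>R\<bar> + 1)\<^sup>2 * C + (\<kappa>\<^sup>2 + t\<^sup>2) * C) / (t * \<mu>) < real n" using n0 n by linarith
    then have *: "C + (\<bar>R\<bar> + 1)\<^sup>2 * C + (\<kappa>\<^sup>2 + t\<^sup>2) * C < real n * (t * \<mu>)" using pos by (simp add: pos_divide_less_eq)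
    have nn: "0 \<le> (\<bar>R\<bar> + 1)\<^sup>2 * C" "0 \<le> (\<kappa>\<^sup>2 + t\<^sup>2) * C" using C(1) by auto
    show 1: "C < real n * (t * \<mu>)" using * nn by linarith
    have "(\<kappa>\<^sup>2 + t\<^sup>2) * C < real n * (t * \<mu>)" using * nn C(1) by linarith
    then show "\<kappa>\<^sup>2 + t\<^sup>2 < real n * (t * \<mu> / C)" using C(1) by (simp add: field_simps)
    have "(\<bar>R\<bar> + 1)\<^sup>2 * C < real n * (t * \<mu>)" using * nn C(1) by linarith
    then have "(\<bar>R\<bar> + 1)\<^sup>2 < real n * (t * \<mu> / C)" using C(1) by (simp add: field_simps)
    also have "\<dots> \<le> (d (g n))\<^sup>2" using d_lower[OF 1] .
    finally have "\<bar>R\<bar> + 1 < d (g n)" using d0[OF ne] by (rule power2_less_imp_less)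
    then show "R \<le> d (g n)" by linarith
  qed
  have close: "\<bar>(dV (g n))\<^sup>2 - (d (g n))\<^sup>2\<bar> < t\<^sup>2" if "n \<ge> n0" for n
    using R[of e "g n"] big(2)[OF that] unfolding d dV .
  \<comment> \<open>Without \<open>V\<close>-horizontal curves to \<open>g n\<close> the value of \<open>dV\<close> would be \<open>\<kappa>\<close>, which is too small.\<close>
  have neV: "lengths V (g n) \<noteq> {}" if n: "n \<ge> n0" for n
  proof
    assume "lengths V (g n) = {}"
    then have "dV (g n) = \<kappa>" by (simp add: dV_def \<kappa>_def)
    then have "(d (g n))\<^sup>2 < \<kappa>\<^sup>2 + t\<^sup>2" using close[OF n] by (simp add: abs_less_iff)
    then show False using d_lower[OF big(1)[OF n]] big(3)[OF n] by linarith
  qed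
  have lengths_V: "lengths V p \<subseteq> lengths (\<Delta> e) p" for p unfolding lengths_def using V_sub by blast
  have step: "(d (g (Suc n)))\<^sup>2 \<le> (dV (g n))\<^sup>2 + t\<^sup>2 * k" if n: "n \<ge> n0" for n
  proof -
    have pos: "l \<noteq> 0" if "l \<in> lengths V (g n)" for l
    proof
      assume "l = 0"
      then have "real n * (t * \<mu> / C) \<le> 0" using lower[of l n] big(1)[OF n] that lengths_V by auto
      then show False using big(3)[OF n] by (smt (verit) zero_le_power2)
    qed
    have "(d (g (Suc n)))\<^sup>2 \<le> l\<^sup>2 + t\<^sup>2 * k" if l: "l \<in> lengths V (g n)" for l
    proof -
      have "\<exists>l'\<in>lengths (\<Delta> e) (g n \<odot> \<iota> (\<epsilon> t)). l'\<^sup>2 \<le> l\<^sup>2 + t\<^sup>2 * \<rho> e \<zeta> \<zeta>"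
        by (rule lengths_mul_central[OF \<epsilon>(2-5) Ad_id \<zeta>(1) t(1,2) l pos])
      then obtain l' where l': "l' \<in> lengths (\<Delta> e) (g (Suc n))" "l'\<^sup>2 \<le> l\<^sup>2 + t\<^sup>2 * k"
        unfolding g_Suc k_def by blast
      have "d (g (Suc n)) \<le> l'" unfolding d_def by (rule cInf_lower[OF l'(1) bdd[OF order_refl]])
      then have "(d (g (Suc n)))\<^sup>2 \<le> l'\<^sup>2" using d0[OF ne] by (intro power_mono)
      then show ?thesis using l'(2) by linarith
    qed
    then have "sqrt ((d (g (Suc n)))\<^sup>2 - t\<^sup>2 * k) \<le> l" if "l \<in> lengths V (g n)" for l
      using that lengths_nonneg[OF V_sub that] by (intro real_le_lsqrt) (auto simp: algebra_simps)
    then have *: "sqrt ((d (g (Suc n)))\<^sup>2 - t\<^sup>2 * k) \<le> dV (g n)"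
      unfolding dV_def by (intro cInf_greatest neV n)
    show ?thesis
    proof (cases "(d (g (Suc n)))\<^sup>2 - t\<^sup>2 * k \<le> 0")
      case False
      then have "(d (g (Suc n)))\<^sup>2 - t\<^sup>2 * k = (sqrt ((d (g (Suc n)))\<^sup>2 - t\<^sup>2 * k))\<^sup>2" by simp
      also have "\<dots> \<le> (dV (g n))\<^sup>2" using * False by (intro power_mono) auto
      finally show ?thesis by simp
    next
      case True
      then show ?thesis using zero_le_power2[of "dV (g n)"] by linarith
    qed
  qed
  have upper: "(dV (g (n0 + j)))\<^sup>2 \<le> (dV (g n0))\<^sup>2 + real j * (t\<^sup>2 * (k + 1))" for j
  proof (induction j)
    case (Suc j)
    have "(dV (g (Suc (n0 + j))))\<^sup>2 \<le> (d (g (Suc (n0 + j))))\<^sup>2 + t\<^sup>2"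
      using close[of "Suc (n0 + j)"] by (simp add: abs_less_iff)
    also have "\<dots> \<le> (dV (g (n0 + j)))\<^sup>2 + t\<^sup>2 * k + t\<^sup>2" using step[of "n0 + j"] by simp
    also have "\<dots> \<le> (dV (g n0))\<^sup>2 + real j * (t\<^sup>2 * (k + 1)) + t\<^sup>2 * k + t\<^sup>2" using Suc by simp
    finally show ?case by (simp add: algebra_simps)
  qed simp
  define s where "s = t * (\<mu> / C - t * (k + 1))"
  have s: "s > 0" using t(1,3) by (simp add: s_def)
  have "real j * s \<le> (dV (g n0))\<^sup>2 + t\<^sup>2" for j
  proof -
    have "real j * (t * \<mu> / C) \<le> real (n0 + j) * (t * \<mu> / C)"
      using t(1) \<mu> C(1) by (intro mult_right_mono) auto
    also have "\<dots> \<le> (d (g (n0 + j)))\<^sup>2" by (rule d_lower[OF big(1)]) simp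
    also have "\<dots> \<le> (dV (g (n0 + j)))\<^sup>2 + t\<^sup>2" using close[of "n0 + j"] by (simp add: abs_less_iff)
    also have "\<dots> \<le> (dV (g n0))\<^sup>2 + real j * (t\<^sup>2 * (k + 1)) + t\<^sup>2" using upper[of j] by simp
    finally show ?thesis by (simp add: s_def power2_eq_square algebra_simps)
  qed
  moreover obtain j :: nat where "((dV (g n0))\<^sup>2 + t\<^sup>2) / s < real j" using reals_Archimedean2 by blast
  then have "(dV (g n0))\<^sup>2 + t\<^sup>2 < real j * s" using s by (simp add: pos_divide_less_eq)
  ultimately show False by (meson not_le)
qed

end

theorem corollary4p5:
  fixes A :: "('g::{t2_space,second_countable_topology}, 'a::euclidean_space) chart set"
    and mul :: "'g \<Rightarrow> 'g \<Rightarrow> 'g" and e :: 'g and iv :: "'g \<Rightarrow> 'g"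
    and \<Delta> :: "'g \<Rightarrow> 'a set" and \<rho> :: "'g \<Rightarrow> 'a \<Rightarrow> 'a \<Rightarrow> real"
  assumes "lie_group A mul e iv"
    and "simply_connected (UNIV :: 'g set)"
    and "two_step_nilpotent A mul e"
    and "sub_riemannian_structure A mul e \<Delta> \<rho>"
    and "((\<lambda>(p, q). \<bar>(asymptotic_dist A mul e \<Delta> \<rho> p q)\<^sup>2 - (sr_dist A \<Delta> \<rho> p q)\<^sup>2\<bar>) \<longlongrightarrow> 0)
           (filtercomap (\<lambda>(p, q). sr_dist A \<Delta> \<rho> p q) at_top)"
  shows "sr_dist A \<Delta> \<rho> = asymptotic_dist A mul e \<Delta> \<rho>"
proof -
  interpret sub_riemannian_two_step A mul e iv \<Delta> \<rho>
    by unfold_locales (rule assms)+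
  have zero: "\<Delta> e \<inter> derived_algebra \<subseteq> {0}" by (rule \<Delta>_meets_derived_trivially[OF assms(5)])
  have "V = \<Delta> e"
  proof (rule equalityI[OF V_sub], rule subsetI)
    fix v assume v: "v \<in> \<Delta> e"
    have "\<rho> e v w = 0" if "w \<in> \<Delta> e \<inter> derived_algebra" for w
    proof -
      have "w = 0" using that zero by blast
      then show ?thesis using \<rho>_sym[OF v zero_in_\<Delta>] \<rho>_zero[OF v] by simp
    qed
    then show "v \<in> V" using v by (simp add: V_def)
  qed
  then have "asymptotic_distribution A mul e \<Delta> \<rho> = \<Delta>"
    by (intro ext) (simp only: asymptotic_distribution_eq \<Delta>_eq[symmetric])
  then show ?thesis by (simp only: asymptotic_dist_def)
qed

end
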